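(* Consider the stationary hidden Markov model $(P,\pi,\Phi)$ with law $\mathbf{P}$ (see context). Suppose that: (Ergodicity) $\|\mathbf{P}^z(X_n\in\cdot)-\pi\|_{\mathrm{TV}}\to0$ as $n\to\infty$ for $\pi$-a.e. $z\in E$; (Nondegeneracy) there exist a probability measure $\varphi$ on $\mathcal{B}(F)$ and a strictly positive measurable function $g:E\times F\to]0,\infty[$ such that $\Phi(z,A)=\int I_A(u)g(z,u)\varphi(du)$ for all $A\in\mathcal{B}(F)$, $z\in E$. Then $$\bigcap_{n\ge0}\mathcal{F}^Y_+\vee\mathcal{F}^X_{[n,\infty[}=\mathcal{F}^Y_+\qquad\text{and}\qquad\bigcap_{n\ge0}\mathcal{F}^Y_0\vee\mathcal{F}^X_{-n}=\mathcal{F}^Y_0\qquad\mathbf{P}\text{-a.s.}$$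
   Context: Let $E,F$ be Polish spaces, $\Omega=E^{\mathbb{Z}}\times F^{\mathbb{Z}}$, with coordinate processes $X_n(x,y)=x(n)$, $Y_n(x,y)=y(n)$. $P:E\times\mathcal{B}(E)\to[0,1]$ is a probability kernel, $\pi$ a probability measure on $E$ with $\int P(z,A)\pi(dz)=\pi(A)$ for all $A$, and $\Phi:E\times\mathcal{B}(F)\to[0,1]$ a probability kernel. $\mathbf{P}$ is the law on $\Omega$ under which $(X_n)_{n\in\mathbb{Z}}$ is the stationary Markov chain with transition kernel $P$ and stationary law $\pi$ and, conditionally on $(X_n)_{n\in\mathbb{Z}}$, the $Y_n$ are independent with $Y_n\sim\Phi(X_n,\cdot)$. $\mathbf{P}^z$ is the law of $(X_n,Y_n)_{n\ge0}$ for the same model with $X_0=z$. Notation: $\mathcal{F}^Y_+=\sigma\{Y_k:k\ge0\}$, $\mathcal{F}^Y_0=\sigma\{Y_k:k\le0\}$, $\mathcal{F}^X_{[n,\infty[}=\sigma\{X_k:k\ge n\}$, $\mathcal{F}^X_{-n}=\sigma\{X_k:k\le-n\}$. The intersections are of the $\sigma$-fields $\mathcal{F}^Y_+\vee\mathcal{F}^X_{[n,\infty[}$ (resp. $\mathcal{F}^Y_0\vee\mathcal{F}^X_{-n}$) over $n\ge0$. Equality of $\sigma$-fields $\mathbf{P}$-a.s. means that they coincide up to $\mathbf{P}$-null sets (each set in one differs from some set in the other by a $\mathbf{P}$-null set). $\|\rho\|_{\mathrm{TV}}=\sup_{\|f\|_\infty\le1}|\int f\,d\rho|$. *)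

theory Defs
  imports "HOL-Probability.Probability"
begin

text \<open>
  Paths are pairs \<open>(x, y)\<close>, with time index \<open>int\<close> for the two-sided space and \<open>nat\<close> for the
  one-sided space; the class \<open>linordered_semidom\<close> covers both. A sigma-field on the path space
  is represented by its collection of sets.
\<close>

definition X :: "'i \<Rightarrow> ('i \<Rightarrow> 'e) \<times> ('i \<Rightarrow> 'f) \<Rightarrow> 'e" where
  "X n \<omega> = fst \<omega> n"

definition Y :: "'i \<Rightarrow> ('i \<Rightarrow> 'e) \<times> ('i \<Rightarrow> 'f) \<Rightarrow> 'f" where
  "Y n \<omega> = snd \<omega> n"

definition path_space ::
    "(('i \<Rightarrow> 'e::topological_space) \<times> ('i \<Rightarrow> 'f::topological_space)) measure" where
  "path_space = (\<Pi>\<^sub>M n\<in>UNIV. borel) \<Otimes>\<^sub>M (\<Pi>\<^sub>M n\<in>UNIV. borel)"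

definition FX :: "'i set \<Rightarrow> (('i \<Rightarrow> 'e::topological_space) \<times> ('i \<Rightarrow> 'f)) set set" where
  "FX T = sigma_sets UNIV {X k -` A | k A. k \<in> T \<and> A \<in> sets borel}"

definition FY :: "'i set \<Rightarrow> (('i \<Rightarrow> 'e) \<times> ('i \<Rightarrow> 'f::topological_space)) set set" where
  "FY T = sigma_sets UNIV {Y k -` B | k B. k \<in> T \<and> B \<in> sets borel}"

definition sigma_join :: "'a set set \<Rightarrow> 'a set set \<Rightarrow> 'a set set" where
  "sigma_join \<G> \<H> = sigma_sets UNIV (\<G> \<union> \<H>)"

definition eq_mod_null :: "'a measure \<Rightarrow> 'a set set \<Rightarrow> 'a set set \<Rightarrow> bool" where
  "eq_mod_null M \<G> \<H> \<longleftrightarrow>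
     (\<forall>A\<in>\<G>. \<exists>B\<in>\<H>. sym_diff A B \<in> null_sets M) \<and>
     (\<forall>B\<in>\<H>. \<exists>A\<in>\<G>. sym_diff A B \<in> null_sets M)"

definition prob_kernel ::
    "('a::topological_space \<Rightarrow> 'b::topological_space measure) \<Rightarrow> bool" where
  "prob_kernel K \<longleftrightarrow> K \<in> borel \<rightarrow>\<^sub>M prob_algebra borel"

definition invariant_law :: "('e::topological_space \<Rightarrow> 'e measure) \<Rightarrow> 'e measure \<Rightarrow> bool" where
  "invariant_law P \<pi> \<longleftrightarrow> (\<forall>A\<in>sets borel. (\<integral>z. measure (P z) A \<partial>\<pi>) = measure \<pi> A)"

text \<open>
  The measure \<open>M\<close> on path space is the law of a hidden Markov model with transition kernel \<open>P\<close>
  and observation kernel \<open>\<Phi>\<close>: the process \<open>X\<close> is Markov with kernel \<open>P\<close>, and conditionally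
  on the whole process \<open>X\<close> the \<open>Y\<^sub>n\<close> are independent with \<open>Y\<^sub>n \<sim> \<Phi>(X\<^sub>n, \<cdot>)\<close>. The
  marginal law of \<open>X\<close> at a fixed time is left open; see the two definitions that follow, each of
  which determines \<open>M\<close> uniquely.
\<close>

definition hmm :: "('e::polish_space \<Rightarrow> 'e measure) \<Rightarrow> ('e \<Rightarrow> 'f::polish_space measure) \<Rightarrow>
    (('i::linordered_semidom \<Rightarrow> 'e) \<times> ('i \<Rightarrow> 'f)) measure \<Rightarrow> bool" where
  "hmm P \<Phi> M \<longleftrightarrow>
     prob_space M \<and> sets M = sets path_space \<and>
     (\<forall>n. \<forall>A\<in>sets borel. AE \<omega> in M.
        real_cond_exp M (sigma UNIV (FX {..n})) (indicator {\<omega>. X (n + 1) \<omega> \<in> A}) \<omega>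
          = measure (P (X n \<omega>)) A) \<and>
     (\<forall>J B. finite J \<longrightarrow> (\<forall>j\<in>J. B j \<in> sets borel) \<longrightarrow> (AE \<omega> in M.
        real_cond_exp M (sigma UNIV (FX UNIV)) (indicator {\<omega>. \<forall>j\<in>J. Y j \<omega> \<in> B j}) \<omega>
          = (\<Prod>j\<in>J. measure (\<Phi> (X j \<omega>)) (B j))))"

definition stationary_hmm :: "('e::polish_space \<Rightarrow> 'e measure) \<Rightarrow> 'e measure \<Rightarrow>
    ('e \<Rightarrow> 'f::polish_space measure) \<Rightarrow> ((int \<Rightarrow> 'e) \<times> (int \<Rightarrow> 'f)) measure \<Rightarrow> bool" where
  "stationary_hmm P \<pi> \<Phi> M \<longleftrightarrow> hmm P \<Phi> M \<and> (\<forall>n. distr M borel (X n) = \<pi>)"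

definition hmm_from :: "('e::polish_space \<Rightarrow> 'e measure) \<Rightarrow> ('e \<Rightarrow> 'f::polish_space measure) \<Rightarrow>
    'e \<Rightarrow> ((nat \<Rightarrow> 'e) \<times> (nat \<Rightarrow> 'f)) measure \<Rightarrow> bool" where
  "hmm_from P \<Phi> z M \<longleftrightarrow> hmm P \<Phi> M \<and> distr M borel (X 0) = return borel z"

text \<open>The total variation norm of \<open>\<mu> - \<nu>\<close>, for finite Borel measures \<open>\<mu>\<close> and \<open>\<nu>\<close>.\<close>

definition tv_dist :: "'a::topological_space measure \<Rightarrow> 'a measure \<Rightarrow> real" where
  "tv_dist \<mu> \<nu> =
     (SUP f\<in>{f \<in> borel_measurable borel. \<forall>x. \<bar>f x\<bar> \<le> 1}. \<bar>(\<integral>x. f x \<partial>\<mu>) - (\<integral>x. f x \<partial>\<nu>)\<bar>)"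

definition nondegenerate ::
    "('e::topological_space \<Rightarrow> 'f::topological_space measure) \<Rightarrow> bool" where
  "nondegenerate \<Phi> \<longleftrightarrow>
     (\<exists>\<phi> g. prob_space \<phi> \<and> sets \<phi> = sets borel \<and>
        (\<lambda>(z, u). g z u :: real) \<in> borel_measurable (borel \<Otimes>\<^sub>M borel) \<and>
        (\<forall>z u. 0 < g z u) \<and>
        (\<forall>z. \<forall>A\<in>sets borel.
           emeasure (\<Phi> z) A = (\<integral>\<^sup>+u. indicator A u * ennreal (g z u) \<partial>\<phi>)))"

end

theory Submission
  imports Defs
begin

text \<open>
  Let \<open>A\<close> belong to the first intersection. Given \<open>X\<^sub>N\<close> and the observations, past and future of
  the signal are independent, so \<open>A\<close>, which is approximated by events of the signal up to time \<open>N\<close>,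
  is also approximated by events \<open>{(X\<^sub>N, Y) \<in> D\<^sub>N}\<close>. Shifting by \<open>N\<close>, stationarity yields sets
  such that, for every fixed \<open>n\<close>, the events \<open>{(X\<^sub>0, Y) \<in> H\<^sub>N}\<close> and \<open>{(X\<^sub>n, Y) \<in> H'\<^sub>N}\<close>
  eventually agree almost surely along a subsequence.

  Nondegeneracy allows finitely many observations to be resampled without changing null sets, and
  ergodicity decouples distant times in total variation. Together they show that the law of
  \<open>(X\<^sub>0, X\<^sub>n, Y)\<close> has the same null sets as the product of the laws of \<open>(X\<^sub>0, X\<^sub>n)\<close> and \<open>Y\<close>;
  moreover the law of \<open>(X\<^sub>0, X\<^sub>n)\<close> tends to \<open>\<pi> \<otimes> \<pi>\<close>. Hence two independent starting points
  \<open>x, x'\<close> can be compared through a common value of \<open>X\<^sub>n\<close>: for almost every \<open>y\<close>, the points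
  \<open>(x, y)\<close> and \<open>(x', y)\<close> eventually agree on membership in \<open>H\<^sub>N\<close>. So \<open>H\<^sub>N\<close> may be replaced by
  a set depending on \<open>y\<close> only, and \<open>A\<close> is an event of the observations up to a null set. The
  argument is symmetric in time and gives the second identity as well.
\<close>

section \<open>Approximation and conditional independence in finite measure spaces\<close>

text \<open>An intersection of sigma-fields need not commute with a join, even modulo null sets, and
  mixing of the signal need not survive conditioning on the observations. The obstacle is that total
  variation bounds only reach events that ignore a block of observations around the states, while
  null sets of the full observation sequence have to be compared. Resampling closes this gap:
  averaging an indicator over the observations in the block yields a function that ignores the
  block, and its integral vanishes exactly when the set is null. The remaining error tends to 0 as
  the block grows.

  Conditional independence is always stated as an identity of integrals in which an indicator is
  replaced by a function of the present. This form is symmetric in past and future, which is why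
  convergence of the forward chain serves both directions of time.

  The shift is needed because the approximating sets are read at times that move to infinity. After
  it they are read at fixed times; they then no longer approximate \<open>A\<close>, so only
  distances between them are kept until the final shift back.\<close>

lemma factor_density:
  fixes Z :: "'a \<Rightarrow> 'b"
  assumes M: "finite_measure M" and Z[measurable]: "Z \<in> M \<rightarrow>\<^sub>M N" and A[measurable]: "A \<in> sets M"
  obtains a :: "'b \<Rightarrow> ennreal" where "a \<in> borel_measurable N"
    "\<And>\<psi>. \<psi> \<in> borel_measurable N \<Longrightarrow>
      (\<integral>\<^sup>+x. indicator A x * \<psi> (Z x) \<partial>M) = (\<integral>\<^sup>+x. a (Z x) * \<psi> (Z x) \<partial>M)"
proof -
  \<comment> \<open>The derivative of \<open>?R\<close> with respect to \<open>?L\<close> is a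
    version of the conditional probability of \<open>A\<close> given \<open>Z\<close>, written as a
    function of the value of \<open>Z\<close>.\<close>
  let ?L = "distr M N Z" and ?R = "distr (density M (indicator A)) N Z"
  interpret L: finite_measure ?L by (rule finite_measure.finite_measure_distr[OF M Z])
  have "absolutely_continuous ?L ?R"
    unfolding absolutely_continuous_def
  proof
    fix D assume "D \<in> null_sets ?L"
    then have [measurable]: "D \<in> sets N" and 0: "emeasure M (Z -` D \<inter> space M) = 0"
      by (auto simp: null_sets_def emeasure_distr)
    have "emeasure ?R D = (\<integral>\<^sup>+x. indicator A x * indicator (Z -` D \<inter> space M) x \<partial>M)"
      by (subst emeasure_distr) (auto simp: emeasure_density)
    also have "\<dots> \<le> (\<integral>\<^sup>+x. indicator (Z -` D \<inter> space M) x \<partial>M)"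
      by (intro nn_integral_mono) (auto split: split_indicator)
    finally show "D \<in> null_sets ?R" using 0 by (simp add: null_sets_def)
  qed
  then obtain a where a[measurable]: "a \<in> borel_measurable ?L" and eq: "density ?L a = ?R"
    using L.Radon_Nikodym[of ?R] by auto
  have "(\<integral>\<^sup>+x. indicator A x * \<psi> (Z x) \<partial>M) = (\<integral>\<^sup>+x. a (Z x) * \<psi> (Z x) \<partial>M)"
    if [measurable]: "\<psi> \<in> borel_measurable N" for \<psi>
  proof -
    have "(\<integral>\<^sup>+x. indicator A x * \<psi> (Z x) \<partial>M) = (\<integral>\<^sup>+z. \<psi> z \<partial>?R)"
      by (subst nn_integral_distr) (auto simp: nn_integral_density)
    also have "\<dots> = (\<integral>\<^sup>+x. a (Z x) * \<psi> (Z x) \<partial>M)"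
      using a by (subst eq[symmetric]) (simp add: nn_integral_density nn_integral_distr)
    finally show ?thesis .
  qed
  then show ?thesis using a that[of a] by simp
qed

text \<open>Both sides integrate \<open>\<xi>\<close> against measures on \<open>F\<close> that
  agree on a generating pi-system; its member \<open>UNIV\<close> makes the total masses equal and
  finite. Identities of conditional expectations thus need to be checked on cylinders only.\<close>

lemma emeasure_Int_eq_lift:
  assumes M: "finite_measure M" "space M = UNIV" and F: "subalgebra M F" "sets F = sigma_sets UNIV G"
    and G: "Int_stable G" "UNIV \<in> G"
    and A[measurable]: "A \<in> sets M" and h[measurable]: "h \<in> borel_measurable M"
    and eq: "\<And>V. V \<in> G \<Longrightarrow> emeasure M (A \<inter> V) = (\<integral>\<^sup>+x. indicator V x * h x \<partial>M)"
    and \<xi>: "\<xi> \<in> borel_measurable F"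
  shows "(\<integral>\<^sup>+x. indicator A x * \<xi> x \<partial>M) = (\<integral>\<^sup>+x. h x * \<xi> x \<partial>M)"
proof -
  interpret finite_measure M by fact
  have id[measurable]: "(\<lambda>x. x) \<in> M \<rightarrow>\<^sub>M F"
    using F unfolding subalgebra_def measurable_def by auto
  have spF: "space F = UNIV" using F M by (simp add: subalgebra_def)
  have GM: "V \<in> sets F \<and> V \<in> sets M" if "V \<in> G" for V
    using that F by (auto simp: subalgebra_def)
  have e1: "emeasure (distr (density M (indicator A)) F (\<lambda>x. x)) V = emeasure M (A \<inter> V)"
    if "V \<in> G" for V
  proof -
    have [measurable]: "V \<in> sets F" "V \<in> sets M" using GM[OF that] by auto
    have "emeasure (distr (density M (indicator A)) F (\<lambda>x. x)) V = emeasure (density M (indicator A)) V"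
      using M by (subst emeasure_distr) auto
    also have "\<dots> = (\<integral>\<^sup>+x. indicator (A \<inter> V) x \<partial>M)"
      by (simp add: emeasure_density indicator_inter_arith del: nn_integral_indicator)
    finally show ?thesis by simp
  qed
  have e2: "emeasure (distr (density M h) F (\<lambda>x. x)) V = (\<integral>\<^sup>+x. indicator V x * h x \<partial>M)"
    if "V \<in> G" for V
    using GM[OF that] M by (subst emeasure_distr) (auto simp: emeasure_density mult.commute)
  have "distr (density M (indicator A)) F (\<lambda>x. x) = distr (density M h) F (\<lambda>x. x)"
  proof (rule measure_eqI_generator_eq[where E=G and \<Omega>=UNIV and A="\<lambda>_. UNIV"])
    show "emeasure (distr (density M (indicator A)) F (\<lambda>x. x)) V =
      emeasure (distr (density M h) F (\<lambda>x. x)) V" if "V \<in> G" for V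
      using e1 e2 eq that by simp
    show "emeasure (distr (density M (indicator A)) F (\<lambda>x. x)) UNIV \<noteq> \<infinity>" for i :: nat
      using e1[OF G(2)] emeasure_finite by simp
  qed (use G F in auto)
  moreover have "\<xi> \<in> borel_measurable M" using measurable_compose[OF id \<xi>] by simp
  moreover have "(\<integral>\<^sup>+x. \<xi> x \<partial>distr (density M (indicator A)) F (\<lambda>x. x)) = (\<integral>\<^sup>+x. indicator A x * \<xi> x \<partial>M)"
    using \<xi> calculation(2) by (subst nn_integral_distr) (auto simp: nn_integral_density)
  moreover have "(\<integral>\<^sup>+x. \<xi> x \<partial>distr (density M h) F (\<lambda>x. x)) = (\<integral>\<^sup>+x. h x * \<xi> x \<partial>M)"
    using \<xi> calculation(2) by (subst nn_integral_distr) (auto simp: nn_integral_density)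
  ultimately show ?thesis by simp
qed

lemma emeasure_Int_eq_lift_sets:
  assumes "finite_measure M" "space M = UNIV" "subalgebra M F"
    and "A \<in> sets M" "h \<in> borel_measurable M"
    and "\<And>V. V \<in> sets F \<Longrightarrow> emeasure M (A \<inter> V) = (\<integral>\<^sup>+x. indicator V x * h x \<partial>M)"
    and "\<xi> \<in> borel_measurable F"
  shows "(\<integral>\<^sup>+x. indicator A x * \<xi> x \<partial>M) = (\<integral>\<^sup>+x. h x * \<xi> x \<partial>M)"
proof (rule emeasure_Int_eq_lift[where G="sets F"])
  show "sets F = sigma_sets UNIV (sets F)" using assms
    by (metis sets.sigma_sets_eq subalgebra_def)
  show "UNIV \<in> sets F" using assms by (metis sets.top subalgebra_def)
qed (use assms in \<open>auto simp: Int_stable_def\<close>)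

text \<open>Conditional independence of \<open>F\<close> and \<open>H\<close> given
  \<open>Z\<close>, in integral form. Let \<open>a\<close> be the conditional probability of
  \<open>U\<close> given \<open>Z\<close>. The integrals of 1_U 1_V, 1_U s(Z), a(Z) s(Z) and 1_V
  a(Z) coincide in turn; the last link tests the hypothesis on \<open>V\<close> with a(Z), which is
  allowed because \<open>Z\<close> is measurable for \<open>F\<close>.\<close>

lemma factor_cond_indep:
  fixes Z :: "'a \<Rightarrow> 'b"
  assumes M: "finite_measure M" "space M = UNIV"
    and F: "subalgebra M F" and Z: "Z \<in> F \<rightarrow>\<^sub>M N"
    and H: "subalgebra M H" "sets H = sigma_sets UNIV G" "Int_stable G" "UNIV \<in> G"
    and eq: "\<And>V. V \<in> G \<Longrightarrow> \<exists>s\<in>borel_measurable N. \<forall>U\<in>sets F.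
      emeasure M (U \<inter> V) = (\<integral>\<^sup>+x. indicator U x * s (Z x) \<partial>M)"
    and U: "U \<in> sets F"
  shows "\<exists>a\<in>borel_measurable N. \<forall>\<xi>\<in>borel_measurable H.
      (\<integral>\<^sup>+x. indicator U x * \<xi> x \<partial>M) = (\<integral>\<^sup>+x. a (Z x) * \<xi> x \<partial>M)"
proof -
  have ZM[measurable]: "Z \<in> M \<rightarrow>\<^sub>M N" by (rule measurable_from_subalg[OF F Z])
  have UM[measurable]: "U \<in> sets M" using F U by (auto simp: subalgebra_def)
  obtain a where a[measurable]: "a \<in> borel_measurable N"
    and aeq: "\<And>\<psi>. \<psi> \<in> borel_measurable N \<Longrightarrow>
      (\<integral>\<^sup>+x. indicator U x * \<psi> (Z x) \<partial>M) = (\<integral>\<^sup>+x. a (Z x) * \<psi> (Z x) \<partial>M)"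
    using factor_density[OF M(1) ZM UM] by blast
  have "(\<integral>\<^sup>+x. indicator U x * \<xi> x \<partial>M) = (\<integral>\<^sup>+x. a (Z x) * \<xi> x \<partial>M)"
    if \<xi>: "\<xi> \<in> borel_measurable H" for \<xi>
  proof (rule emeasure_Int_eq_lift[OF M H(1,2,3,4) UM _ _ \<xi>])
    fix V assume V: "V \<in> G"
    then have VM[measurable]: "V \<in> sets M" using H by (auto simp: subalgebra_def)
    obtain s where s[measurable]: "s \<in> borel_measurable N"
      and seq: "\<And>U. U \<in> sets F \<Longrightarrow> emeasure M (U \<inter> V) = (\<integral>\<^sup>+x. indicator U x * s (Z x) \<partial>M)"
      using eq[OF V] by blast
    have "(\<integral>\<^sup>+x. indicator V x * a (Z x) \<partial>M) = (\<integral>\<^sup>+x. s (Z x) * a (Z x) \<partial>M)"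
      by (rule emeasure_Int_eq_lift_sets[OF M F VM]) (use Z a seq in \<open>auto simp: Int_commute\<close>)
    also have "\<dots> = emeasure M (U \<inter> V)"
      using seq[OF U] aeq[OF s] by (simp add: mult.commute)
    finally show "emeasure M (U \<inter> V) = (\<integral>\<^sup>+x. indicator V x * a (Z x) \<partial>M)" ..
  qed simp
  then show ?thesis using a by blast
qed

text \<open>Conditional independence is symmetric once \<open>Z\<close> is measurable for both
  sigma-fields. This gives the later statements in both directions of time without a reversed
  transition kernel.\<close>

lemma factor_cond_indep_sym:
  fixes Z :: "'a \<Rightarrow> 'b"
  assumes M: "finite_measure M" "space M = UNIV"
    and F: "subalgebra M F" and Z: "Z \<in> F \<rightarrow>\<^sub>M N" "Z \<in> H \<rightarrow>\<^sub>M N"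
    and H: "subalgebra M H"
    and eq: "\<And>U. U \<in> sets F \<Longrightarrow> \<exists>a\<in>borel_measurable N. \<forall>\<xi>\<in>borel_measurable H.
      (\<integral>\<^sup>+x. indicator U x * \<xi> x \<partial>M) = (\<integral>\<^sup>+x. a (Z x) * \<xi> x \<partial>M)"
    and V: "V \<in> sets H"
  shows "\<exists>b\<in>borel_measurable N. \<forall>\<zeta>\<in>borel_measurable F.
      (\<integral>\<^sup>+x. indicator V x * \<zeta> x \<partial>M) = (\<integral>\<^sup>+x. b (Z x) * \<zeta> x \<partial>M)"
proof (rule factor_cond_indep[OF M H Z(2) F _ _ _ _ V])
  show "sets F = sigma_sets UNIV (sets F)" using F M by (metis sets.sigma_sets_eq subalgebra_def)
  show "UNIV \<in> sets F" using F M by (metis sets.top subalgebra_def)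
  fix U assume U: "U \<in> sets F"
  then have "U \<in> sets M" using F by (auto simp: subalgebra_def)
  obtain a where a: "a \<in> borel_measurable N" and aeq: "\<And>\<xi>. \<xi> \<in> borel_measurable H \<Longrightarrow>
      (\<integral>\<^sup>+x. indicator U x * \<xi> x \<partial>M) = (\<integral>\<^sup>+x. a (Z x) * \<xi> x \<partial>M)"
    using eq[OF U] by blast
  have "emeasure M (V' \<inter> U) = (\<integral>\<^sup>+x. indicator V' x * a (Z x) \<partial>M)" if "V' \<in> sets H" for V'
  proof -
    have "V' \<in> sets M" using that H by (auto simp: subalgebra_def)
    then have "emeasure M (V' \<inter> U) = (\<integral>\<^sup>+x. indicator U x * indicator V' x \<partial>M)"
      using \<open>U \<in> sets M\<close> by (simp add: nn_integral_indicator[symmetric] indicator_inter_arith mult.commute del: nn_integral_indicator)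
    also have "\<dots> = (\<integral>\<^sup>+x. indicator V' x * a (Z x) \<partial>M)"
      using aeq[of "indicator V'"] that by (simp add: mult.commute)
    finally show ?thesis .
  qed
  then show "\<exists>s\<in>borel_measurable N. \<forall>V'\<in>sets H. emeasure M (V' \<inter> U) = (\<integral>\<^sup>+x. indicator V' x * s (Z x) \<partial>M)"
    using a by blast
qed (auto simp: Int_stable_def)

section \<open>Approximation in measure by sets of a sub-sigma-field\<close>

lemma measure_sym_diff_triangle:
  assumes "finite_measure M" "A \<in> sets M" "B \<in> sets M" "C \<in> sets M"
  shows "measure M (sym_diff A C) \<le> measure M (sym_diff A B) + measure M (sym_diff B C)"
proof -
  interpret finite_measure M by fact
  have "measure M (sym_diff A C) \<le> measure M (sym_diff A B \<union> sym_diff B C)"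
    using assms by (intro finite_measure_mono) auto
  also have "\<dots> \<le> measure M (sym_diff A B) + measure M (sym_diff B C)"
    using assms by (intro measure_Un_le) auto
  finally show ?thesis .
qed

lemma sym_diff_Union_subset: "sym_diff (\<Union>i\<in>I. A i) (\<Union>i\<in>I. B i) \<subseteq> (\<Union>i\<in>I. sym_diff (A i) (B i))"
  by blast

text \<open>The sets that can be approximated arbitrarily well at some stage form a sigma-field.
  Since the stages increase, approximation at one stage gives it at all later ones, and the choice
  of approximants at the times \<open>N0 j + n\<close> for every \<open>n\<close> relies on
  that.\<close>

lemma increasing_union_approx:
  assumes M: "finite_measure M" "space M = UNIV" and F: "\<And>n::nat. subalgebra M (F n)"
    and mono: "\<And>m n. m \<le> n \<Longrightarrow> sets (F m) \<subseteq> sets (F n)"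
    and A: "A \<in> sigma_sets UNIV (\<Union>n. sets (F n))" and e: "0 < (e::real)"
  shows "\<exists>N. \<forall>n\<ge>N. \<exists>B\<in>sets (F n). measure M (sym_diff A B) < e"
proof -
  interpret finite_measure M by fact
  have FM: "sets (F n) \<subseteq> sets M" for n using F by (auto simp: subalgebra_def)
  have sub: "sigma_sets UNIV (\<Union>n. sets (F n)) \<subseteq> sets M"
    by (metis FM M(2) UN_least sets.sigma_sets_subset)
  have spF: "space (F n) = UNIV" for n using F M by (auto simp: subalgebra_def)
  have "\<exists>N. \<exists>B\<in>sets (F N). measure M (sym_diff A B) < e"
    using A e
  proof (induction arbitrary: e rule: sigma_sets.induct)
    case (Basic a)
    then obtain n where "a \<in> sets (F n)" by auto
    then show ?case using Basic.prems by (intro exI[of _ n] bexI[of _ a]) auto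
  next
    case Empty
    then show ?case by (intro exI[of _ 0] bexI[of _ "{}"]) auto
  next
    case (Compl a)
    then obtain n B where B: "B \<in> sets (F n)" "measure M (sym_diff a B) < e" by blast
    have "UNIV - B \<in> sets (F n)" using B(1) sets.compl_sets[of B "F n"] spF by simp
    moreover have "sym_diff (UNIV - a) (UNIV - B) = sym_diff a B" by auto
    ultimately show ?case using B by metis
  next
    case (Union a)
    have am: "a i \<in> sets M" for i using Union.hyps sub by auto
    let ?U = "\<Union>i. a i"
    have "(\<lambda>m. measure M (\<Union>i<m. a i)) \<longlonglongrightarrow> measure M (\<Union>m. \<Union>i<m. a i)"
      by (rule finite_Lim_measure_incseq) (use am in \<open>fastforce simp: incseq_def\<close>)+
    moreover have "(\<Union>m. \<Union>i<m. a i) = ?U" by auto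
    ultimately have "\<forall>\<^sub>F m in sequentially. dist (measure M (\<Union>i<m. a i)) (measure M ?U) < e/2"
      using Union.prems by (intro tendstoD) auto
    then obtain m where m: "dist (measure M (\<Union>i<m. a i)) (measure M ?U) < e/2"
      by (auto simp: eventually_sequentially)
    \<comment> \<open>The error allowed for each of the \<open>m\<close> sets; their sum stays below
      half of \<open>e\<close>, and the added 1 keeps the denominator positive for
      \<open>m = 0\<close>.\<close>
    define d where "d = e / (2 * (real m + 1))"
    have d: "d > 0" using Union.prems by (simp add: d_def)
    have "\<forall>i. \<exists>N B. B \<in> sets (F N) \<and> measure M (sym_diff (a i) B) < d"
      using Union.IH[OF d] by blast
    then obtain N B where B: "\<And>i. B i \<in> sets (F (N i))" "\<And>i. measure M (sym_diff (a i) (B i)) < d"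
      by metis
    define K where "K = Max (insert 0 (N ` {..<m}))"
    have BK: "B i \<in> sets (F K)" if "i < m" for i
      using B(1)[of i] mono[of "N i" K] that by (auto simp: K_def)
    have BM: "B i \<in> sets M" for i using B(1) FM by auto
    have 1: "measure M (sym_diff ?U (\<Union>i<m. a i)) < e/2"
    proof -
      have "sym_diff ?U (\<Union>i<m. a i) = ?U - (\<Union>i<m. a i)" by auto
      moreover have "measure M (?U - (\<Union>i<m. a i)) = measure M ?U - measure M (\<Union>i<m. a i)"
        using am by (intro finite_measure_Diff) auto
      ultimately show ?thesis using m by (auto simp: dist_real_def abs_if split: if_splits)
    qed
    have "measure M (sym_diff (\<Union>i<m. a i) (\<Union>i<m. B i)) \<le> measure M (\<Union>i<m. sym_diff (a i) (B i))"
      using am BM by (intro finite_measure_mono sym_diff_Union_subset) auto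
    also have "\<dots> \<le> (\<Sum>i<m. measure M (sym_diff (a i) (B i)))"
      using am BM by (intro finite_measure_subadditive_finite) auto
    also have "\<dots> \<le> (\<Sum>i<m. d)" using B(2) by (intro sum_mono less_imp_le)
    also have "\<dots> = real m * d" by simp
    also have "\<dots> < e/2" using Union.prems by (simp add: d_def field_simps)
    finally have 2: "measure M (sym_diff (\<Union>i<m. a i) (\<Union>i<m. B i)) < e/2" .
    have "measure M (sym_diff ?U (\<Union>i<m. B i)) < e"
      using measure_sym_diff_triangle[OF M(1), of ?U "\<Union>i<m. a i" "\<Union>i<m. B i"] 1 2 am BM by auto
    moreover have "(\<Union>i<m. B i) \<in> sets (F K)" using BK by auto
    ultimately show ?case by blast
  qed
  then obtain N B where "B \<in> sets (F N)" "measure M (sym_diff A B) < e" by blast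
  then show ?thesis using mono by (intro exI[of _ N]) blast
qed

text \<open>With errors below 2^-j the symmetric differences are summable. By Borel-Cantelli the
  limit superior of the approximants, which lies in \<open>F\<close>, agrees with \<open>A\<close>
  almost surely.\<close>

lemma approx_imp_mod_null:
  assumes M: "finite_measure M" "space M = UNIV" and F: "subalgebra M F" and A[measurable]: "A \<in> sets M"
    and approx: "\<And>e. 0 < e \<Longrightarrow> \<exists>B\<in>sets F. measure M (sym_diff A B) < (e::real)"
  shows "\<exists>B\<in>sets F. sym_diff A B \<in> null_sets M"
proof -
  interpret finite_measure M by fact
  have "\<forall>j::nat. \<exists>B\<in>sets F. measure M (sym_diff A B) < (1/2)^j" using approx by auto
  then obtain B where B: "\<And>j. B j \<in> sets F" "\<And>j. measure M (sym_diff A (B j)) < (1/2)^j" by metis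
  have [measurable]: "B j \<in> sets M" for j using B F by (auto simp: subalgebra_def)
  define L where "L = (\<Inter>m. \<Union>j\<in>{m..}. B j)"
  have "L \<in> sets F" using B(1) unfolding L_def by (intro sets.countable_INT sets.countable_UN') auto
  moreover have "sym_diff A L \<subseteq> limsup (\<lambda>j. sym_diff A (B j))"
  proof
    fix x assume x: "x \<in> sym_diff A L"
    have "\<exists>j\<ge>m. x \<in> sym_diff A (B j)" for m
    proof (cases "x \<in> A")
      case True
      then obtain k where "\<forall>j\<ge>k. x \<notin> B j" using x unfolding L_def by auto
      then show ?thesis using True by (intro exI[of _ "max m k"]) auto
    next
      case False
      then obtain j where "j \<ge> m" "x \<in> B j" using x unfolding L_def by auto
      then show ?thesis using False by auto
    qed
    then show "x \<in> limsup (\<lambda>j. sym_diff A (B j))"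
      unfolding limsup_INF_SUP by auto
  qed
  moreover have "limsup (\<lambda>j. sym_diff A (B j)) \<in> null_sets M"
  proof (rule borel_cantelli_limsup1)
    show "summable (\<lambda>j. measure M (sym_diff A (B j)))"
      using B(2) by (intro summable_comparison_test'[OF summable_geometric[of "1/2::real"], of 0])
        (auto intro: less_imp_le)
  qed (auto simp: emeasure_eq_measure)
  moreover have "L \<in> sets M" using \<open>L \<in> sets F\<close> F by (auto simp: subalgebra_def)
  then have "sym_diff A L \<in> sets M" by auto
  ultimately show ?thesis using null_sets_subset by blast
qed

text \<open>The set \<open>{q > 1/2}\<close> minimises the distance to \<open>A\<close> among \<open>\<sigma>(Z)\<close>-sets up to a constant.\<close>

lemma factor_approx:
  fixes Z :: "'a \<Rightarrow> 'b" and q :: "'b \<Rightarrow> ennreal"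
  assumes M: "finite_measure M" "space M = UNIV"
    and F: "subalgebra M F" and Z: "Z \<in> F \<rightarrow>\<^sub>M N" and A: "A \<in> sets M"
    and q[measurable]: "q \<in> borel_measurable N"
    and eq: "\<And>W. W \<in> sets F \<Longrightarrow> emeasure M (W \<inter> A) = (\<integral>\<^sup>+x. indicator W x * q (Z x) \<partial>M)"
    and A': "A' \<in> sets F"
  shows "\<exists>D\<in>sets N. measure M (sym_diff A {x. Z x \<in> D}) \<le> 3 * measure M (sym_diff A A')"
proof -
  interpret finite_measure M by fact
  define D where "D = {z\<in>space N. 1 < 2 * q z}"
  have D[measurable]: "D \<in> sets N" unfolding D_def by measurable
  define B where "B = {x. Z x \<in> D}"
  have spF: "space F = UNIV" using F M by (simp add: subalgebra_def)
  have BF: "B \<in> sets F"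
    using measurable_sets[OF Z D] spF by (simp add: B_def vimage_def)
  have [measurable]: "A' \<in> sets M" "B \<in> sets M" using A' BF F by (auto simp: subalgebra_def)
  note A[measurable]
  have Z'[measurable]: "Z \<in> M \<rightarrow>\<^sub>M N" by (rule measurable_from_subalg[OF F Z])
  have Zsp: "Z x \<in> space N" for x using measurable_space[OF Z] spF by auto
  \<comment> \<open>On \<open>A' - B\<close> the conditional probability of \<open>A\<close> is at
    most 1/2, so at least half of this set lies outside \<open>A\<close>; on \<open>B - A'\<close>
    it exceeds 1/2, so at least half lies inside. Hence \<open>A'\<close> and \<open>B\<close>
    differ by at most twice the distance from \<open>A\<close> to \<open>A'\<close>, and the
    triangle inequality turns 2 into 3.\<close>
  have 1: "measure M (A' - B) \<le> 2 * measure M (A' - A)"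
  proof -
    have W: "A' - B \<in> sets F" using A' BF by auto
    have "2 * ennreal (measure M ((A' - B) \<inter> A)) = (\<integral>\<^sup>+x. 2 * (indicator (A' - B) x * q (Z x)) \<partial>M)"
      using eq[OF W] Z' by (subst nn_integral_cmult) (auto simp: emeasure_eq_measure)
    also have "\<dots> \<le> (\<integral>\<^sup>+x. indicator (A' - B) x \<partial>M)"
      using Zsp by (intro nn_integral_mono) (auto simp: B_def D_def not_less split: split_indicator)
    also have "\<dots> = ennreal (measure M (A' - B))"
      by (simp add: emeasure_eq_measure)
    finally have "ennreal (2 * measure M ((A' - B) \<inter> A)) \<le> ennreal (measure M (A' - B))"
      by (simp add: ennreal_mult)
    then have "2 * measure M ((A' - B) \<inter> A) \<le> measure M (A' - B)" by simp
    moreover have "measure M (A' - B) = measure M ((A' - B) \<inter> A) + measure M (A' - B - A)"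
      by (subst finite_measure_Union[symmetric]) (auto intro!: arg_cong[where f="measure M"])
    moreover have "measure M (A' - B - A) \<le> measure M (A' - A)" by (intro finite_measure_mono) auto
    ultimately show ?thesis by simp
  qed
  have 2: "measure M (B - A') \<le> 2 * measure M (A - A')"
  proof -
    have W: "B - A' \<in> sets F" using A' BF by auto
    have "ennreal (measure M (B - A')) = (\<integral>\<^sup>+x. indicator (B - A') x \<partial>M)"
      by (simp add: emeasure_eq_measure)
    also have "\<dots> \<le> (\<integral>\<^sup>+x. 2 * (indicator (B - A') x * q (Z x)) \<partial>M)"
      by (intro nn_integral_mono) (auto simp: B_def D_def less_imp_le split: split_indicator)
    also have "\<dots> = 2 * ennreal (measure M ((B - A') \<inter> A))"
      using eq[OF W] Z' by (subst nn_integral_cmult) (auto simp: emeasure_eq_measure)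
    finally have "ennreal (measure M (B - A')) \<le> ennreal (2 * measure M ((B - A') \<inter> A))"
      by (simp add: ennreal_mult)
    then have "measure M (B - A') / 2 \<le> measure M ((B - A') \<inter> A)" by simp
    also have "\<dots> \<le> measure M (A - A')" by (intro finite_measure_mono) auto
    finally show ?thesis by simp
  qed
  have s: "measure M (sym_diff C E) = measure M (C - E) + measure M (E - C)"
    if "C \<in> sets M" "E \<in> sets M" for C E
    using that by (intro finite_measure_Union) auto
  have "measure M (sym_diff A' B) \<le> 2 * measure M (sym_diff A A')"
    using 1 2 by (simp add: s)
  then have "measure M (sym_diff A B) \<le> 3 * measure M (sym_diff A A')"
    using measure_sym_diff_triangle[OF M(1), of A A' B] by simp
  then show ?thesis using D unfolding B_def by blast
qed

section \<open>The sigma-fields of the path space\<close>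

type_synonym ('i, 'e, 'f) path = "('i \<Rightarrow> 'e) \<times> ('i \<Rightarrow> 'f)"

text \<open>
  The observed sigma-fields are generated by cylinders; in \<open>XY T U\<close> the signal is seen at the
  times in \<open>T\<close> and the observations at the times in \<open>U\<close>, and \<open>YM U\<close> lives on observation paths.
\<close>

definition cyl :: "'i set \<Rightarrow> 'i set \<Rightarrow> ('i, 'e::topological_space, 'f::topological_space) path set set" where
  "cyl T U = {{\<omega>. \<forall>i. X i \<omega> \<in> A i \<and> Y i \<omega> \<in> B i} | A B.
     (\<forall>i. A i \<in> sets borel \<and> B i \<in> sets borel) \<and> finite {i. A i \<noteq> UNIV \<or> B i \<noteq> UNIV} \<and>
     {i. A i \<noteq> UNIV} \<subseteq> T \<and> {i. B i \<noteq> UNIV} \<subseteq> U}"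

definition XY :: "'i set \<Rightarrow> 'i set \<Rightarrow> ('i, 'e::topological_space, 'f::topological_space) path measure" where
  "XY T U = sigma UNIV (cyl T U)"

definition YM :: "'i set \<Rightarrow> ('i \<Rightarrow> 'f::topological_space) measure" where
  "YM U = sigma UNIV {(\<lambda>y. y k) -` B | k B. k \<in> U \<and> B \<in> sets borel}"

lemma space_XY[simp]: "space (XY T U) = UNIV" by (simp add: XY_def)
lemma space_YM[simp]: "space (YM U) = UNIV" by (simp add: YM_def)
lemma sets_XY: "sets (XY T U) = sigma_sets UNIV (cyl T U)" by (simp add: XY_def)

lemma UNIV_in_cyl: "UNIV \<in> cyl T U"
  unfolding cyl_def mem_Collect_eq by (intro exI[of _ "\<lambda>_. UNIV"]) auto

lemma Int_stable_cyl: "Int_stable (cyl T U)"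
proof (rule Int_stableI)
  fix a b :: "(('a \<Rightarrow> 'b) \<times> ('a \<Rightarrow> 'c)) set"
  assume "a \<in> cyl T U" "b \<in> cyl T U"
  then obtain A B C D where *: "a = {\<omega>. \<forall>i. X i \<omega> \<in> A i \<and> Y i \<omega> \<in> B i}" "b = {\<omega>. \<forall>i. X i \<omega> \<in> C i \<and> Y i \<omega> \<in> D i}"
     "\<forall>i. A i \<in> sets borel \<and> B i \<in> sets borel" "finite {i. A i \<noteq> UNIV \<or> B i \<noteq> UNIV}"
     "{i. A i \<noteq> UNIV} \<subseteq> T" "{i. B i \<noteq> UNIV} \<subseteq> U"
     "\<forall>i. C i \<in> sets borel \<and> D i \<in> sets borel" "finite {i. C i \<noteq> UNIV \<or> D i \<noteq> UNIV}"
     "{i. C i \<noteq> UNIV} \<subseteq> T" "{i. D i \<noteq> UNIV} \<subseteq> U"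
    unfolding cyl_def by blast
  have f: "finite {i. A i \<inter> C i \<noteq> UNIV \<or> B i \<inter> D i \<noteq> UNIV}"
    by (rule finite_subset[OF _ finite_UnI[OF *(4,8)]]) auto
  show "a \<inter> b \<in> cyl T U"
    unfolding cyl_def mem_Collect_eq
    by (rule exI[of _ "\<lambda>i. A i \<inter> C i"], rule exI[of _ "\<lambda>i. B i \<inter> D i"]) (use * f in auto)
qed

lemma X_in_cyl: "i \<in> T \<Longrightarrow> A \<in> sets borel \<Longrightarrow> X i -` A \<in> cyl T U"
  unfolding cyl_def mem_Collect_eq
  by (rule exI[of _ "\<lambda>j. if j = i then A else UNIV"], rule exI[of _ "\<lambda>j. UNIV"]) auto

lemma Y_in_cyl: "i \<in> U \<Longrightarrow> B \<in> sets borel \<Longrightarrow> Y i -` B \<in> cyl T U"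
  unfolding cyl_def mem_Collect_eq
  by (rule exI[of _ "\<lambda>j. UNIV"], rule exI[of _ "\<lambda>j. if j = i then B else UNIV"]) auto

lemma X_XY: "i \<in> T \<Longrightarrow> X i \<in> XY T U \<rightarrow>\<^sub>M borel"
  by (rule measurableI) (auto simp: sets_XY intro: X_in_cyl)

lemma Y_XY: "i \<in> U \<Longrightarrow> Y i \<in> XY T U \<rightarrow>\<^sub>M borel"
  by (rule measurableI) (auto simp: sets_XY intro: Y_in_cyl)

lemma cyl_subset:
  fixes M :: "('i, 'e::topological_space, 'f::topological_space) path measure"
  assumes X: "\<And>i. i \<in> T \<Longrightarrow> X i \<in> M \<rightarrow>\<^sub>M borel" and Y: "\<And>i. i \<in> U \<Longrightarrow> Y i \<in> M \<rightarrow>\<^sub>M borel" and "space M = UNIV"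
  shows "cyl T U \<subseteq> sets M"
proof
  fix a :: "('i, 'e, 'f) path set" assume "a \<in> cyl T U"
  then obtain A B where *: "a = {\<omega>. \<forall>i. X i \<omega> \<in> A i \<and> Y i \<omega> \<in> B i}"
     "\<forall>i. A i \<in> sets borel \<and> B i \<in> sets borel" "finite {i. A i \<noteq> UNIV \<or> B i \<noteq> UNIV}"
     "{i. A i \<noteq> UNIV} \<subseteq> T" "{i. B i \<noteq> UNIV} \<subseteq> U"
    unfolding cyl_def by blast
  have X': "(X i -` A i :: ('i, 'e, 'f) path set) \<in> sets M" for i
    using *(2,4) measurable_sets[OF X, of i "A i"] \<open>space M = UNIV\<close> sets.top[of M]
    by (cases "A i = UNIV") auto
  have Y': "(Y i -` B i :: ('i, 'e, 'f) path set) \<in> sets M" for i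
    using *(2,5) measurable_sets[OF Y, of i "B i"] \<open>space M = UNIV\<close> sets.top[of M]
    by (cases "B i = UNIV") auto
  have "a = UNIV \<inter> (\<Inter>i\<in>{i. A i \<noteq> UNIV \<or> B i \<noteq> UNIV}. X i -` A i \<inter> Y i -` B i)"
    unfolding *(1) by auto
  also have "\<dots> \<in> sets M"
    using X' Y' *(3) \<open>space M = UNIV\<close> sets.top[of M]
    by (cases "{i. A i \<noteq> UNIV \<or> B i \<noteq> UNIV} = {}") (auto intro!: sets.finite_INT)
  finally show "a \<in> sets M" .
qed

lemma XY_subset:
  fixes M :: "('i, 'e::topological_space, 'f::topological_space) path measure"
  assumes "\<And>i. i \<in> T \<Longrightarrow> X i \<in> M \<rightarrow>\<^sub>M borel" "\<And>i. i \<in> U \<Longrightarrow> Y i \<in> M \<rightarrow>\<^sub>M borel" "space M = UNIV"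
  shows "sets (XY T U) \<subseteq> sets M"
  using cyl_subset[OF assms] sets.sigma_sets_subset[of "cyl T U" M] assms(3) by (simp add: sets_XY)

lemma XY_mono: "T \<subseteq> T' \<Longrightarrow> U \<subseteq> U' \<Longrightarrow> sets (XY T U) \<subseteq> sets (XY T' U')"
  by (rule XY_subset) (auto intro: X_XY Y_XY)

lemma measurable_XY_mono: "f \<in> XY T U \<rightarrow>\<^sub>M N \<Longrightarrow> T \<subseteq> T' \<Longrightarrow> U \<subseteq> U' \<Longrightarrow> f \<in> XY T' U' \<rightarrow>\<^sub>M N"
  using XY_mono[of T T' U U'] unfolding measurable_def by auto

text \<open>Connects the joins of the theorem with sigma-fields generated by a pi-system of
  cylinders, to which the uniqueness arguments apply.\<close>

lemma sets_XY_join: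
  "sets (XY T U) = (sigma_join (FX T) (FY U) :: ('i, 'e::topological_space, 'f::topological_space) path set set)"
proof
  let ?S = "sigma UNIV (FX T \<union> FY U) :: ('i, 'e, 'f) path measure"
  have S: "sets ?S = sigma_join (FX T) (FY U)" by (simp add: sigma_join_def)
  have "X i \<in> ?S \<rightarrow>\<^sub>M borel" if "i \<in> T" for i
    by (rule measurableI) (use that in \<open>auto simp: FX_def intro!: sigma_sets.Basic\<close>)
  moreover have "Y i \<in> ?S \<rightarrow>\<^sub>M borel" if "i \<in> U" for i
    by (rule measurableI) (use that in \<open>auto simp: FY_def intro!: sigma_sets.Basic\<close>)
  ultimately show "sets (XY T U) \<subseteq> (sigma_join (FX T) (FY U) :: ('i, 'e, 'f) path set set)"
    using XY_subset[of T ?S U] S by simp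
  have "FX T \<subseteq> sigma_sets UNIV (cyl T U :: ('i, 'e, 'f) path set set)"
    unfolding FX_def by (rule sigma_sets_mono) (auto intro: X_in_cyl)
  moreover have "FY U \<subseteq> sigma_sets UNIV (cyl T U :: ('i, 'e, 'f) path set set)"
    unfolding FY_def by (rule sigma_sets_mono) (auto intro: Y_in_cyl)
  ultimately show "sigma_join (FX T) (FY U) \<subseteq> (sets (XY T U) :: ('i, 'e, 'f) path set set)"
    unfolding sigma_join_def sets_XY by (intro sigma_sets_mono) auto
qed

lemma measurable_into_XY:
  fixes f :: "'a \<Rightarrow> ('i, 'e::topological_space, 'f::topological_space) path"
  assumes X: "\<And>i. i \<in> T \<Longrightarrow> (\<lambda>x. X i (f x)) \<in> N \<rightarrow>\<^sub>M borel" and Y: "\<And>i. i \<in> U \<Longrightarrow> (\<lambda>x. Y i (f x)) \<in> N \<rightarrow>\<^sub>M borel"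
  shows "f \<in> N \<rightarrow>\<^sub>M XY T U"
proof -
  let ?G = "{X k -` A | k A. k \<in> T \<and> A \<in> sets borel} \<union> {Y k -` B | k B. k \<in> U \<and> B \<in> sets borel} :: ('i, 'e, 'f) path set set"
  have "f \<in> N \<rightarrow>\<^sub>M sigma UNIV ?G"
  proof (rule measurable_measure_of)
    fix y assume "y \<in> ?G"
    then consider k A where "y = X k -` A" "k \<in> T" "A \<in> sets borel" | k B where "y = Y k -` B" "k \<in> U" "B \<in> sets borel"
      by blast
    then show "f -` y \<inter> space N \<in> sets N"
    proof cases
      case 1 then show ?thesis using measurable_sets[OF X, of k A] by (simp add: vimage_def)
    next
      case 2 then show ?thesis using measurable_sets[OF Y, of k B] by (simp add: vimage_def)
    qed
  qed auto
  moreover have "sets (XY T U) \<subseteq> sets (sigma UNIV ?G)"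
  proof (rule XY_subset)
    show "X i \<in> sigma UNIV ?G \<rightarrow>\<^sub>M borel" if "i \<in> T" for i
      by (rule measurableI) (use that in \<open>auto intro!: sigma_sets.Basic\<close>)
    show "Y i \<in> sigma UNIV ?G \<rightarrow>\<^sub>M borel" if "i \<in> U" for i
      by (rule measurableI) (use that in \<open>auto intro!: sigma_sets.Basic\<close>)
  qed simp
  ultimately show ?thesis unfolding measurable_def by auto
qed

lemma sigma_sets_idem: "sigma_sets \<Omega> (sigma_sets \<Omega> A) = sigma_sets \<Omega> A"
  by (intro equalityI sigma_sets_mono) (auto intro: sigma_sets.Basic)

lemma sets_XY_FX: "sets (XY T {}) = (FX T :: ('i, 'e::topological_space, 'f::topological_space) path set set)"
proof -
  have "sigma_sets UNIV (FX T \<union> (FY {}:: ('i, 'e, 'f) path set set)) = FX T"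
  proof
    have "FY {} \<subseteq> (FX T :: ('i, 'e, 'f) path set set)"
      unfolding FY_def FX_def by (intro sigma_sets_mono) auto
    then have "FX T \<union> FY {} = (FX T :: ('i, 'e, 'f) path set set)" by (rule sup_absorb1)
    then show "sigma_sets UNIV (FX T \<union> (FY {}:: ('i, 'e, 'f) path set set)) \<subseteq> FX T"
      by (simp add: FX_def sigma_sets_idem)
  qed (auto intro: sigma_sets.Basic)
  then show ?thesis by (simp add: sets_XY_join sigma_join_def)
qed

lemma sets_XY_FY: "sets (XY {} U) = (FY U :: ('i, 'e::topological_space, 'f::topological_space) path set set)"
proof -
  have "sigma_sets UNIV ((FX {}:: ('i, 'e, 'f) path set set) \<union> FY U) = FY U"
  proof
    have "FX {} \<subseteq> (FY U :: ('i, 'e, 'f) path set set)"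
      unfolding FY_def FX_def by (intro sigma_sets_mono) auto
    then have "FX {} \<union> FY U = (FY U :: ('i, 'e, 'f) path set set)" by (rule sup_absorb2)
    then show "sigma_sets UNIV ((FX {}:: ('i, 'e, 'f) path set set) \<union> FY U) \<subseteq> FY U"
      by (simp add: FY_def sigma_sets_idem)
  qed (auto intro: sigma_sets.Basic)
  then show ?thesis by (simp add: sets_XY_join sigma_join_def)
qed

section \<open>Sets and maps on the space of observation paths\<close>

lemma measurable_into_YM:
  fixes f :: "'a \<Rightarrow> 'i \<Rightarrow> 'f::topological_space"
  assumes "\<And>k. k \<in> U \<Longrightarrow> (\<lambda>x. f x k) \<in> M \<rightarrow>\<^sub>M borel"
  shows "f \<in> M \<rightarrow>\<^sub>M YM U"
  unfolding YM_def
proof (rule measurable_measure_of)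
  fix y :: "('i \<Rightarrow> 'f) set" assume "y \<in> {(\<lambda>y. y k) -` B | k B. k \<in> U \<and> B \<in> sets borel}"
  then obtain k B where "y = (\<lambda>y. y k) -` B" "k \<in> U" "B \<in> sets borel" by auto
  then show "f -` y \<inter> space M \<in> sets M"
    using measurable_sets[OF assms, of k B] by (simp add: vimage_def)
qed auto

lemma YM_component: "k \<in> U \<Longrightarrow> (\<lambda>y. y k) \<in> YM U \<rightarrow>\<^sub>M borel"
  by (rule measurableI) (auto simp: YM_def intro!: sigma_sets.Basic)

lemma snd_XY: "U \<subseteq> U' \<Longrightarrow> snd \<in> XY T U' \<rightarrow>\<^sub>M YM U"
  by (rule measurable_into_YM) (auto intro!: Y_XY[unfolded Y_def[abs_def]])

text \<open>An observed event constrains the second component alone. Its indicator can therefore be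
  multiplied into functions of the pair of present state and observation path.\<close>

lemma FY_snd:
  fixes A :: "('i, 'e::topological_space, 'f::topological_space) path set"
  assumes "A \<in> FY U" shows "\<exists>C\<in>sets (YM U). A = snd -` C"
  using assms unfolding FY_def
proof (induction rule: sigma_sets.induct)
  case (Basic a)
  then obtain k B where "a = Y k -` B" "k \<in> U" "B \<in> sets borel" by auto
  then show ?case
    by (intro bexI[of _ "(\<lambda>y. y k) -` B"]) (auto simp: YM_def Y_def intro!: sigma_sets.Basic)
next
  case (Compl a)
  then obtain C where "C \<in> sets (YM U)" "a = snd -` C" by blast
  then show ?case using sets.compl_sets[of C "YM U"] by (intro bexI[of _ "UNIV - C"]) auto
next
  case (Union a)
  then obtain C where "\<And>i. C i \<in> sets (YM U)" "\<And>i. a i = snd -` C i" by metis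
  then show ?case by (intro bexI[of _ "\<Union>i. C i"]) auto
qed auto

lemma snd_FY:
  "C \<in> sets (YM U) \<Longrightarrow> (snd -` C :: ('i, 'e::topological_space, 'f::topological_space) path set) \<in> FY U"
proof -
  assume C: "C \<in> sets (YM U)"
  have "snd \<in> (XY {} U :: ('i, 'e, 'f) path measure) \<rightarrow>\<^sub>M YM U" by (rule snd_XY) simp
  from measurable_sets[OF this C] show ?thesis by (simp add: sets_XY_FY)
qed

lemma sets_path_space: "sets path_space = sets (XY UNIV UNIV)"
proof
  have id: "(\<lambda>\<omega>. \<omega>) \<in> XY UNIV UNIV \<rightarrow>\<^sub>M path_space"
  proof -
    have "(\<lambda>\<omega>. fst \<omega>) \<in> XY UNIV UNIV \<rightarrow>\<^sub>M (\<Pi>\<^sub>M n\<in>UNIV. borel)"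
      by (rule measurable_PiM_single') (auto intro!: X_XY[unfolded X_def[abs_def]])
    moreover have "(\<lambda>\<omega>. snd \<omega>) \<in> XY UNIV UNIV \<rightarrow>\<^sub>M (\<Pi>\<^sub>M n\<in>UNIV. borel)"
      by (rule measurable_PiM_single') (auto intro!: Y_XY[unfolded Y_def[abs_def]])
    ultimately show ?thesis unfolding path_space_def by (simp add: measurable_pair_iff comp_def)
  qed
  show "sets path_space \<subseteq> sets (XY UNIV UNIV)"
  proof
    fix A assume A: "A \<in> sets path_space"
    then show "A \<in> sets (XY UNIV UNIV)" using measurable_sets[OF id A] by simp
  qed
  show "sets (XY UNIV UNIV) \<subseteq> sets path_space"
  proof (rule XY_subset)
    show "X i \<in> path_space \<rightarrow>\<^sub>M borel" for i
      unfolding path_space_def X_def[abs_def] by measurable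
    show "Y i \<in> path_space \<rightarrow>\<^sub>M borel" for i
      unfolding path_space_def Y_def[abs_def] by measurable
  qed (simp add: path_space_def space_pair_measure space_PiM PiE_UNIV_domain)
qed

section \<open>Integrals along the hidden Markov model\<close>

text \<open>The expectation of f_0(x_0) f_1(x_1) ... f_m(x_m) for the chain with kernel
  \<open>P\<close> started at x_0 = \<open>x\<close>.\<close>

primrec markov_int :: "('e \<Rightarrow> 'e measure) \<Rightarrow> ('e \<Rightarrow> ennreal) list \<Rightarrow> 'e \<Rightarrow> ennreal" where
  "markov_int P [] x = 1"
| "markov_int P (f # fs) x = f x * (\<integral>\<^sup>+x'. markov_int P fs x' \<partial>P x)"

text \<open>Time advances by \<open>a + 1\<close> in any \<open>linordered_semidom\<close>, so the
  same product runs along one-sided and two-sided paths.\<close>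

primrec path_prod :: "('e \<Rightarrow> ennreal) list \<Rightarrow> 'i::linordered_semidom \<Rightarrow> ('i, 'e, 'f) path \<Rightarrow> ennreal" where
  "path_prod [] a \<omega> = 1"
| "path_prod (f # fs) a \<omega> = f (X a \<omega>) * path_prod fs (a + 1) \<omega>"

lemma markov_int_measurable:
  assumes P: "prob_kernel P" and "\<And>f. f \<in> set fs \<Longrightarrow> f \<in> borel_measurable borel"
  shows "markov_int P fs \<in> borel_measurable borel"
  using assms(2)
proof (induction fs)
  case Nil
  have "markov_int P [] = (\<lambda>_. 1)" by (simp add: fun_eq_iff)
  then show ?case by simp
next
  case (Cons f fs)
  have P': "P \<in> borel \<rightarrow>\<^sub>M subprob_algebra borel"
    using P unfolding prob_kernel_def by (rule measurable_prob_algebraD)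
  have [measurable]: "f \<in> borel_measurable borel" "markov_int P fs \<in> borel_measurable borel"
    using Cons by auto
  have [measurable]: "(\<lambda>x. \<integral>\<^sup>+x'. markov_int P fs x' \<partial>P x) \<in> borel_measurable borel"
    by (rule measurable_compose[OF P' nn_integral_measurable_subprob_algebra]) measurable
  have "(\<lambda>x. f x * (\<integral>\<^sup>+x'. markov_int P fs x' \<partial>P x)) \<in> borel_measurable borel" by measurable
  moreover have "markov_int P (f # fs) = (\<lambda>x. f x * (\<integral>\<^sup>+x'. markov_int P fs x' \<partial>P x))"
    by (simp add: fun_eq_iff)
  ultimately show ?case by simp
qed

text \<open>The index type stays open because the locale is used twice: for the two-sided stationary
  law and, with index \<open>nat\<close>, for the laws started at a point.\<close>

locale hmm_measure =
  fixes P :: "'e::polish_space \<Rightarrow> 'e measure"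
    and \<Phi> :: "'e \<Rightarrow> 'f::polish_space measure"
    and M :: "('i::linordered_semidom, 'e, 'f) path measure"
  assumes hmm: "hmm P \<Phi> M" and P: "prob_kernel P" and \<Phi>: "prob_kernel \<Phi>"
begin

sublocale prob_space M using hmm by (simp add: hmm_def)

lemma sets_M: "sets M = sets (XY UNIV UNIV)"
  using hmm by (simp add: hmm_def sets_path_space)

lemma space_M[simp]: "space M = UNIV"
  using sets_eq_imp_space_eq[OF sets_M] by simp

lemma finM: "finite_measure M" by unfold_locales

lemma subalg: "subalgebra M (XY T U)"
  using XY_mono[of T UNIV U UNIV] by (auto simp: subalgebra_def sets_M)

lemma X_measurable[measurable]: "X i \<in> M \<rightarrow>\<^sub>M borel"
  using measurable_from_subalg[OF subalg X_XY] by blast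

lemma Y_measurable[measurable]: "Y i \<in> M \<rightarrow>\<^sub>M borel"
  using measurable_from_subalg[OF subalg Y_XY] by blast

lemma P_prob: "prob_space (P x)" "sets (P x) = sets borel"
  using measurable_space[OF P[unfolded prob_kernel_def], of x] by (auto simp: space_prob_algebra)

lemma \<Phi>_prob: "prob_space (\<Phi> x)" "sets (\<Phi> x) = sets borel"
  using measurable_space[OF \<Phi>[unfolded prob_kernel_def], of x] by (auto simp: space_prob_algebra)

lemma P_sub: "P \<in> borel \<rightarrow>\<^sub>M subprob_algebra borel"
  using P unfolding prob_kernel_def by (rule measurable_prob_algebraD)

lemma \<Phi>_sub: "\<Phi> \<in> borel \<rightarrow>\<^sub>M subprob_algebra borel"
  using \<Phi> unfolding prob_kernel_def by (rule measurable_prob_algebraD)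

lemma P_measure: "A \<in> sets borel \<Longrightarrow> (\<lambda>x. measure (P x) A) \<in> borel_measurable borel"
  unfolding measure_def
  by (rule borel_measurable_enn2real, rule measurable_compose[OF P_sub measurable_emeasure_subprob_algebra])

lemma \<Phi>_emeasure: "A \<in> sets borel \<Longrightarrow> (\<lambda>x. emeasure (\<Phi> x) A) \<in> borel_measurable borel"
  by (rule measurable_compose[OF \<Phi>_sub measurable_emeasure_subprob_algebra])

lemma \<Phi>_measure: "A \<in> sets borel \<Longrightarrow> (\<lambda>x. measure (\<Phi> x) A) \<in> borel_measurable borel"
  unfolding measure_def by (rule borel_measurable_enn2real, rule \<Phi>_emeasure)

lemma cond_prob_lift:
  assumes F: "sets F = FX T" and B[measurable]: "B \<in> sets M" and r[measurable]: "r \<in> borel_measurable M"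
    and r0: "\<And>\<omega>. 0 \<le> r \<omega>"
    and ae: "AE \<omega> in M. real_cond_exp M F (indicator B) \<omega> = r \<omega>"
    and \<zeta>: "\<zeta> \<in> borel_measurable (XY T {})"
  shows "(\<integral>\<^sup>+\<omega>. indicator B \<omega> * \<zeta> \<omega> \<partial>M) = (\<integral>\<^sup>+\<omega>. ennreal (r \<omega>) * \<zeta> \<omega> \<partial>M)"
proof (rule emeasure_Int_eq_lift_sets[OF finM space_M subalg B _ _ \<zeta>])
  have F': "subalgebra M F"
    using subalg[of T "{}"] F sets_eq_imp_space_eq[of F "XY T {}"] by (simp add: subalgebra_def sets_XY_FX)
  interpret C: sigma_finite_subalgebra M F
    using finM F' by (intro finite_measure_subalgebra_is_sigma_finite)
      (simp add: finite_measure_subalgebra_def finite_measure_subalgebra_axioms_def)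
  fix V :: "('i, 'e, 'f) path set" assume "V \<in> sets (XY T {})"
  then have V: "V \<in> sets F" by (simp add: F sets_XY_FX)
  then have [measurable]: "V \<in> sets M" using F' by (auto simp: subalgebra_def)
  have int: "integrable M (indicator B :: _ \<Rightarrow> real)" by (simp add: less_top[symmetric])
  have intr: "integrable M r"
    using C.real_cond_exp_int(1)[OF int] ae by (subst integrable_cong_AE[of r M "real_cond_exp M F (indicator B)"]) auto
  have "emeasure M (B \<inter> V) = ennreal (\<integral>\<omega>. indicator V \<omega> * indicator B \<omega> \<partial>M)"
    by (simp add: emeasure_eq_measure indicator_inter_arith[symmetric] Int_commute)
  also have "(\<integral>\<omega>. indicator V \<omega> * indicator B \<omega> \<partial>M) = (\<integral>\<omega>. indicator V \<omega> * real_cond_exp M F (indicator B) \<omega> \<partial>M)"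
    using C.real_cond_exp_intA[OF int V] by (simp add: set_lebesgue_integral_def)
  also have "\<dots> = (\<integral>\<omega>. indicator V \<omega> * r \<omega> \<partial>M)"
    using ae by (intro integral_cong_AE) auto
  also have "ennreal \<dots> = (\<integral>\<^sup>+\<omega>. ennreal (indicator V \<omega> * r \<omega>) \<partial>M)"
  proof (rule nn_integral_eq_integral[symmetric])
    show "integrable M (\<lambda>\<omega>. indicator V \<omega> * r \<omega>)"
      using integrable_real_mult_indicator[OF _ intr, of V] by (simp add: mult.commute)
  qed (use r0 in auto)
  also have "\<dots> = (\<integral>\<^sup>+\<omega>. indicator V \<omega> * ennreal (r \<omega>) \<partial>M)"
    by (intro nn_integral_cong) (auto split: split_indicator)
  finally show "emeasure M (B \<inter> V) = (\<integral>\<^sup>+\<omega>. indicator V \<omega> * ennreal (r \<omega>) \<partial>M)" .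
qed simp

text \<open>Measures are compared instead of integrals: under the weight \<open>\<zeta>\<close>, the
  law of \<open>X (n + 1)\<close> and the mixture of the laws \<open>P (X n \<omega>)\<close> agree
  on Borel sets by the Markov property, hence they integrate every \<open>f\<close> alike.\<close>

lemma markov_step:
  assumes f: "f \<in> borel_measurable borel" and \<zeta>: "\<zeta> \<in> borel_measurable (XY {..n} {})"
  shows "(\<integral>\<^sup>+\<omega>. \<zeta> \<omega> * f (X (n + 1) \<omega>) \<partial>M) = (\<integral>\<^sup>+\<omega>. \<zeta> \<omega> * (\<integral>\<^sup>+x. f x \<partial>P (X n \<omega>)) \<partial>M)"
proof -
  note [measurable] = measurable_from_subalg[OF subalg \<zeta>]
  let ?L = "distr (density M \<zeta>) borel (X (n + 1))" and ?R = "density M \<zeta> \<bind> (\<lambda>\<omega>. P (X n \<omega>))"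
  have K: "(\<lambda>\<omega>. P (X n \<omega>)) \<in> M \<rightarrow>\<^sub>M subprob_algebra borel"
    by (rule measurable_compose[OF X_measurable P_sub])
  then have K': "(\<lambda>\<omega>. P (X n \<omega>)) \<in> density M \<zeta> \<rightarrow>\<^sub>M subprob_algebra borel" by simp
  have "?L = ?R"
  proof (rule measure_eqI)
    show "sets ?L = sets ?R" by (subst sets_bind[of _ _ borel]) (simp_all add: P_prob)
    fix A assume "A \<in> sets ?L"
    then have A[measurable]: "A \<in> sets borel" by simp
    have "AE \<omega> in M. real_cond_exp M (sigma UNIV (FX {..n})) (indicator {\<omega>. X (n + 1) \<omega> \<in> A}) \<omega> = measure (P (X n \<omega>)) A"
      using hmm A by (simp add: hmm_def)
    moreover have "(\<lambda>\<omega>. measure (P (X n \<omega>)) A) \<in> borel_measurable M"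
      using measurable_compose[OF X_measurable P_measure] A by simp
    moreover have "{\<omega>. X (n + 1) \<omega> \<in> A} \<in> sets M"
      using measurable_sets[OF X_measurable A] by (simp add: vimage_def)
    ultimately have "(\<integral>\<^sup>+\<omega>. indicator {\<omega>. X (n + 1) \<omega> \<in> A} \<omega> * \<zeta> \<omega> \<partial>M) = (\<integral>\<^sup>+\<omega>. ennreal (measure (P (X n \<omega>)) A) * \<zeta> \<omega> \<partial>M)"
      by (intro cond_prob_lift[OF _ _ _ _ _ \<zeta>]) (auto simp: FX_def sigma_sets_idem)
    moreover have "emeasure (P x) A = ennreal (measure (P x) A)" for x
      using P_prob(1)[of x] by (simp add: prob_space_def finite_measure.emeasure_eq_measure)
    moreover have "emeasure ?L A = (\<integral>\<^sup>+\<omega>. indicator {\<omega>. X (n + 1) \<omega> \<in> A} \<omega> * \<zeta> \<omega> \<partial>M)"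
    proof -
      have "emeasure ?L A = (\<integral>\<^sup>+x. indicator A x \<partial>?L)" by simp
      also have "\<dots> = (\<integral>\<^sup>+\<omega>. \<zeta> \<omega> * indicator A (X (n + 1) \<omega>) \<partial>M)"
        by (subst nn_integral_distr) (auto simp: nn_integral_density)
      finally show ?thesis by (simp add: indicator_def mult.commute)
    qed
    moreover have "emeasure ?R A = (\<integral>\<^sup>+\<omega>. \<zeta> \<omega> * emeasure (P (X n \<omega>)) A \<partial>M)"
      using measurable_compose[OF K measurable_emeasure_subprob_algebra[OF A]]
      by (simp add: emeasure_bind[OF _ K' A] nn_integral_density)
    ultimately show "emeasure ?L A = emeasure ?R A" by (simp add: mult.commute)
  qed
  moreover have "(\<integral>\<^sup>+x. f x \<partial>?L) = (\<integral>\<^sup>+\<omega>. \<zeta> \<omega> * f (X (n + 1) \<omega>) \<partial>M)"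
    using f by (simp add: nn_integral_distr nn_integral_density)
  moreover have "(\<integral>\<^sup>+x. f x \<partial>?R) = (\<integral>\<^sup>+\<omega>. \<zeta> \<omega> * (\<integral>\<^sup>+x. f x \<partial>P (X n \<omega>)) \<partial>M)"
    using measurable_compose[OF K nn_integral_measurable_subprob_algebra[OF f]]
    by (simp add: nn_integral_bind[OF f K'] nn_integral_density)
  ultimately show ?thesis by simp
qed

text \<open>The first factor is absorbed into the weight, which remains a function of the signal up
  to the current time. The induction therefore generalises over both the time and the
  weight.\<close>

lemma markov_prod:
  assumes "\<And>f. f \<in> set fs \<Longrightarrow> f \<in> borel_measurable borel" and "\<zeta> \<in> borel_measurable (XY {..n} {})"
  shows "(\<integral>\<^sup>+\<omega>. \<zeta> \<omega> * path_prod fs n \<omega> \<partial>M) = (\<integral>\<^sup>+\<omega>. \<zeta> \<omega> * markov_int P fs (X n \<omega>) \<partial>M)"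
  using assms
proof (induction fs arbitrary: n \<zeta>)
  case (Cons f fs)
  have f: "f \<in> borel_measurable borel" and fs: "markov_int P fs \<in> borel_measurable borel"
    using Cons.prems P markov_int_measurable by auto
  have Xn: "X n \<in> XY {..n} {} \<rightarrow>\<^sub>M borel" by (rule X_XY) simp
  have z: "(\<lambda>\<omega>. \<zeta> \<omega> * f (X n \<omega>)) \<in> borel_measurable (XY {..n} {})"
    using Cons.prems(2) measurable_compose[OF Xn f] by measurable
  then have z': "(\<lambda>\<omega>. \<zeta> \<omega> * f (X n \<omega>)) \<in> borel_measurable (XY {..n+1} {})"
    by (rule measurable_XY_mono) (auto intro: order_trans)
  have "(\<integral>\<^sup>+\<omega>. \<zeta> \<omega> * path_prod (f # fs) n \<omega> \<partial>M) = (\<integral>\<^sup>+\<omega>. (\<zeta> \<omega> * f (X n \<omega>)) * path_prod fs (n + 1) \<omega> \<partial>M)"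
    by (simp add: mult.assoc)
  also have "\<dots> = (\<integral>\<^sup>+\<omega>. (\<zeta> \<omega> * f (X n \<omega>)) * markov_int P fs (X (n + 1) \<omega>) \<partial>M)"
    using Cons.prems by (intro Cons.IH z') auto
  also have "\<dots> = (\<integral>\<^sup>+\<omega>. (\<zeta> \<omega> * f (X n \<omega>)) * (\<integral>\<^sup>+x. markov_int P fs x \<partial>P (X n \<omega>)) \<partial>M)"
    by (rule markov_step[OF fs z])
  finally show ?case by (simp add: mult.assoc)
qed simp

text \<open>The weight may depend on the whole signal, not only on its past. This is what allows
  observations to be integrated out, the signal to be treated alone, and some observations to be put
  back afterwards.\<close>

lemma obs_cond:
  assumes J: "finite J" and B: "\<And>j. j \<in> J \<Longrightarrow> B j \<in> sets borel" and \<zeta>: "\<zeta> \<in> borel_measurable (XY UNIV {})"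
  shows "(\<integral>\<^sup>+\<omega>. indicator {\<omega>. \<forall>j\<in>J. Y j \<omega> \<in> B j} \<omega> * \<zeta> \<omega> \<partial>M) =
    (\<integral>\<^sup>+\<omega>. (\<Prod>j\<in>J. emeasure (\<Phi> (X j \<omega>)) (B j)) * \<zeta> \<omega> \<partial>M)"
proof -
  have ae: "AE \<omega> in M. real_cond_exp M (sigma UNIV (FX UNIV)) (indicator {\<omega>. \<forall>j\<in>J. Y j \<omega> \<in> B j}) \<omega>
          = (\<Prod>j\<in>J. measure (\<Phi> (X j \<omega>)) (B j))"
    using hmm J B by (simp add: hmm_def)
  have [measurable]: "(\<lambda>\<omega>. measure (\<Phi> (X j \<omega>)) (B j)) \<in> borel_measurable M" if "j \<in> J" for j
    using measurable_compose[OF X_measurable \<Phi>_measure] B[OF that] by simp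
  have Bs: "{\<omega>. Y j \<omega> \<in> B j} \<in> sets M" if "j \<in> J" for j
    using measurable_sets[OF Y_measurable B[OF that]] by (simp add: vimage_def)
  have "{\<omega>. \<forall>j\<in>J. Y j \<omega> \<in> B j} = {\<omega>\<in>space M. \<forall>j\<in>J. Y j \<omega> \<in> B j}" by simp
  also have "\<dots> \<in> sets M" using J Bs by (intro sets.sets_Collect_finite_All) auto
  finally have Bm: "{\<omega>. \<forall>j\<in>J. Y j \<omega> \<in> B j} \<in> sets M" .
  have "(\<integral>\<^sup>+\<omega>. indicator {\<omega>. \<forall>j\<in>J. Y j \<omega> \<in> B j} \<omega> * \<zeta> \<omega> \<partial>M) =
    (\<integral>\<^sup>+\<omega>. ennreal (\<Prod>j\<in>J. measure (\<Phi> (X j \<omega>)) (B j)) * \<zeta> \<omega> \<partial>M)"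
    by (rule cond_prob_lift[OF _ Bm _ _ ae \<zeta>]) (auto simp: FX_def sigma_sets_idem intro!: prod_nonneg)
  also have "\<dots> = (\<integral>\<^sup>+\<omega>. (\<Prod>j\<in>J. emeasure (\<Phi> (X j \<omega>)) (B j)) * \<zeta> \<omega> \<partial>M)"
  proof -
    have "emeasure (\<Phi> x) C = ennreal (measure (\<Phi> x) C)" for x C
      using \<Phi>_prob(1)[of x] by (simp add: prob_space_def finite_measure.emeasure_eq_measure)
    then show ?thesis by (simp add: prod_ennreal)
  qed
  finally show ?thesis .
qed

end

section \<open>Stationarity and the two-sided Markov property\<close>

text \<open>The factors left for the signal at consecutive times once the observations are
  integrated out. An interval of times suffices, since a cylinder can be padded with
  \<open>UNIV\<close>, whose factor is 1.\<close>

primrec cyl_funs :: "('e \<Rightarrow> 'f measure) \<Rightarrow> (int \<Rightarrow> 'e set) \<Rightarrow> (int \<Rightarrow> 'f set) \<Rightarrow> nat \<Rightarrow> int \<Rightarrow> ('e \<Rightarrow> ennreal) list" where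
  "cyl_funs \<Phi> A B 0 n = []"
| "cyl_funs \<Phi> A B (Suc m) n = (\<lambda>x. indicator (A n) x * emeasure (\<Phi> x) (B n)) # cyl_funs \<Phi> A B m (n + 1)"

lemma int_interval_Suc: "{n..<n + int (Suc m)} = insert n {n + 1..<(n + 1) + int m}"
  by auto

lemma path_prod_cyl_funs:
  "path_prod (cyl_funs \<Phi> A B m n) n \<omega> =
    (\<Prod>i\<in>{n..<n + int m}. indicator (A i) (X i \<omega>) * emeasure (\<Phi> (X i \<omega>)) (B i))"
proof (induction m arbitrary: n)
  case (Suc m)
  show ?case unfolding int_interval_Suc by (subst prod.insert) (simp_all add: Suc)
qed simp

lemma cyl_funs_shift: "cyl_funs \<Phi> (\<lambda>i. A (i - N)) (\<lambda>i. B (i - N)) m (n + N) = cyl_funs \<Phi> A B m n"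
proof (induction m arbitrary: n)
  case (Suc m)
  show ?case using Suc[of "n + 1"] by (simp add: add.commute add.left_commute)
qed simp

lemma finite_int_subset_interval:
  assumes "finite (I :: int set)" obtains n m where "I \<subseteq> {n..<n + int m}"
proof -
  \<comment> \<open>Inserting 0 keeps \<open>Min\<close> and \<open>Max\<close> meaningful when
    \<open>I\<close> is empty.\<close>
  have "I \<subseteq> {Min (insert 0 I)..Max (insert 0 I)}" using assms by auto
  then obtain a b where "I \<subseteq> {a..b}" by blast
  then show ?thesis by (intro that[of a "nat (b - a + 1)"]) auto
qed

definition shift :: "int \<Rightarrow> (int, 'e, 'f) path \<Rightarrow> (int, 'e, 'f) path" where
  "shift N \<omega> = (\<lambda>i. fst \<omega> (i + N), \<lambda>i. snd \<omega> (i + N))"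

lemma X_shift[simp]: "X i (shift N \<omega>) = X (i + N) \<omega>" by (simp add: X_def shift_def)
lemma Y_shift[simp]: "Y i (shift N \<omega>) = Y (i + N) \<omega>" by (simp add: Y_def shift_def)

locale stationary_hmm_measure = hmm_measure P \<Phi> M
  for P :: "'e::polish_space \<Rightarrow> 'e measure"
    and \<Phi> :: "'e \<Rightarrow> 'f::polish_space measure"
    and M :: "(int, 'e, 'f) path measure" +
  fixes \<pi> :: "'e measure"
  assumes X_distr: "distr M borel (X n) = \<pi>"
begin

lemma cyl_funs_measurable:
  assumes "\<And>i. A i \<in> sets borel" "\<And>i. B i \<in> sets borel" "f \<in> set (cyl_funs \<Phi> A B m n)"
  shows "f \<in> borel_measurable borel"
  using assms(3)
proof (induction m arbitrary: n)
  case (Suc m)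
  have "(\<lambda>x. indicator (A n) x * emeasure (\<Phi> x) (B n)) \<in> borel_measurable borel"
    using \<Phi>_emeasure[OF assms(2)] assms(1) by (intro borel_measurable_times_ennreal borel_measurable_indicator)
  then show ?case using Suc by auto
qed simp

text \<open>All observations are integrated out, the Markov property is applied to the remaining
  signal factors from time \<open>n\<close> on, and the past observations are then put back. The
  state at time \<open>n\<close> belongs to the past here, the observation at time \<open>n\<close>
  to the future.\<close>

lemma past_cylinder:
  assumes A: "\<And>i. A i \<in> sets borel" and B: "\<And>i. B i \<in> sets borel"
    and U: "U \<in> sets (XY {..n} {..<n})"
  shows "emeasure M (U \<inter> {\<omega>. \<forall>i\<in>{n..<n + int m}. X i \<omega> \<in> A i \<and> Y i \<omega> \<in> B i}) =
    (\<integral>\<^sup>+\<omega>. indicator U \<omega> * markov_int P (cyl_funs \<Phi> A B m n) (X n \<omega>) \<partial>M)"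
proof -
  let ?I = "{n..<n + int m}"
  define s where "s = markov_int P (cyl_funs \<Phi> A B m n)"
  have s[measurable]: "s \<in> borel_measurable borel"
    unfolding s_def by (rule markov_int_measurable[OF P cyl_funs_measurable[OF A B]])
  define V where "V = {\<omega>. \<forall>i\<in>?I. X i \<omega> \<in> A i \<and> Y i \<omega> \<in> B i}"
  define VX where "VX = {\<omega> :: (int, 'e, 'f) path. \<forall>i\<in>?I. X i \<omega> \<in> A i}"
  have XA: "{\<omega> :: (int, 'e, 'f) path. X i \<omega> \<in> A i} \<in> sets (XY T W)" if "i \<in> T" for i T W
    using measurable_sets[OF X_XY[OF that] A[of i], of W] by (simp add: vimage_def)
  have YB: "{\<omega> :: (int, 'e, 'f) path. Y i \<omega> \<in> B i} \<in> sets (XY T W)" if "i \<in> W" for i T W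
    using measurable_sets[OF Y_XY[OF that] B[of i], of T] by (simp add: vimage_def)
  have "VX = {\<omega>\<in>space (XY UNIV {}). \<forall>i\<in>?I. X i \<omega> \<in> A i}" by (simp add: VX_def)
  also have "\<dots> \<in> sets (XY UNIV {})" using XA by (intro sets.sets_Collect_finite_All) auto
  finally have VX: "VX \<in> sets (XY UNIV {})" .
  have "V = {\<omega>\<in>space (XY UNIV UNIV). \<forall>i\<in>?I. X i \<omega> \<in> A i \<and> Y i \<omega> \<in> B i}" by (simp add: V_def)
  also have "\<dots> \<in> sets (XY UNIV UNIV)"
    using XA YB by (intro sets.sets_Collect_finite_All sets.sets_Collect_conj) auto
  finally have V[measurable]: "V \<in> sets M" by (simp add: sets_M)
  have sXn: "(\<lambda>\<omega>. s (X n \<omega>)) \<in> borel_measurable (XY T W)" if "n \<in> T" for T W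
    by (rule measurable_compose[OF X_XY[OF that] s])
  have "(\<integral>\<^sup>+\<omega>. indicator V \<omega> * indicator U \<omega> \<partial>M) = (\<integral>\<^sup>+\<omega>. s (X n \<omega>) * indicator U \<omega> \<partial>M)"
  proof (rule emeasure_Int_eq_lift[OF finM space_M subalg sets_XY Int_stable_cyl UNIV_in_cyl V])
    fix W :: "(int, 'e, 'f) path set" assume W: "W \<in> cyl {..n} {..<n}"
    then obtain C D where CD: "W = {\<omega>. \<forall>i. X i \<omega> \<in> C i \<and> Y i \<omega> \<in> D i}"
       "\<forall>i. C i \<in> sets borel \<and> D i \<in> sets borel" "finite {i. C i \<noteq> UNIV \<or> D i \<noteq> UNIV}"
       "{i. C i \<noteq> UNIV} \<subseteq> {..n}" "{i. D i \<noteq> UNIV} \<subseteq> {..<n}"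
      unfolding cyl_def by blast
    let ?J = "{i. D i \<noteq> UNIV}"
    have J: "finite ?J" by (rule finite_subset[OF _ CD(3)]) auto
    \<comment> \<open>Because the observation at time \<open>n\<close> counts as future,
      \<open>W\<close> and \<open>V\<close> constrain observations at disjoint sets of times. One
      family \<open>E\<close> can thus carry both constraints, and the product of its factors
      splits.\<close>
    have disj: "?J \<inter> ?I = {}" using CD(5) by auto
    define WX where "WX = {\<omega> :: (int, 'e, 'f) path. \<forall>i. X i \<omega> \<in> C i}"
    have "WX \<in> cyl {..n} {}"
      unfolding cyl_def WX_def mem_Collect_eq
      by (rule exI[of _ C], rule exI[of _ "\<lambda>_. UNIV"]) (use CD finite_subset[OF _ CD(3), of "{i. C i \<noteq> UNIV}"] in auto)
    then have WX: "WX \<in> sets (XY {..n} {})" by (auto simp: sets_XY)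
    have pJ: "(\<lambda>\<omega>. \<Prod>j\<in>?J. emeasure (\<Phi> (X j \<omega>)) (D j)) \<in> borel_measurable (XY {..n} {})"
    proof (rule borel_measurable_prod_ennreal)
      fix j assume "j \<in> ?J"
      then have "j \<in> {..n}" using CD(5) by auto
      then show "(\<lambda>\<omega>. emeasure (\<Phi> (X j \<omega>)) (D j)) \<in> borel_measurable (XY {..n} {})"
        using CD(2) by (intro measurable_compose[OF X_XY \<Phi>_emeasure]) auto
    qed
    define E where "E j = (if j \<in> ?J then D j else B j)" for j
    have "emeasure M (V \<inter> W) = (\<integral>\<^sup>+\<omega>. indicator (V \<inter> W) \<omega> \<partial>M)"
      using V W subalg[of "{..n}" "{..<n}"] by (subst nn_integral_indicator) (auto simp: sets_XY subalgebra_def)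
    also have "\<dots> = (\<integral>\<^sup>+\<omega>. indicator {\<omega>. \<forall>j\<in>?J \<union> ?I. Y j \<omega> \<in> E j} \<omega> * (indicator WX \<omega> * indicator VX \<omega>) \<partial>M)"
    proof (intro nn_integral_cong)
      fix \<omega> :: "(int, 'e, 'f) path"
      have "(\<forall>j\<in>?J \<union> ?I. Y j \<omega> \<in> E j) \<longleftrightarrow> (\<forall>j. Y j \<omega> \<in> D j) \<and> (\<forall>j\<in>?I. Y j \<omega> \<in> B j)"
      proof -
        have 1: "(\<forall>j\<in>?J. Y j \<omega> \<in> E j) \<longleftrightarrow> (\<forall>j. Y j \<omega> \<in> D j)" by (auto simp: E_def)
        have 2: "(\<forall>j\<in>?I. Y j \<omega> \<in> E j) \<longleftrightarrow> (\<forall>j\<in>?I. Y j \<omega> \<in> B j)"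
          using disj by (intro ball_cong) (auto simp: E_def)
        show ?thesis unfolding ball_Un 1 2 ..
      qed
      then have "\<omega> \<in> V \<inter> W \<longleftrightarrow> (\<forall>j\<in>?J \<union> ?I. Y j \<omega> \<in> E j) \<and> \<omega> \<in> WX \<and> \<omega> \<in> VX"
        unfolding V_def CD(1) WX_def VX_def by blast
      then show "(indicator (V \<inter> W) \<omega> :: ennreal) =
          indicator {\<omega>. \<forall>j\<in>?J \<union> ?I. Y j \<omega> \<in> E j} \<omega> * (indicator WX \<omega> * indicator VX \<omega>)"
        by (simp add: indicator_def)
    qed
    also have "\<dots> = (\<integral>\<^sup>+\<omega>. (\<Prod>j\<in>?J \<union> ?I. emeasure (\<Phi> (X j \<omega>)) (E j)) * (indicator WX \<omega> * indicator VX \<omega>) \<partial>M)"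
    proof (rule obs_cond)
      have "WX \<in> sets (XY UNIV {})" using WX XY_mono[of "{..n}" UNIV "{}" "{}"] by auto
      then show "(\<lambda>\<omega>. indicator WX \<omega> * indicator VX \<omega> :: ennreal) \<in> borel_measurable (XY UNIV {})"
        using VX by (intro borel_measurable_times_ennreal borel_measurable_indicator)
    qed (use J CD(2) B in \<open>auto simp: E_def\<close>)
    also have "\<dots> = (\<integral>\<^sup>+\<omega>. ((\<Prod>j\<in>?J. emeasure (\<Phi> (X j \<omega>)) (D j)) * indicator WX \<omega>) * path_prod (cyl_funs \<Phi> A B m n) n \<omega> \<partial>M)"
    proof (intro nn_integral_cong)
      fix \<omega> :: "(int, 'e, 'f) path"
      have 1: "(\<Prod>j\<in>?J \<union> ?I. emeasure (\<Phi> (X j \<omega>)) (E j)) =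
        (\<Prod>j\<in>?J. emeasure (\<Phi> (X j \<omega>)) (E j)) * (\<Prod>j\<in>?I. emeasure (\<Phi> (X j \<omega>)) (E j))"
        by (rule prod.union_disjoint[OF J _ disj]) simp
      have 2: "(\<Prod>j\<in>?J. emeasure (\<Phi> (X j \<omega>)) (E j)) = (\<Prod>j\<in>?J. emeasure (\<Phi> (X j \<omega>)) (D j))"
        by (rule prod.cong) (auto simp: E_def)
      have 3: "(\<Prod>j\<in>?I. emeasure (\<Phi> (X j \<omega>)) (E j)) = (\<Prod>j\<in>?I. emeasure (\<Phi> (X j \<omega>)) (B j))"
        using disj by (intro prod.cong) (auto simp: E_def)
      have 4: "(indicator VX \<omega> :: ennreal) = (\<Prod>i\<in>?I. indicator (A i) (X i \<omega>))"
        unfolding VX_def by (auto simp: indicator_def prod_zero_iff)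
      show "(\<Prod>j\<in>?J \<union> ?I. emeasure (\<Phi> (X j \<omega>)) (E j)) * (indicator WX \<omega> * indicator VX \<omega>) =
        ((\<Prod>j\<in>?J. emeasure (\<Phi> (X j \<omega>)) (D j)) * indicator WX \<omega>) * path_prod (cyl_funs \<Phi> A B m n) n \<omega>"
        unfolding path_prod_cyl_funs 1 2 3 4 prod.distrib by (simp add: ac_simps)
    qed
    also have "\<dots> = (\<integral>\<^sup>+\<omega>. ((\<Prod>j\<in>?J. emeasure (\<Phi> (X j \<omega>)) (D j)) * indicator WX \<omega>) * s (X n \<omega>) \<partial>M)"
      unfolding s_def using pJ WX
      by (intro markov_prod borel_measurable_times_ennreal borel_measurable_indicator cyl_funs_measurable[OF A B])
    also have "\<dots> = (\<integral>\<^sup>+\<omega>. (\<Prod>j\<in>?J. emeasure (\<Phi> (X j \<omega>)) (D j)) * (indicator WX \<omega> * s (X n \<omega>)) \<partial>M)"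
      by (simp add: mult.assoc)
    also have "\<dots> = (\<integral>\<^sup>+\<omega>. indicator {\<omega>. \<forall>j\<in>?J. Y j \<omega> \<in> D j} \<omega> * (indicator WX \<omega> * s (X n \<omega>)) \<partial>M)"
    proof (rule obs_cond[symmetric, OF J])
      have "WX \<in> sets (XY UNIV {})" using WX XY_mono[of "{..n}" UNIV "{}" "{}"] by auto
      then show "(\<lambda>\<omega>. indicator WX \<omega> * s (X n \<omega>)) \<in> borel_measurable (XY UNIV {})"
        using sXn by (intro borel_measurable_times_ennreal borel_measurable_indicator) auto
    qed (use CD(2) in auto)
    also have "\<dots> = (\<integral>\<^sup>+\<omega>. indicator W \<omega> * s (X n \<omega>) \<partial>M)"
    proof (intro nn_integral_cong)
      fix \<omega> :: "(int, 'e, 'f) path"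
      have "\<omega> \<in> W \<longleftrightarrow> (\<forall>j\<in>?J. Y j \<omega> \<in> D j) \<and> \<omega> \<in> WX"
        unfolding CD(1) WX_def by blast
      then show "indicator {\<omega>. \<forall>j\<in>?J. Y j \<omega> \<in> D j} \<omega> * (indicator WX \<omega> * s (X n \<omega>)) = indicator W \<omega> * s (X n \<omega>)"
        by (simp add: indicator_def)
    qed
    finally show "emeasure M (V \<inter> W) = (\<integral>\<^sup>+\<omega>. indicator W \<omega> * s (X n \<omega>) \<partial>M)" .
  qed (use U in auto)
  moreover have "U \<in> sets M" using U subalg[of "{..n}" "{..<n}"] by (auto simp: subalgebra_def)
  ultimately show ?thesis
    unfolding s_def[symmetric] V_def[symmetric] using V
    by (simp add: nn_integral_indicator[symmetric] indicator_inter_arith mult.commute del: nn_integral_indicator)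
qed

lemma cyl_as_interval:
  assumes "{i. A i \<noteq> UNIV \<or> B i \<noteq> UNIV} \<subseteq> {n..<n + int m}"
  shows "{\<omega>. \<forall>i. X i \<omega> \<in> A i \<and> Y i \<omega> \<in> B i} = {\<omega>. \<forall>i\<in>{n..<n + int m}. X i \<omega> \<in> A i \<and> Y i \<omega> \<in> B i}"
  using assms by blast

text \<open>By \<open>past_cylinder\<close>, the prediction of a future cylinder from the past is a
  function of \<open>X n\<close>, so \<open>factor_cond_indep\<close> applies. In the conclusion a
  past event is seen by the future only through \<open>X n\<close>.\<close>

lemma past_future:
  assumes U: "U \<in> sets (XY {..n} {..<n})"
  shows "\<exists>a\<in>borel_measurable borel. \<forall>\<xi>\<in>borel_measurable (XY {n..} {n..}).
    (\<integral>\<^sup>+\<omega>. indicator U \<omega> * \<xi> \<omega> \<partial>M) = (\<integral>\<^sup>+\<omega>. a (X n \<omega>) * \<xi> \<omega> \<partial>M)"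
proof (rule factor_cond_indep[OF finM space_M subalg _ subalg sets_XY Int_stable_cyl UNIV_in_cyl _ U])
  fix V :: "(int, 'e, 'f) path set" assume "V \<in> cyl {n..} {n..}"
  then obtain A B where AB: "V = {\<omega>. \<forall>i. X i \<omega> \<in> A i \<and> Y i \<omega> \<in> B i}"
     "\<forall>i. A i \<in> sets borel \<and> B i \<in> sets borel" "finite {i. A i \<noteq> UNIV \<or> B i \<noteq> UNIV}"
     "{i. A i \<noteq> UNIV} \<subseteq> {n..}" "{i. B i \<noteq> UNIV} \<subseteq> {n..}"
    unfolding cyl_def by blast
  obtain a k where ak: "{i. A i \<noteq> UNIV \<or> B i \<noteq> UNIV} \<subseteq> {a..<a + int k}"
    using finite_int_subset_interval[OF AB(3)] by blast
  \<comment> \<open>All constrained times are at least \<open>n\<close>, so the interval may start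
    at \<open>n\<close>; \<open>nat\<close> gives it length 0 if the old interval ends before
    \<open>n\<close>.\<close>
  have "{i. A i \<noteq> UNIV \<or> B i \<noteq> UNIV} \<subseteq> {n..<n + int (nat (a + int k - n))}"
    using ak AB(4,5) by (auto simp: subset_iff)
  from cyl_as_interval[OF this] have "V = {\<omega>. \<forall>i\<in>{n..<n + int (nat (a + int k - n))}. X i \<omega> \<in> A i \<and> Y i \<omega> \<in> B i}"
    using AB(1) by simp
  with past_cylinder[of A B _ n "nat (a + int k - n)"] AB(2)
  show "\<exists>s\<in>borel_measurable borel. \<forall>U\<in>sets (XY {..n} {..<n}).
      emeasure M (U \<inter> V) = (\<integral>\<^sup>+ x. indicator U x * s (X n x) \<partial>M)"
    by (intro bexI[of _ "markov_int P (cyl_funs \<Phi> A B (nat (a + int k - n)) n)"] markov_int_measurable[OF P])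
       (auto intro: cyl_funs_measurable[of A B])
qed (auto intro: X_XY)

lemma future_past:
  assumes V: "V \<in> sets (XY {n..} {n..})"
  shows "\<exists>b\<in>borel_measurable borel. \<forall>\<zeta>\<in>borel_measurable (XY {..n} {..<n}).
    (\<integral>\<^sup>+\<omega>. indicator V \<omega> * \<zeta> \<omega> \<partial>M) = (\<integral>\<^sup>+\<omega>. b (X n \<omega>) * \<zeta> \<omega> \<partial>M)"
  by (rule factor_cond_indep_sym[OF finM space_M subalg _ _ subalg past_future V]) (auto intro: X_XY)

lemma shift_measurable: "shift N \<in> M \<rightarrow>\<^sub>M M"
proof -
  have "shift N \<in> M \<rightarrow>\<^sub>M XY UNIV UNIV" by (rule measurable_into_XY) simp_all
  then show ?thesis using measurable_cong_sets[OF refl sets_M[symmetric]] by auto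
qed

text \<open>By \<open>past_cylinder\<close> with the trivial past event, the probability of a
  cylinder depends on its position only through the law of the first state, and this law is
  \<open>\<pi>\<close> at every time.\<close>

lemma shift_invariant: "distr M M (shift N) = M"
proof (rule measure_eqI_generator_eq[where E="cyl UNIV UNIV" and \<Omega>=UNIV and A="\<lambda>_. UNIV"])
  fix V :: "(int, 'e, 'f) path set" assume V: "V \<in> cyl UNIV UNIV"
  then have VM: "V \<in> sets M" by (auto simp: sets_M sets_XY)
  from V obtain A B where AB: "V = {\<omega>. \<forall>i. X i \<omega> \<in> A i \<and> Y i \<omega> \<in> B i}"
     "\<forall>i. A i \<in> sets borel \<and> B i \<in> sets borel" "finite {i. A i \<noteq> UNIV \<or> B i \<noteq> UNIV}"
    unfolding cyl_def by blast
  have *: "emeasure M {\<omega>. \<forall>i. X i \<omega> \<in> A i \<and> Y i \<omega> \<in> B i} = (\<integral>\<^sup>+x. markov_int P (cyl_funs \<Phi> A B k a) x \<partial>\<pi>)"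
    if "\<forall>i. A i \<in> sets borel \<and> B i \<in> sets borel" "{i. A i \<noteq> UNIV \<or> B i \<noteq> UNIV} \<subseteq> {a..<a + int k}" for A B a k
  proof -
    have [measurable]: "markov_int P (cyl_funs \<Phi> A B k a) \<in> borel_measurable borel"
      using that by (intro markov_int_measurable[OF P cyl_funs_measurable[of A B]]) auto
    have "emeasure M (UNIV \<inter> {\<omega>. \<forall>i. X i \<omega> \<in> A i \<and> Y i \<omega> \<in> B i}) = (\<integral>\<^sup>+\<omega>. indicator UNIV \<omega> * markov_int P (cyl_funs \<Phi> A B k a) (X a \<omega>) \<partial>M)"
      unfolding cyl_as_interval[OF that(2)] using that(1) sets.top[of "XY {..a} {..<a}"] by (intro past_cylinder) auto
    also have "\<dots> = (\<integral>\<^sup>+x. markov_int P (cyl_funs \<Phi> A B k a) x \<partial>distr M borel (X a))"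
      by (simp add: nn_integral_distr)
    finally show ?thesis by (simp add: X_distr)
  qed
  obtain a k where ak: "{i. A i \<noteq> UNIV \<or> B i \<noteq> UNIV} \<subseteq> {a..<a + int k}"
    using finite_int_subset_interval[OF AB(3)] by blast
  have "shift N -` V = {\<omega>. \<forall>i. X i \<omega> \<in> A (i - N) \<and> Y i \<omega> \<in> B (i - N)}"
  proof -
    have "(\<forall>i. X (i + N) \<omega> \<in> A i \<and> Y (i + N) \<omega> \<in> B i) \<longleftrightarrow> (\<forall>i. X i \<omega> \<in> A (i - N) \<and> Y i \<omega> \<in> B (i - N))" for \<omega>
      by (metis add_diff_cancel_right' diff_add_cancel)
    then show ?thesis unfolding AB(1) by auto
  qed
  moreover have "{i. A (i - N) \<noteq> UNIV \<or> B (i - N) \<noteq> UNIV} \<subseteq> {a + N..<a + N + int k}"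
    using ak by (auto simp: subset_iff)
  ultimately have "emeasure M (shift N -` V) = (\<integral>\<^sup>+x. markov_int P (cyl_funs \<Phi> A B k a) x \<partial>\<pi>)"
    using *[of "\<lambda>i. A (i - N)" "\<lambda>i. B (i - N)" "a + N" k] AB(2) by (simp add: cyl_funs_shift)
  then show "emeasure (distr M M (shift N)) V = emeasure M V"
    using *[OF AB(2) ak] VM shift_measurable by (simp add: emeasure_distr AB(1))
next
  interpret D: prob_space "distr M M (shift N)" by (rule prob_space_distr[OF shift_measurable])
  show "emeasure (distr M M (shift N)) UNIV \<noteq> \<infinity>" for i :: nat
    using D.emeasure_finite by simp
qed (auto simp: sets_M sets_XY Int_stable_cyl UNIV_in_cyl)

end

section \<open>Conditional independence given the observations\<close>

lemma measurable_pair_YM: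
  assumes "i \<in> T'" "U \<subseteq> U'"
  shows "(\<lambda>\<omega>. (X i \<omega>, snd \<omega>)) \<in> XY T' U' \<rightarrow>\<^sub>M borel \<Otimes>\<^sub>M YM U"
  using assms by (auto intro!: measurable_Pair X_XY snd_XY)

lemma pair_YM_mono:
  assumes "q \<in> borel_measurable (N \<Otimes>\<^sub>M YM U)" "U \<subseteq> U'"
  shows "q \<in> borel_measurable (N \<Otimes>\<^sub>M YM U')"
proof -
  have [measurable]: "(\<lambda>y. y) \<in> YM U' \<rightarrow>\<^sub>M YM U"
    by (rule measurable_into_YM) (use assms(2) in \<open>auto intro: YM_component\<close>)
  have "(\<lambda>z. (fst z, snd z)) \<in> N \<Otimes>\<^sub>M YM U' \<rightarrow>\<^sub>M N \<Otimes>\<^sub>M YM U" by measurable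
  from measurable_compose[OF this assms(1)] show ?thesis by simp
qed

lemma cyl_split:
  fixes W :: "('i, 'e::topological_space, 'f::topological_space) path set"
  assumes "W \<in> cyl T U"
  obtains W1 W2 where "W = W1 \<inter> W2" "W1 \<in> cyl T (U \<inter> S)" "W2 \<in> cyl {} (U - S)"
proof -
  from assms obtain C D where CD: "W = {\<omega>. \<forall>i. X i \<omega> \<in> C i \<and> Y i \<omega> \<in> D i}"
     "\<forall>i. C i \<in> sets borel \<and> D i \<in> sets borel" "finite {i. C i \<noteq> UNIV \<or> D i \<noteq> UNIV}"
     "{i. C i \<noteq> UNIV} \<subseteq> T" "{i. D i \<noteq> UNIV} \<subseteq> U"
    unfolding cyl_def by blast
  let ?D1 = "\<lambda>i. if i \<in> S then D i else UNIV" and ?D2 = "\<lambda>i. if i \<in> S then UNIV else D i"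
  have 1: "{\<omega>. \<forall>i. X i \<omega> \<in> C i \<and> Y i \<omega> \<in> ?D1 i} \<in> cyl T (U \<inter> S)"
    unfolding cyl_def mem_Collect_eq
  proof (intro exI conjI)
    show "finite {i. C i \<noteq> UNIV \<or> ?D1 i \<noteq> UNIV}" by (rule finite_subset[OF _ CD(3)]) auto
  qed (use CD in \<open>auto split: if_splits\<close>)
  have 2: "{\<omega>. \<forall>i. X i \<omega> \<in> (UNIV :: 'e set) \<and> Y i \<omega> \<in> ?D2 i} \<in> cyl {} (U - S)"
    unfolding cyl_def mem_Collect_eq
  proof (rule exI[of _ "\<lambda>_. UNIV"], rule exI[of _ ?D2], intro conjI)
    show "finite {i. (UNIV :: 'e set) \<noteq> UNIV \<or> ?D2 i \<noteq> UNIV}" by (rule finite_subset[OF _ CD(3)]) auto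
  qed (use CD in \<open>auto split: if_splits\<close>)
  have "Y i \<omega> \<in> D i \<longleftrightarrow> Y i \<omega> \<in> ?D1 i \<and> Y i \<omega> \<in> ?D2 i" for i and \<omega> :: "('i, 'e, 'f) path"
    by simp
  then have "W = {\<omega>. \<forall>i. X i \<omega> \<in> C i \<and> Y i \<omega> \<in> ?D1 i} \<inter> {\<omega>. \<forall>i. X i \<omega> \<in> UNIV \<and> Y i \<omega> \<in> ?D2 i}"
    unfolding CD(1) by blast
  then show ?thesis using that 1 2 by blast
qed

lemma cyl_sets: "W \<in> cyl T U \<Longrightarrow> T \<subseteq> T' \<Longrightarrow> U \<subseteq> U' \<Longrightarrow> W \<in> sets (XY T' U')"
  using XY_mono[of T T' U U'] by (auto simp: sets_XY)

lemma cyl_Y_snd: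
  assumes "W \<in> cyl {} U" obtains C where "C \<in> sets (YM U)" "W = snd -` C"
  using FY_snd[of W U] cyl_sets[OF assms, of "{}" U] by (auto simp: sets_XY_FY)

context stationary_hmm_measure
begin

lemma sub_M: "A \<in> sets (XY T U) \<Longrightarrow> A \<in> sets M"
  using subalg[of T U] by (auto simp: subalgebra_def)

text \<open>The past signal and the observations before \<open>n\<close> add nothing to the
  prediction of the future signal from \<open>X n\<close> and the later observations in
  \<open>T\<close>. The past part of a cylinder is first replaced by a function of
  \<open>X n\<close>, which makes \<open>factor_density\<close> applicable, and is restored at the
  end.\<close>

lemma future_X_given_obs:
  assumes A: "A \<in> sets (XY {n..} {})"
  shows "\<exists>q\<in>borel_measurable (borel \<Otimes>\<^sub>M YM T). \<forall>W\<in>sets (XY {..n} T).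
    emeasure M (W \<inter> A) = (\<integral>\<^sup>+\<omega>. indicator W \<omega> * q (X n \<omega>, snd \<omega>) \<partial>M)"
proof -
  \<comment> \<open>Only the observations of \<open>T\<close> from time \<open>n\<close> on are
    kept. This makes \<open>q\<close> measurable for the future, as needed when
    \<open>past_future\<close> is applied in the opposite direction to bring back
    \<open>U\<close>.\<close>
  let ?T = "T - {..<n}" and ?Z = "\<lambda>\<omega> :: (int, 'e, 'f) path. (X n \<omega>, snd \<omega>)"
  have A': "A \<in> sets (XY {n..} {n..})" using A XY_mono[of "{n..}" "{n..}" "{}" "{n..}"] by auto
  note AM[measurable] = sub_M[OF A]
  have Z[measurable]: "?Z \<in> M \<rightarrow>\<^sub>M borel \<Otimes>\<^sub>M YM ?T"
    by (rule measurable_from_subalg[OF subalg[of UNIV UNIV] measurable_pair_YM]) auto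
  obtain q where q[measurable]: "q \<in> borel_measurable (borel \<Otimes>\<^sub>M YM ?T)"
    and qeq: "\<And>\<psi>. \<psi> \<in> borel_measurable (borel \<Otimes>\<^sub>M YM ?T) \<Longrightarrow>
      (\<integral>\<^sup>+\<omega>. indicator A \<omega> * \<psi> (?Z \<omega>) \<partial>M) = (\<integral>\<^sup>+\<omega>. q (?Z \<omega>) * \<psi> (?Z \<omega>) \<partial>M)"
    using factor_density[OF finM Z AM] by blast
  have qZ: "(\<lambda>\<omega>. q (?Z \<omega>)) \<in> borel_measurable (XY {n..} {n..})"
    by (rule measurable_compose[OF measurable_pair_YM q]) auto
  have "emeasure M (W \<inter> A) = (\<integral>\<^sup>+\<omega>. indicator W \<omega> * q (?Z \<omega>) \<partial>M)" if W: "W \<in> sets (XY {..n} T)" for W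
  proof -
    have "(\<integral>\<^sup>+\<omega>. indicator A \<omega> * indicator W \<omega> \<partial>M) = (\<integral>\<^sup>+\<omega>. q (?Z \<omega>) * indicator W \<omega> \<partial>M)"
    proof (rule emeasure_Int_eq_lift[OF finM space_M subalg sets_XY Int_stable_cyl UNIV_in_cyl AM])
      fix V :: "(int, 'e, 'f) path set" assume V: "V \<in> cyl {..n} T"
      obtain U K where UK: "V = U \<inter> K" "U \<in> cyl {..n} (T \<inter> {..<n})" "K \<in> cyl {} ?T"
        using cyl_split[OF V] by blast
      have U: "U \<in> sets (XY {..n} {..<n})" by (rule cyl_sets[OF UK(2)]) auto
      have K: "K \<in> sets (XY {n..} {n..})" by (rule cyl_sets[OF UK(3)]) auto
      note [measurable] = sub_M[OF U] sub_M[OF K]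
      obtain C where C: "C \<in> sets (YM ?T)" "K = snd -` C" using cyl_Y_snd[OF UK(3)] by blast
      obtain a where a[measurable]: "a \<in> borel_measurable borel"
        and aeq: "\<And>\<xi>. \<xi> \<in> borel_measurable (XY {n..} {n..}) \<Longrightarrow>
          (\<integral>\<^sup>+\<omega>. indicator U \<omega> * \<xi> \<omega> \<partial>M) = (\<integral>\<^sup>+\<omega>. a (X n \<omega>) * \<xi> \<omega> \<partial>M)"
        using past_future[OF U] by blast
      have KC: "indicator K \<omega> = (indicator C (snd \<omega>) :: ennreal)" for \<omega> by (simp add: C(2) indicator_def)
      have "emeasure M (A \<inter> V) = (\<integral>\<^sup>+\<omega>. indicator U \<omega> * (indicator K \<omega> * indicator A \<omega>) \<partial>M)"
        unfolding UK(1)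
        by (simp add: nn_integral_indicator[symmetric] indicator_inter_arith ac_simps del: nn_integral_indicator)
      also have "\<dots> = (\<integral>\<^sup>+\<omega>. a (X n \<omega>) * (indicator K \<omega> * indicator A \<omega>) \<partial>M)"
        using K A' by (intro aeq borel_measurable_times_ennreal borel_measurable_indicator)
      also have "\<dots> = (\<integral>\<^sup>+\<omega>. indicator A \<omega> * (\<lambda>z. a (fst z) * indicator C (snd z)) (?Z \<omega>) \<partial>M)"
        by (simp add: KC ac_simps)
      also have "\<dots> = (\<integral>\<^sup>+\<omega>. q (?Z \<omega>) * (\<lambda>z. a (fst z) * indicator C (snd z)) (?Z \<omega>) \<partial>M)"
      proof (rule qeq)
        note C(1)[measurable]
        show "(\<lambda>z. a (fst z) * indicator C (snd z)) \<in> borel_measurable (borel \<Otimes>\<^sub>M YM ?T)" by measurable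
      qed
      also have "\<dots> = (\<integral>\<^sup>+\<omega>. a (X n \<omega>) * (indicator K \<omega> * q (?Z \<omega>)) \<partial>M)"
        by (simp add: KC ac_simps)
      also have "\<dots> = (\<integral>\<^sup>+\<omega>. indicator U \<omega> * (indicator K \<omega> * q (?Z \<omega>)) \<partial>M)"
        using K qZ by (intro aeq[symmetric] borel_measurable_times_ennreal borel_measurable_indicator)
      also have "\<dots> = (\<integral>\<^sup>+\<omega>. indicator V \<omega> * q (?Z \<omega>) \<partial>M)"
        unfolding UK(1) by (simp add: indicator_inter_arith ac_simps)
      finally show "emeasure M (A \<inter> V) = (\<integral>\<^sup>+\<omega>. indicator V \<omega> * q (?Z \<omega>) \<partial>M)" .
    qed (use W in auto)
    then show ?thesis using sub_M[OF W]
      by (simp add: nn_integral_indicator[symmetric] indicator_inter_arith mult.commute del: nn_integral_indicator)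
  qed
  moreover have "q \<in> borel_measurable (borel \<Otimes>\<^sub>M YM T)" by (rule pair_YM_mono[OF q]) auto
  ultimately show ?thesis by blast
qed

text \<open>The state at time \<open>n\<close> together with the observations in \<open>T\<close>
  separates the past of the signal from its future. The observations of a future cylinder are part
  of the conditioning, so they are moved over to the past event, which leaves a pure signal event
  for \<open>future_X_given_obs\<close>.\<close>

lemma past_future_given_obs:
  assumes U: "U \<in> sets (XY {..n} T)"
  shows "\<exists>a\<in>borel_measurable (borel \<Otimes>\<^sub>M YM T). \<forall>\<xi>\<in>borel_measurable (XY {n..} T).
    (\<integral>\<^sup>+\<omega>. indicator U \<omega> * \<xi> \<omega> \<partial>M) = (\<integral>\<^sup>+\<omega>. a (X n \<omega>, snd \<omega>) * \<xi> \<omega> \<partial>M)"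
proof (rule factor_cond_indep[OF finM space_M subalg _ subalg sets_XY Int_stable_cyl UNIV_in_cyl _ U])
  show "(\<lambda>\<omega>. (X n \<omega>, snd \<omega>)) \<in> XY {..n} T \<rightarrow>\<^sub>M borel \<Otimes>\<^sub>M YM T" by (rule measurable_pair_YM) auto
  fix V :: "(int, 'e, 'f) path set" assume V: "V \<in> cyl {n..} T"
  obtain A K where AK: "V = A \<inter> K" "A \<in> cyl {n..} (T \<inter> {})" "K \<in> cyl {} (T - {})"
    using cyl_split[OF V] by blast
  have A: "A \<in> sets (XY {n..} {})" by (rule cyl_sets[OF AK(2)]) auto
  have K: "K \<in> sets (XY {..n} T)" by (rule cyl_sets[OF AK(3)]) auto
  obtain C where C: "C \<in> sets (YM T)" "K = snd -` C" using cyl_Y_snd[OF AK(3)] by auto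
  have KC: "indicator K \<omega> = (indicator C (snd \<omega>) :: ennreal)" for \<omega> by (simp add: C(2) indicator_def)
  obtain q where q[measurable]: "q \<in> borel_measurable (borel \<Otimes>\<^sub>M YM T)"
    and qeq: "\<And>W. W \<in> sets (XY {..n} T) \<Longrightarrow> emeasure M (W \<inter> A) = (\<integral>\<^sup>+\<omega>. indicator W \<omega> * q (X n \<omega>, snd \<omega>) \<partial>M)"
    using future_X_given_obs[OF A] by blast
  show "\<exists>s\<in>borel_measurable (borel \<Otimes>\<^sub>M YM T). \<forall>U\<in>sets (XY {..n} T).
    emeasure M (U \<inter> V) = (\<integral>\<^sup>+\<omega>. indicator U \<omega> * s (X n \<omega>, snd \<omega>) \<partial>M)"
  proof (intro bexI ballI)
    show "(\<lambda>z. q z * indicator C (snd z)) \<in> borel_measurable (borel \<Otimes>\<^sub>M YM T)"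
    proof -
      note C(1)[measurable]
      show ?thesis by measurable
    qed
    fix W :: "(int, 'e, 'f) path set" assume W: "W \<in> sets (XY {..n} T)"
    have "emeasure M (W \<inter> V) = emeasure M ((W \<inter> K) \<inter> A)" by (simp add: AK(1) ac_simps)
    also have "\<dots> = (\<integral>\<^sup>+\<omega>. indicator (W \<inter> K) \<omega> * q (X n \<omega>, snd \<omega>) \<partial>M)" using W K by (intro qeq) auto
    also have "\<dots> = (\<integral>\<^sup>+\<omega>. indicator W \<omega> * (q (X n \<omega>, snd \<omega>) * indicator C (snd (X n \<omega>, snd \<omega>))) \<partial>M)"
      by (simp add: KC indicator_inter_arith ac_simps)
    finally show "emeasure M (W \<inter> V) = \<dots>" .
  qed
qed

lemma future_past_given_obs:
  assumes V: "V \<in> sets (XY {n..} T)"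
  shows "\<exists>b\<in>borel_measurable (borel \<Otimes>\<^sub>M YM T). \<forall>\<zeta>\<in>borel_measurable (XY {..n} T).
    (\<integral>\<^sup>+\<omega>. indicator V \<omega> * \<zeta> \<omega> \<partial>M) = (\<integral>\<^sup>+\<omega>. b (X n \<omega>, snd \<omega>) * \<zeta> \<omega> \<partial>M)"
  by (rule factor_cond_indep_sym[OF finM space_M subalg _ _ subalg past_future_given_obs V])
    (auto intro: measurable_pair_YM)

text \<open>An approximation by the signal on one side of \<open>n\<close> and the observations can
  be traded for one by the present state and the observations, at the price of the factor 3 from
  \<open>factor_approx\<close>. \<open>T1\<close> is left open so that it can be either half
  line.\<close>

lemma approx_present:
  assumes T1: "n \<in> T1" and A: "A \<in> sets M" and A': "A' \<in> sets (XY T1 T)"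
    and b: "\<exists>b\<in>borel_measurable (borel \<Otimes>\<^sub>M YM T). \<forall>\<zeta>\<in>borel_measurable (XY T1 T).
      (\<integral>\<^sup>+\<omega>. indicator A \<omega> * \<zeta> \<omega> \<partial>M) = (\<integral>\<^sup>+\<omega>. b (X n \<omega>, snd \<omega>) * \<zeta> \<omega> \<partial>M)"
  shows "\<exists>D\<in>sets (borel \<Otimes>\<^sub>M YM T). measure M (sym_diff A {\<omega>. (X n \<omega>, snd \<omega>) \<in> D}) \<le> 3 * measure M (sym_diff A A')"
proof -
  obtain b where bm: "b \<in> borel_measurable (borel \<Otimes>\<^sub>M YM T)" and beq: "\<And>\<zeta>. \<zeta> \<in> borel_measurable (XY T1 T) \<Longrightarrow>
      (\<integral>\<^sup>+\<omega>. indicator A \<omega> * \<zeta> \<omega> \<partial>M) = (\<integral>\<^sup>+\<omega>. b (X n \<omega>, snd \<omega>) * \<zeta> \<omega> \<partial>M)"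
    using b by blast
  show ?thesis
  proof (rule factor_approx[OF finM space_M subalg _ A bm _ A'])
    show "(\<lambda>\<omega>. (X n \<omega>, snd \<omega>)) \<in> XY T1 T \<rightarrow>\<^sub>M borel \<Otimes>\<^sub>M YM T" by (rule measurable_pair_YM[OF T1]) auto
    fix W :: "(int, 'e, 'f) path set" assume W: "W \<in> sets (XY T1 T)"
    show "emeasure M (W \<inter> A) = (\<integral>\<^sup>+\<omega>. indicator W \<omega> * b (X n \<omega>, snd \<omega>) \<partial>M)"
      using beq[of "indicator W"] W sub_M[OF W] A
      by (simp add: nn_integral_indicator[symmetric] indicator_inter_arith mult.commute del: nn_integral_indicator)
  qed
qed

lemma approx_increasing:
  assumes E: "\<And>m n. m \<le> n \<Longrightarrow> E m \<subseteq> E n" and S: "S \<subseteq> (\<Union>n::nat. E n)"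
    and A: "A \<in> sets (XY S T)" and e: "0 < (e::real)"
  shows "\<exists>N. \<forall>n\<ge>N. \<exists>B\<in>sets (XY (E n) T). measure M (sym_diff A B) < e"
proof (rule increasing_union_approx[OF finM space_M subalg _ _ e])
  show "sets (XY (E m) T) \<subseteq> sets (XY (E n) T :: (int, 'e, 'f) path measure)" if "m \<le> n" for m n
    using E[OF that] by (rule XY_mono) simp
  let ?G = "\<Union>n. sets (XY (E n) T) :: (int, 'e, 'f) path set set"
  have "sets (XY S T) \<subseteq> sets (sigma UNIV ?G)"
  proof (rule XY_subset)
    fix i assume "i \<in> S"
    then obtain n where "i \<in> E n" using S by auto
    show "X i \<in> sigma UNIV ?G \<rightarrow>\<^sub>M borel"
      using measurable_sets[OF X_XY[OF \<open>i \<in> E n\<close>, of T]] by (intro measurableI) (auto intro!: sigma_sets.Basic)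
  next
    fix i assume "i \<in> T"
    show "Y i \<in> sigma UNIV ?G \<rightarrow>\<^sub>M borel"
      using measurable_sets[OF Y_XY[OF \<open>i \<in> T\<close>, of "E 0"]] by (intro measurableI) (auto intro!: sigma_sets.Basic)
  qed simp
  then show "A \<in> sigma_sets UNIV ?G" using A by auto
qed

text \<open>A tail event plays two roles: it is approximated by the signal up to a late time
  \<open>N\<close>, and it is itself an event of the signal from \<open>N\<close> on, hence
  separated from that past by the state at \<open>N\<close> and the observations. The tolerance
  \<open>e/3\<close> absorbs the factor of \<open>approx_present\<close>.\<close>

lemma tail_future_approx:
  assumes A: "\<And>n::nat. A \<in> sets (XY {int n..} T)" and e: "0 < (e::real)"
  shows "\<exists>N0. \<forall>N::nat\<ge>N0. \<exists>D\<in>sets (borel \<Otimes>\<^sub>M YM T). measure M (sym_diff A {\<omega>. (X (int N) \<omega>, snd \<omega>) \<in> D}) < e"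
proof -
  have "\<exists>N0. \<forall>N::nat\<ge>N0. \<exists>B\<in>sets (XY {..int N} T). measure M (sym_diff A B) < e/3"
  proof (rule approx_increasing)
    show "{int 0..} \<subseteq> (\<Union>n. {..int n})" using nat_0_le by (auto simp: nat_le_iff[symmetric])
  qed (use e A[of 0] in auto)
  then obtain N0 where N0: "\<And>N. N \<ge> N0 \<Longrightarrow> \<exists>B\<in>sets (XY {..int N} T). measure M (sym_diff A B) < e/3" by blast
  have "\<exists>D\<in>sets (borel \<Otimes>\<^sub>M YM T). measure M (sym_diff A {\<omega>. (X (int N) \<omega>, snd \<omega>) \<in> D}) < e" if "N \<ge> N0" for N
  proof -
    from N0[OF that] obtain B where B: "B \<in> sets (XY {..int N} T)" "measure M (sym_diff A B) < e/3" by blast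
    show ?thesis
      using approx_present[OF _ sub_M[OF A[of 0]] B(1) future_past_given_obs[OF A]] B(2) by force
  qed
  then show ?thesis by blast
qed

lemma tail_past_approx:
  assumes A: "\<And>n::nat. A \<in> sets (XY {..- int n} T)" and e: "0 < (e::real)"
  shows "\<exists>N0. \<forall>N::nat\<ge>N0. \<exists>D\<in>sets (borel \<Otimes>\<^sub>M YM T). measure M (sym_diff A {\<omega>. (X (- int N) \<omega>, snd \<omega>) \<in> D}) < e"
proof -
  have "\<exists>N0. \<forall>N::nat\<ge>N0. \<exists>B\<in>sets (XY {- int N..} T). measure M (sym_diff A B) < e/3"
  proof (rule approx_increasing)
    show "{..- int 0} \<subseteq> (\<Union>n. {- int n..})" by (auto simp: minus_le_iff nat_le_iff[symmetric])
  qed (use e A[of 0] in auto)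
  then obtain N0 where N0: "\<And>N. N \<ge> N0 \<Longrightarrow> \<exists>B\<in>sets (XY {- int N..} T). measure M (sym_diff A B) < e/3" by blast
  have "\<exists>D\<in>sets (borel \<Otimes>\<^sub>M YM T). measure M (sym_diff A {\<omega>. (X (- int N) \<omega>, snd \<omega>) \<in> D}) < e" if "N \<ge> N0" for N
  proof -
    from N0[OF that] obtain B where B: "B \<in> sets (XY {- int N..} T)" "measure M (sym_diff A B) < e/3" by blast
    show ?thesis
      using approx_present[OF _ sub_M[OF A[of 0]] B(1) past_future_given_obs[OF A]] B(2) by force
  qed
  then show ?thesis by blast
qed

end

section \<open>Mixing\<close>

text \<open>\<open>N\<close> is a \<open>\<nu>\<close>-null set of maximal
  \<open>\<mu>\<close>-measure, the union of a sequence of nearly maximal ones. Off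
  \<open>N\<close>, \<open>\<mu>\<close> is absolutely continuous, since a null set with positive
  mass there could be added to \<open>N\<close>.\<close>

lemma lebesgue_decomposition:
  fixes \<mu> \<nu> :: "'a measure"
  assumes \<mu>: "finite_measure \<mu>" and \<nu>: "finite_measure \<nu>" and S[measurable_cong]: "sets \<mu> = sets \<nu>"
  obtains N p where "N \<in> null_sets \<nu>" "p \<in> borel_measurable \<nu>"
    "\<And>f. f \<in> borel_measurable \<nu> \<Longrightarrow> (\<integral>\<^sup>+x. f x * indicator (space \<nu> - N) x \<partial>\<mu>) = (\<integral>\<^sup>+x. f x * p x \<partial>\<nu>)"
proof -
  interpret \<mu>: finite_measure \<mu> by fact
  interpret \<nu>: finite_measure \<nu> by fact
  define s where "s = (SUP N\<in>null_sets \<nu>. measure \<mu> N)"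
  have bdd: "bdd_above (measure \<mu> ` null_sets \<nu>)"
    using \<mu>.bounded_measure by (auto simp: bdd_above_def)
  have "\<exists>N\<in>null_sets \<nu>. s - 1 / real (Suc i) < measure \<mu> N" for i
    using less_cSUP_iff[OF _ bdd, of "s - 1 / real (Suc i)"] unfolding s_def[symmetric]
    by (auto simp: field_simps)
  then obtain K where K: "\<And>i. K i \<in> null_sets \<nu>" "\<And>i. s - 1 / real (Suc i) < measure \<mu> (K i)" by metis
  define N where "N = (\<Union>i. K i)"
  have N: "N \<in> null_sets \<nu>" unfolding N_def using K(1) by (intro null_sets_UN) auto
  then have N\<nu>[measurable]: "N \<in> sets \<nu>" by auto
  have sN: "s \<le> measure \<mu> N"
  proof (rule field_le_epsilon)
    fix e :: real assume "0 < e"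
    then obtain i where "1 / real (Suc i) < e" using nat_approx_posE by blast
    moreover have "measure \<mu> (K i) \<le> measure \<mu> N"
      using N\<nu> S K(1)[of i] by (intro \<mu>.finite_measure_mono) (auto simp: N_def)
    ultimately show "s \<le> measure \<mu> N + e" using K(2)[of i] by linarith
  qed
  define \<mu>' where "\<mu>' = density \<mu> (indicator (space \<nu> - N))"
  have "absolutely_continuous \<nu> \<mu>'"
    unfolding absolutely_continuous_def
  proof
    fix D assume D: "D \<in> null_sets \<nu>"
    then have [measurable]: "D \<in> sets \<nu>" by auto
    have "N \<union> D \<in> null_sets \<nu>" using N D by auto
    then have "measure \<mu> (N \<union> D) \<le> s" unfolding s_def by (intro cSUP_upper bdd)
    moreover have "measure \<mu> (N \<union> D) = measure \<mu> N + measure \<mu> (D - N)"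
    proof -
      have "N \<union> D = N \<union> (D - N)" by auto
      moreover have "measure \<mu> (N \<union> (D - N)) = measure \<mu> N + measure \<mu> (D - N)"
        by (rule \<mu>.finite_measure_Union) (auto simp: S)
      ultimately show ?thesis by (simp only:)
    qed
    ultimately have "measure \<mu> (D - N) = 0" using sN measure_nonneg[of \<mu> "D - N"] by linarith
    moreover have "emeasure \<mu>' D = emeasure \<mu> (D - N)"
    proof -
      have "emeasure \<mu>' D = (\<integral>\<^sup>+x. indicator (space \<nu> - N) x * indicator D x \<partial>\<mu>)"
        unfolding \<mu>'_def by (rule emeasure_density) (auto simp: S)
      also have "\<dots> = (\<integral>\<^sup>+x. indicator (D - N) x \<partial>\<mu>)"
        using sets.sets_into_space[OF \<open>D \<in> sets \<nu>\<close>]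
        by (intro nn_integral_cong) (auto split: split_indicator)
      finally have "emeasure \<mu>' D = (\<integral>\<^sup>+x. indicator (D - N) x \<partial>\<mu>)" .
      then show ?thesis by (simp add: S)
    qed
    ultimately show "D \<in> null_sets \<mu>'" by (auto simp: null_sets_def \<mu>.emeasure_eq_measure \<mu>'_def S)
  qed
  moreover have "sets \<mu>' = sets \<nu>" by (simp add: \<mu>'_def S)
  ultimately obtain p where p: "p \<in> borel_measurable \<nu>" "density \<nu> p = \<mu>'"
    using \<nu>.Radon_Nikodym[of \<mu>'] by blast
  have "(\<integral>\<^sup>+x. f x * indicator (space \<nu> - N) x \<partial>\<mu>) = (\<integral>\<^sup>+x. f x * p x \<partial>\<nu>)"
    if [measurable]: "f \<in> borel_measurable \<nu>" for f
  proof -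
    have "(\<integral>\<^sup>+x. f x * indicator (space \<nu> - N) x \<partial>\<mu>) = (\<integral>\<^sup>+x. f x \<partial>\<mu>')"
      unfolding \<mu>'_def by (subst nn_integral_density) (auto simp: mult.commute)
    also have "\<dots> = (\<integral>\<^sup>+x. f x * p x \<partial>\<nu>)"
      using p(1) unfolding p(2)[symmetric] by (subst nn_integral_density) (auto simp: mult.commute)
    finally show ?thesis .
  qed
  then show ?thesis using N p(1) that by blast
qed

text \<open>The sum is the total variation norm of the difference: the singular mass and the
  positive and negative parts of \<open>p - 1\<close>, subtraction in \<open>ennreal\<close> being
  truncated at 0. Writing it with just two events reduces its convergence to that of differences of
  measures of sets.\<close>

lemma lebesgue_decomposition_tv:
  fixes \<mu> \<nu> :: "'a measure"
  assumes \<mu>: "finite_measure \<mu>" and \<nu>: "finite_measure \<nu>" and S[measurable_cong]: "sets \<mu> = sets \<nu>"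
  obtains N p D1 D2 where "N \<in> null_sets \<nu>" "p \<in> borel_measurable \<nu>"
    "\<And>f. f \<in> borel_measurable \<nu> \<Longrightarrow> (\<integral>\<^sup>+x. f x * indicator (space \<nu> - N) x \<partial>\<mu>) = (\<integral>\<^sup>+x. f x * p x \<partial>\<nu>)"
    "D1 \<in> sets \<nu>" "D2 \<in> sets \<nu>"
    "emeasure \<mu> N + (\<integral>\<^sup>+x. p x - 1 \<partial>\<nu>) + (\<integral>\<^sup>+x. 1 - p x \<partial>\<nu>) =
      ennreal ((measure \<mu> D1 - measure \<nu> D1) - (measure \<mu> D2 - measure \<nu> D2))"
proof -
  interpret \<mu>: finite_measure \<mu> by fact
  interpret \<nu>: finite_measure \<nu> by fact
  obtain N p where N: "N \<in> null_sets \<nu>" and p[measurable]: "p \<in> borel_measurable \<nu>"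
    and eq: "\<And>f. f \<in> borel_measurable \<nu> \<Longrightarrow> (\<integral>\<^sup>+x. f x * indicator (space \<nu> - N) x \<partial>\<mu>) = (\<integral>\<^sup>+x. f x * p x \<partial>\<nu>)"
    using lebesgue_decomposition[OF assms] by blast
  have N\<nu>[measurable]: "N \<in> sets \<nu>" and N0: "emeasure \<nu> N = 0" using N by auto
  define G where "G = {x\<in>space \<nu>. 1 < p x}"
  have G[measurable]: "G \<in> sets \<nu>" unfolding G_def by measurable
  have sp: "space \<mu> = space \<nu>" using S by (rule sets_eq_imp_space_eq)
  have int: "(\<integral>\<^sup>+x. indicator D x * p x \<partial>\<nu>) = emeasure \<mu> (D - N)" if [measurable]: "D \<in> sets \<nu>" for D
  proof -
    have "(\<integral>\<^sup>+x. indicator D x * p x \<partial>\<nu>) = (\<integral>\<^sup>+x. indicator D x * indicator (space \<nu> - N) x \<partial>\<mu>)"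
      by (rule eq[symmetric]) measurable
    also have "\<dots> = (\<integral>\<^sup>+x. indicator (D - N) x \<partial>\<mu>)"
      using sets.sets_into_space[OF that] by (intro nn_integral_cong) (auto split: split_indicator)
    finally show ?thesis by (simp add: S)
  qed
  have le1: "q - 1 = (0 :: ennreal)" if "q \<le> 1" for q
    by (rule diff_eq_0_ennreal[OF le_less_trans[OF that] that]) simp
  have le2: "1 - q = (0 :: ennreal)" if "1 < q" for q
    by (rule diff_eq_0_ennreal) (use that in auto)
  have 1: "(\<integral>\<^sup>+x. p x - 1 \<partial>\<nu>) + emeasure \<nu> G = emeasure \<mu> (G - N)"
  proof -
    have "(\<integral>\<^sup>+x. p x - 1 \<partial>\<nu>) + emeasure \<nu> G = (\<integral>\<^sup>+x. (p x - 1) + indicator G x \<partial>\<nu>)"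
      by (subst nn_integral_add) auto
    also have "\<dots> = (\<integral>\<^sup>+x. indicator G x * p x \<partial>\<nu>)"
      by (intro nn_integral_cong)
        (auto simp: G_def not_less diff_add_cancel_ennreal less_imp_le le1 le2 split: split_indicator)
    finally show ?thesis using int by simp
  qed
  have 2: "(\<integral>\<^sup>+x. 1 - p x \<partial>\<nu>) + emeasure \<mu> ((space \<nu> - G) - N) = emeasure \<nu> (space \<nu> - G)"
  proof -
    have "(\<integral>\<^sup>+x. 1 - p x \<partial>\<nu>) + emeasure \<mu> ((space \<nu> - G) - N) = (\<integral>\<^sup>+x. 1 - p x \<partial>\<nu>) + (\<integral>\<^sup>+x. indicator (space \<nu> - G) x * p x \<partial>\<nu>)"
      using int by simp
    also have "\<dots> = (\<integral>\<^sup>+x. (1 - p x) + indicator (space \<nu> - G) x * p x \<partial>\<nu>)"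
      by (subst nn_integral_add) auto
    also have "\<dots> = (\<integral>\<^sup>+x. indicator (space \<nu> - G) x \<partial>\<nu>)"
      by (intro nn_integral_cong)
        (auto simp: G_def not_less diff_add_cancel_ennreal less_imp_le le1 le2 split: split_indicator)
    finally show ?thesis by simp
  qed
  \<comment> \<open>Up to null sets these form a Hahn decomposition of the difference; the singular
    set \<open>N\<close> goes to \<open>D1\<close>, where \<open>\<mu>\<close> dominates.\<close>
  define D1 D2 where "D1 = N \<union> G" and "D2 = (space \<nu> - G) - N"
  have D[measurable]: "D1 \<in> sets \<nu>" "D2 \<in> sets \<nu>" by (auto simp: D1_def D2_def)
  have m1: "measure \<mu> D1 = measure \<mu> N + measure \<mu> (G - N)"
  proof -
    have "D1 = N \<union> (G - N)" by (auto simp: D1_def)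
    moreover have "measure \<mu> (N \<union> (G - N)) = measure \<mu> N + measure \<mu> (G - N)"
      by (rule \<mu>.finite_measure_Union) (auto simp: S)
    ultimately show ?thesis by (simp only:)
  qed
  have n1: "measure \<nu> D1 = measure \<nu> G"
    unfolding D1_def using measure_Un_null_set[of G \<nu> N] N by (simp add: Un_commute)
  have n2: "measure \<nu> D2 = measure \<nu> (space \<nu> - G)"
    unfolding D2_def using N by (simp add: measure_Diff_null_set)
  have O1: "(\<integral>\<^sup>+x. p x - 1 \<partial>\<nu>) = ennreal (measure \<mu> (G - N) - measure \<nu> G)"
  proof -
    have "(\<integral>\<^sup>+x. p x - 1 \<partial>\<nu>) = emeasure \<mu> (G - N) - emeasure \<nu> G"
      unfolding 1[symmetric] by (simp add: \<nu>.emeasure_finite)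
    then show ?thesis by (simp add: \<mu>.emeasure_eq_measure \<nu>.emeasure_eq_measure ennreal_minus)
  qed
  have O1': "measure \<nu> G \<le> measure \<mu> (G - N)"
  proof -
    have "emeasure \<nu> G \<le> emeasure \<mu> (G - N)" unfolding 1[symmetric] by simp
    then show ?thesis by (simp add: \<mu>.emeasure_eq_measure \<nu>.emeasure_eq_measure)
  qed
  have O2: "(\<integral>\<^sup>+x. 1 - p x \<partial>\<nu>) = ennreal (measure \<nu> (space \<nu> - G) - measure \<mu> D2)"
  proof -
    have "(\<integral>\<^sup>+x. 1 - p x \<partial>\<nu>) = emeasure \<nu> (space \<nu> - G) - emeasure \<mu> D2"
      unfolding 2[symmetric] D2_def by (simp add: \<mu>.emeasure_finite)
    then show ?thesis by (simp add: \<mu>.emeasure_eq_measure \<nu>.emeasure_eq_measure ennreal_minus)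
  qed
  have O2': "measure \<mu> D2 \<le> measure \<nu> (space \<nu> - G)"
  proof -
    have "emeasure \<mu> D2 \<le> emeasure \<nu> (space \<nu> - G)" unfolding 2[symmetric] D2_def by simp
    then show ?thesis by (simp add: \<mu>.emeasure_eq_measure \<nu>.emeasure_eq_measure)
  qed
  have "emeasure \<mu> N + (\<integral>\<^sup>+x. p x - 1 \<partial>\<nu>) + (\<integral>\<^sup>+x. 1 - p x \<partial>\<nu>) =
      ennreal ((measure \<mu> D1 - measure \<nu> D1) - (measure \<mu> D2 - measure \<nu> D2))"
    unfolding O1 O2 m1 n1 n2 \<mu>.emeasure_eq_measure using O1' O2'
    by (simp add: ennreal_plus[symmetric] del: ennreal_plus) (simp add: algebra_simps)
  then show ?thesis using that N p eq D by blast
qed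

lemma pair_measure_eqI_rect:
  assumes "sets m1 = sets (F \<Otimes>\<^sub>M H)" "sets m2 = sets (F \<Otimes>\<^sub>M H)" "space F = UNIV" "space H = UNIV"
    and fin: "emeasure m1 UNIV \<noteq> \<infinity>"
    and eq: "\<And>A B. A \<in> sets F \<Longrightarrow> B \<in> sets H \<Longrightarrow> emeasure m1 (A \<times> B) = emeasure m2 (A \<times> B)"
  shows "m1 = m2"
proof (rule measure_eqI_generator_eq[where \<Omega>=UNIV and E="{a \<times> b |a b. a \<in> sets F \<and> b \<in> sets H}" and A="\<lambda>_. UNIV"])
  show "Int_stable {a \<times> b |a b. a \<in> sets F \<and> b \<in> sets H}"
    by (rule Int_stable_pair_measure_generator)
  show "sets m1 = sigma_sets UNIV {a \<times> b |a b. a \<in> sets F \<and> b \<in> sets H}"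
    "sets m2 = sigma_sets UNIV {a \<times> b |a b. a \<in> sets F \<and> b \<in> sets H}"
    using assms sets_pair_measure[of F H] by simp_all
  have "UNIV \<in> sets F" "UNIV \<in> sets H" using assms(3,4) sets.top[of F] sets.top[of H] by simp_all
  then show "range (\<lambda>_. UNIV) \<subseteq> {a \<times> b |a b. a \<in> sets F \<and> b \<in> sets H}"
    by (force simp: UNIV_Times_UNIV[symmetric] simp del: UNIV_Times_UNIV)
qed (use eq fin in auto)

lemma tv_dist_upper:
  assumes "prob_space \<mu>" "prob_space \<nu>" "sets \<mu> = sets borel" "sets \<nu> = sets borel" "A \<in> sets borel"
  shows "\<bar>measure \<mu> A - measure \<nu> A\<bar> \<le> tv_dist \<mu> \<nu>"
proof -
  interpret \<mu>: prob_space \<mu> by fact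
  interpret \<nu>: prob_space \<nu> by fact
  let ?F = "{f \<in> borel_measurable borel. \<forall>x. \<bar>f x\<bar> \<le> (1::real)}"
  have b: "\<bar>\<integral>x. f x \<partial>\<rho>\<bar> \<le> 1" if "f \<in> ?F" "prob_space \<rho>" "sets \<rho> = sets borel" for f and \<rho> :: "'a measure"
  proof -
    interpret \<rho>: prob_space \<rho> by fact
    have f: "f \<in> borel_measurable \<rho>" using that measurable_cong_sets[OF that(3) refl, of borel] by auto
    have int: "integrable \<rho> f" using that f by (intro \<rho>.integrable_const_bound[of _ 1]) auto
    have "\<bar>\<integral>x. f x \<partial>\<rho>\<bar> \<le> (\<integral>x. \<bar>f x\<bar> \<partial>\<rho>)" by (rule integral_abs_bound)
    also have "\<dots> \<le> (\<integral>x. 1 \<partial>\<rho>)" using that int by (intro integral_mono) auto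
    finally show ?thesis by (simp add: \<rho>.prob_space)
  qed
  have "bdd_above ((\<lambda>f. \<bar>(\<integral>x. f x \<partial>\<mu>) - (\<integral>x. f x \<partial>\<nu>)\<bar>) ` ?F)"
  proof (rule bdd_aboveI2)
    fix f :: "'a \<Rightarrow> real" assume "f \<in> ?F"
    then show "\<bar>(\<integral>x. f x \<partial>\<mu>) - (\<integral>x. f x \<partial>\<nu>)\<bar> \<le> 2"
      using b[of f \<mu>] b[of f \<nu>] assms by (simp add: \<mu>.prob_space_axioms \<nu>.prob_space_axioms)
  qed
  moreover have "indicator A \<in> ?F" using assms(5) by (auto split: split_indicator)
  ultimately have "\<bar>(\<integral>x. indicator A x \<partial>\<mu>) - (\<integral>x. indicator A x \<partial>\<nu>)\<bar> \<le> tv_dist \<mu> \<nu>"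
    unfolding tv_dist_def by (rule cSUP_upper[rotated])
  then show ?thesis using assms by simp
qed

section \<open>Transition probabilities and the law of two states\<close>

lemma path_prod_last: "path_prod (replicate n (\<lambda>_. 1) @ [f]) a \<omega> = f (X (a + of_nat n) \<omega>)"
proof (induction n arbitrary: a)
  case (Suc n)
  show ?case using Suc[of "a + 1"] by (simp add: add.assoc)
qed simp

locale ergodic_hmm_measure = stationary_hmm_measure P \<Phi> M \<pi>
  for P :: "'e::polish_space \<Rightarrow> 'e measure"
    and \<Phi> :: "'e \<Rightarrow> 'f::polish_space measure"
    and M :: "(int, 'e, 'f) path measure" and \<pi> +
  fixes Pz :: "'e \<Rightarrow> (nat, 'e, 'f) path measure"
  assumes Pz: "\<And>z. hmm_from P \<Phi> z (Pz z)"
    and ergodic: "AE z in \<pi>. (\<lambda>n. tv_dist (distr (Pz z) borel (X n)) \<pi>) \<longlonglongrightarrow> 0"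
begin

definition "\<kappa> n z = distr (Pz z) borel (X n)"

definition "joint k = distr M (borel \<Otimes>\<^sub>M borel) (\<lambda>\<omega>. (X 0 \<omega>, X (int k) \<omega>))"

lemma \<pi>_prob: "prob_space \<pi>"
  using prob_space_distr[OF X_measurable, of 0] by (simp add: X_distr)

lemma sets_\<pi>[simp, measurable_cong]: "sets \<pi> = sets borel"
  unfolding X_distr[of 0, symmetric] by simp

lemma space_\<pi>[simp]: "space \<pi> = UNIV"
  unfolding X_distr[of 0, symmetric] by simp

sublocale \<pi>: prob_space \<pi> by (rule \<pi>_prob)

sublocale \<pi>\<pi>: pair_prob_space \<pi> \<pi> ..

sublocale MM: pair_prob_space M M ..

lemma Pz_hmm: "hmm_measure P \<Phi> (Pz z)"
  using Pz P \<Phi> by (simp add: hmm_measure_def hmm_from_def)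

lemma \<kappa>_prob: "prob_space (\<kappa> n z)" "sets (\<kappa> n z) = sets borel"
proof -
  interpret Z: hmm_measure P \<Phi> "Pz z" by (rule Pz_hmm)
  show "prob_space (\<kappa> n z)" unfolding \<kappa>_def by (rule Z.prob_space_distr) simp
qed (simp add: \<kappa>_def)

lemma space_\<kappa>[simp]: "space (\<kappa> n z) = UNIV"
  using sets_eq_imp_space_eq[OF \<kappa>_prob(2)] by simp

lemma transition_list:
  assumes "A \<in> sets borel"
  shows "f \<in> set (replicate n (\<lambda>_. 1) @ [indicator A]) \<Longrightarrow> f \<in> borel_measurable borel"
  using assms by (auto split: if_splits)

text \<open>The assumptions on \<open>Pz z\<close> are made separately for each \<open>z\<close>.
  The formula by iterated integrals of \<open>P\<close> shows that \<open>\<kappa> n\<close> is a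
  measurable kernel and ties it to the transitions of the stationary process.\<close>

lemma \<kappa>_eq:
  assumes A[measurable]: "A \<in> sets borel"
  shows "emeasure (\<kappa> n z) A = markov_int P (replicate n (\<lambda>_. 1) @ [indicator A]) z"
proof -
  interpret Z: hmm_measure P \<Phi> "Pz z" by (rule Pz_hmm)
  let ?fs = "replicate n (\<lambda>_. 1) @ [indicator A]"
  have [measurable]: "markov_int P ?fs \<in> borel_measurable borel"
    by (rule markov_int_measurable[OF P transition_list[OF A]])
  have "emeasure (\<kappa> n z) A = (\<integral>\<^sup>+\<omega>. indicator A (X n \<omega>) \<partial>Pz z)"
    unfolding \<kappa>_def by (simp add: nn_integral_distr nn_integral_indicator[symmetric] del: nn_integral_indicator)
  also have "\<dots> = (\<integral>\<^sup>+\<omega>. 1 * path_prod ?fs 0 \<omega> \<partial>Pz z)"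
    by (simp add: path_prod_last)
  also have "\<dots> = (\<integral>\<^sup>+\<omega>. 1 * markov_int P ?fs (X 0 \<omega>) \<partial>Pz z)"
    by (rule Z.markov_prod[OF transition_list[OF A]]) auto
  also have "\<dots> = (\<integral>\<^sup>+x. markov_int P ?fs x \<partial>distr (Pz z) borel (X 0))"
    by (simp add: nn_integral_distr)
  also have "\<dots> = markov_int P ?fs z"
    using Pz[of z] by (simp add: hmm_from_def nn_integral_return)
  finally show ?thesis .
qed

lemma \<kappa>_measurable: "\<kappa> n \<in> borel \<rightarrow>\<^sub>M subprob_algebra borel"
proof (rule measurable_subprob_algebra)
  show "subprob_space (\<kappa> n a)" for a using \<kappa>_prob(1) by (rule prob_space_imp_subprob_space)
  fix A :: "'e set" assume "A \<in> sets borel"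
  then show "(\<lambda>a. emeasure (\<kappa> n a) A) \<in> borel_measurable borel"
    using markov_int_measurable[OF P transition_list[OF \<open>A \<in> sets borel\<close>]] by (simp add: \<kappa>_eq)
qed (use \<kappa>_prob in simp)

lemma transition_rect:
  assumes A[measurable]: "A \<in> sets borel" and C[measurable]: "C \<in> sets borel"
  shows "emeasure M {\<omega>. X a \<omega> \<in> C \<and> X (a + int k) \<omega> \<in> A} = (\<integral>\<^sup>+z. indicator C z * emeasure (\<kappa> k z) A \<partial>\<pi>)"
proof -
  let ?fs = "replicate k (\<lambda>_. 1) @ [indicator A]"
  have [measurable]: "markov_int P ?fs \<in> borel_measurable borel"
    by (rule markov_int_measurable[OF P transition_list[OF A]])
  have "{\<omega>. X a \<omega> \<in> C \<and> X (a + int k) \<omega> \<in> A} = {\<omega>\<in>space M. X a \<omega> \<in> C \<and> X (a + int k) \<omega> \<in> A}" by simp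
  also have "\<dots> \<in> sets M" by measurable
  finally have S: "{\<omega>. X a \<omega> \<in> C \<and> X (a + int k) \<omega> \<in> A} \<in> sets M" .
  have "emeasure M {\<omega>. X a \<omega> \<in> C \<and> X (a + int k) \<omega> \<in> A} = (\<integral>\<^sup>+\<omega>. indicator {\<omega>. X a \<omega> \<in> C \<and> X (a + int k) \<omega> \<in> A} \<omega> \<partial>M)"
    using S by simp
  also have "\<dots> = (\<integral>\<^sup>+\<omega>. indicator C (X a \<omega>) * path_prod ?fs a \<omega> \<partial>M)"
    by (intro nn_integral_cong) (simp add: path_prod_last indicator_def)
  also have "\<dots> = (\<integral>\<^sup>+\<omega>. indicator C (X a \<omega>) * markov_int P ?fs (X a \<omega>) \<partial>M)"
    using transition_list[OF A] by (intro markov_prod measurable_compose[OF X_XY borel_measurable_indicator]) auto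
  also have "\<dots> = (\<integral>\<^sup>+z. indicator C z * markov_int P ?fs z \<partial>distr M borel (X a))"
    by (simp add: nn_integral_distr)
  finally show ?thesis by (simp add: X_distr \<kappa>_eq)
qed

lemma joint_law:
  assumes D[measurable]: "D \<in> sets (borel \<Otimes>\<^sub>M borel)"
  shows "emeasure M {\<omega>. (X a \<omega>, X (a + int k) \<omega>) \<in> D} = (\<integral>\<^sup>+z. emeasure (\<kappa> k z) {x. (z, x) \<in> D} \<partial>\<pi>)"
proof -
  let ?BB = "borel \<Otimes>\<^sub>M borel :: ('e \<times> 'e) measure"
  let ?L = "distr M ?BB (\<lambda>\<omega>. (X a \<omega>, X (a + int k) \<omega>))"
  let ?R = "\<pi> \<bind> (\<lambda>z. distr (\<kappa> k z) ?BB (Pair z))"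
  have K: "(\<lambda>z. distr (\<kappa> k z) ?BB (Pair z)) \<in> borel \<rightarrow>\<^sub>M subprob_algebra ?BB"
    by (rule measurable_distr2[OF _ \<kappa>_measurable]) simp
  have K': "(\<lambda>z. distr (\<kappa> k z) ?BB (Pair z)) \<in> \<pi> \<rightarrow>\<^sub>M subprob_algebra ?BB"
    using K by (simp cong: measurable_cong_sets)
  have Pm: "Pair z \<in> \<kappa> k z' \<rightarrow>\<^sub>M ?BB" for z z'
    by (subst measurable_cong_sets[OF \<kappa>_prob(2) refl]) simp
  have R: "emeasure ?R B = (\<integral>\<^sup>+z. emeasure (\<kappa> k z) {x. (z, x) \<in> B} \<partial>\<pi>)" if B: "B \<in> sets ?BB" for B
  proof -
    have "emeasure ?R B = (\<integral>\<^sup>+z. emeasure (distr (\<kappa> k z) ?BB (Pair z)) B \<partial>\<pi>)"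
      by (rule emeasure_bind[OF _ K' B]) simp
    also have "\<dots> = (\<integral>\<^sup>+z. emeasure (\<kappa> k z) {x. (z, x) \<in> B} \<partial>\<pi>)"
      using emeasure_distr[OF Pm B] by (simp add: vimage_def)
    finally show ?thesis .
  qed
  have sR: "sets ?R = sets ?BB" by (rule sets_bind) (auto)
  have "?L = ?R"
  proof (rule pair_measure_eqI_rect[where F=borel and H=borel])
    interpret L: prob_space ?L by (rule prob_space_distr) measurable
    show "emeasure ?L UNIV \<noteq> \<infinity>" using L.emeasure_finite by simp
    fix C A :: "'e set" assume [measurable]: "C \<in> sets borel" "A \<in> sets borel"
    have "emeasure ?L (C \<times> A) = emeasure M {\<omega>. X a \<omega> \<in> C \<and> X (a + int k) \<omega> \<in> A}"
      by (subst emeasure_distr) (auto simp: vimage_def)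
    also have "\<dots> = (\<integral>\<^sup>+z. indicator C z * emeasure (\<kappa> k z) A \<partial>\<pi>)" by (rule transition_rect) measurable
    also have "\<dots> = emeasure ?R (C \<times> A)"
      by (subst R) (auto intro!: nn_integral_cong split: split_indicator)
    finally show "emeasure ?L (C \<times> A) = emeasure ?R (C \<times> A)" .
  qed (auto simp: sR)
  then have "emeasure ?L D = (\<integral>\<^sup>+z. emeasure (\<kappa> k z) {x. (z, x) \<in> D} \<partial>\<pi>)" using R[OF D] by simp
  then show ?thesis by (subst (asm) emeasure_distr) (auto simp: vimage_def)
qed

lemma joint_emeasure:
  assumes D[measurable]: "D \<in> sets (borel \<Otimes>\<^sub>M borel)"
  shows "emeasure M {\<omega>. (X a \<omega>, X (a + int k) \<omega>) \<in> D} = emeasure (joint k) D"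
  unfolding joint_def using joint_law[OF D, of a k] joint_law[OF D, of 0 k]
  by (subst emeasure_distr) (auto simp: vimage_def)

lemma joint_eq: "distr M (borel \<Otimes>\<^sub>M borel) (\<lambda>\<omega>. (X a \<omega>, X (a + int k) \<omega>)) = joint k"
proof (rule measure_eqI)
  show "sets (distr M (borel \<Otimes>\<^sub>M borel) (\<lambda>\<omega>. (X a \<omega>, X (a + int k) \<omega>))) = sets (joint k)" by (simp add: joint_def)
  fix D assume "D \<in> sets (distr M (borel \<Otimes>\<^sub>M borel) (\<lambda>\<omega>. (X a \<omega>, X (a + int k) \<omega>)))"
  then have [measurable]: "D \<in> sets (borel \<Otimes>\<^sub>M borel)" by simp
  show "emeasure (distr M (borel \<Otimes>\<^sub>M borel) (\<lambda>\<omega>. (X a \<omega>, X (a + int k) \<omega>))) D = emeasure (joint k) D"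
    by (subst joint_emeasure[symmetric, where a=a], simp, subst emeasure_distr) (auto simp: vimage_def)
qed

lemma joint_prob: "prob_space (joint k)"
  unfolding joint_def by (rule prob_space_distr) measurable

text \<open>The sets \<open>D k\<close> may change with \<open>k\<close>, so this is convergence in
  total variation. For fixed \<open>z\<close> the sections differ in measure by at most the distance
  in the ergodicity assumption, whatever the set; dominated convergence then integrates over
  \<open>z\<close>.\<close>

lemma joint_asymptotically_product:
  assumes D: "\<And>k. D k \<in> sets (borel \<Otimes>\<^sub>M borel)"
  shows "(\<lambda>k. measure (joint k) (D k) - measure (\<pi> \<Otimes>\<^sub>M \<pi>) (D k)) \<longlonglongrightarrow> 0"
proof -
  note [measurable] = D
  have sec[measurable]: "{x. (z, x) \<in> D k} \<in> sets borel" for z k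
    using sets_Pair1[OF D[of k], of z] by (simp add: vimage_def)
  have \<kappa>m: "(\<lambda>z. emeasure (\<kappa> k z) {x. (z, x) \<in> D k}) \<in> borel_measurable borel" for k
  proof -
    have "(\<lambda>z. emeasure (distr (\<kappa> k z) (borel \<Otimes>\<^sub>M borel) (Pair z)) (D k)) \<in> borel_measurable borel"
      by (rule measurable_compose[OF measurable_distr2[OF _ \<kappa>_measurable] measurable_emeasure_subprob_algebra]) auto
    moreover have "emeasure (distr (\<kappa> k z) (borel \<Otimes>\<^sub>M borel) (Pair z)) (D k) = emeasure (\<kappa> k z) {x. (z, x) \<in> D k}" for z
    proof -
      have "Pair z \<in> \<kappa> k z \<rightarrow>\<^sub>M borel \<Otimes>\<^sub>M borel"
        by (subst measurable_cong_sets[OF \<kappa>_prob(2) refl]) simp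
      from emeasure_distr[OF this D] show ?thesis by (simp add: vimage_def)
    qed
    ultimately show ?thesis by simp
  qed
  then have [measurable]: "(\<lambda>z. measure (\<kappa> k z) {x. (z, x) \<in> D k}) \<in> borel_measurable borel" for k
    unfolding measure_def by (intro borel_measurable_enn2real)
  have \<pi>m[measurable]: "(\<lambda>z. measure \<pi> {x. (z, x) \<in> D k}) \<in> borel_measurable borel" for k
  proof -
    have "(\<lambda>z. emeasure \<pi> (Pair z -` D k)) \<in> borel_measurable borel"
      by (rule \<pi>.measurable_emeasure_Pair) (simp cong: sets_pair_measure_cong)
    then show ?thesis unfolding measure_def vimage_def by (intro borel_measurable_enn2real)
  qed
  have ej: "measure (joint k) (D k) = (\<integral>z. measure (\<kappa> k z) {x. (z, x) \<in> D k} \<partial>\<pi>)" for k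
  proof -
    interpret j: prob_space "joint k" by (rule joint_prob)
    have "emeasure (joint k) (D k) = (\<integral>\<^sup>+z. ennreal (measure (\<kappa> k z) {x. (z, x) \<in> D k}) \<partial>\<pi>)"
      using joint_law[OF D, of 0 k k] joint_emeasure[OF D, of 0 k k] \<kappa>_prob(1)
      by (simp add: finite_measure.emeasure_eq_measure prob_space_def)
    then show ?thesis
      unfolding measure_def[of "joint k"] by (subst integral_eq_nn_integral) auto
  qed
  have ep: "measure (\<pi> \<Otimes>\<^sub>M \<pi>) (D k) = (\<integral>z. measure \<pi> {x. (z, x) \<in> D k} \<partial>\<pi>)" for k
  proof -
    have "emeasure (\<pi> \<Otimes>\<^sub>M \<pi>) (D k) = (\<integral>\<^sup>+z. ennreal (measure \<pi> {x. (z, x) \<in> D k}) \<partial>\<pi>)"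
      by (subst \<pi>.emeasure_pair_measure_alt) (auto simp: \<pi>.emeasure_eq_measure vimage_def cong: sets_pair_measure_cong)
    then show ?thesis
      unfolding measure_def[of "\<pi> \<Otimes>\<^sub>M \<pi>"] by (subst integral_eq_nn_integral) auto
  qed
  have le1: "measure (\<kappa> k z) A \<le> 1" for k z A
    using \<kappa>_prob(1) by (rule prob_space.prob_le_1)
  have i1: "integrable \<pi> (\<lambda>z. measure (\<kappa> k z) {x. (z, x) \<in> D k})" for k
    using le1 by (intro \<pi>.integrable_const_bound[of _ 1]) auto
  have i2: "integrable \<pi> (\<lambda>z. measure \<pi> {x. (z, x) \<in> D k})" for k
    by (intro \<pi>.integrable_const_bound[of _ 1]) auto
  have "(\<lambda>k. \<integral>z. measure (\<kappa> k z) {x. (z, x) \<in> D k} - measure \<pi> {x. (z, x) \<in> D k} \<partial>\<pi>) \<longlonglongrightarrow> (\<integral>z. 0 \<partial>\<pi>)"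
  proof (rule integral_dominated_convergence[where w="\<lambda>_. 1"])
    show "AE z in \<pi>. (\<lambda>k. measure (\<kappa> k z) {x. (z, x) \<in> D k} - measure \<pi> {x. (z, x) \<in> D k}) \<longlonglongrightarrow> 0"
      using ergodic
    proof eventually_elim
      case (elim z)
      show ?case
      proof (rule Lim_null_comparison[OF _ elim])
        show "\<forall>\<^sub>F k in sequentially. norm (measure (\<kappa> k z) {x. (z, x) \<in> D k} - measure \<pi> {x. (z, x) \<in> D k}) \<le> tv_dist (distr (Pz z) borel (X k)) \<pi>"
          using tv_dist_upper[OF \<kappa>_prob(1) \<pi>_prob \<kappa>_prob(2) sets_\<pi> sec] unfolding \<kappa>_def by auto
      qed
    qed
    show "AE z in \<pi>. norm (measure (\<kappa> k z) {x. (z, x) \<in> D k} - measure \<pi> {x. (z, x) \<in> D k}) \<le> 1" for k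
    proof (intro AE_I2)
      fix z
      have "\<bar>a - b\<bar> \<le> 1" if "0 \<le> a" "a \<le> 1" "0 \<le> b" "b \<le> 1" for a b :: real
        using that by linarith
      then show "norm (measure (\<kappa> k z) {x. (z, x) \<in> D k} - measure \<pi> {x. (z, x) \<in> D k}) \<le> 1"
        using le1 \<pi>.prob_le_1 by simp
    qed
  qed auto
  then show ?thesis unfolding ej ep by (subst (asm) Bochner_Integration.integral_diff[OF i1 i2]) auto
qed

end

lemma ennreal_le_add_diff: "a \<le> b + (a - b :: ennreal)"
  by (cases "b \<le> a") (auto simp: add_diff_inverse_ennreal not_le intro: order_trans[OF less_imp_le])

section \<open>Decoupling of past and future in total variation\<close>

context ergodic_hmm_measure
begin

lemma measurable_id_XY: "(\<lambda>\<omega>. \<omega>) \<in> M \<rightarrow>\<^sub>M XY T U"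
  by (rule measurable_from_subalg[OF subalg[of T U]]) simp

text \<open>The Lebesgue decomposition of the law of two states carries over to the whole past and future.\<close>

lemma decoupled:
  assumes N: "N \<in> sets (\<pi> \<Otimes>\<^sub>M \<pi>)" and p: "p \<in> borel_measurable (\<pi> \<Otimes>\<^sub>M \<pi>)"
    and eq: "\<And>f. f \<in> borel_measurable (\<pi> \<Otimes>\<^sub>M \<pi>) \<Longrightarrow>
      (\<integral>\<^sup>+z. f z * indicator (space (\<pi> \<Otimes>\<^sub>M \<pi>) - N) z \<partial>joint k) = (\<integral>\<^sup>+z. f z * p z \<partial>(\<pi> \<Otimes>\<^sub>M \<pi>))"
    and C: "C \<in> sets (XY {..a} {..<a} \<Otimes>\<^sub>M XY {a + int k..} {a + int k..})"
  shows "(\<integral>\<^sup>+\<omega>. indicator C (\<omega>, \<omega>) * indicator (- N) (X a \<omega>, X (a + int k) \<omega>) \<partial>M) =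
    (\<integral>\<^sup>+z. indicator C z * p (X a (fst z), X (a + int k) (snd z)) \<partial>(M \<Otimes>\<^sub>M M))"
proof -
  let ?b = "a + int k"
  let ?F = "XY {..a} {..<a} :: (int, 'e, 'f) path measure"
  let ?H = "XY {?b..} {?b..} :: (int, 'e, 'f) path measure"
  have s\<pi>\<pi>: "sets (\<pi> \<Otimes>\<^sub>M \<pi>) = sets (borel \<Otimes>\<^sub>M borel)" by (rule sets_pair_measure_cong) auto
  have sp: "space (\<pi> \<Otimes>\<^sub>M \<pi>) - N = - N" by (auto simp: space_pair_measure)
  have N'[measurable]: "N \<in> sets (borel \<Otimes>\<^sub>M borel)" using N s\<pi>\<pi> by simp
  have p'[measurable]: "p \<in> borel_measurable (borel \<Otimes>\<^sub>M borel)"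
    using p measurable_cong_sets[OF s\<pi>\<pi> refl, of borel] by simp
  have N''[measurable]: "- N \<in> sets (borel \<Otimes>\<^sub>M borel)"
    using sets.compl_sets[OF N'] by (simp add: space_pair_measure Compl_eq_Diff_UNIV)
  have d[measurable]: "(\<lambda>\<omega>. (\<omega>, \<omega>)) \<in> M \<rightarrow>\<^sub>M ?F \<Otimes>\<^sub>M ?H"
    by (intro measurable_Pair measurable_id_XY)
  have i[measurable]: "(\<lambda>z. z) \<in> M \<Otimes>\<^sub>M M \<rightarrow>\<^sub>M ?F \<Otimes>\<^sub>M ?H"
  proof -
    have "(\<lambda>z. (fst z, snd z)) \<in> M \<Otimes>\<^sub>M M \<rightarrow>\<^sub>M ?F \<Otimes>\<^sub>M ?H"
      by (intro measurable_Pair measurable_compose[OF measurable_fst measurable_id_XY] measurable_compose[OF measurable_snd measurable_id_XY])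
    then show ?thesis by simp
  qed
  define w where "w \<omega> = (indicator (- N) (X a \<omega>, X ?b \<omega>) :: ennreal)" for \<omega> :: "(int, 'e, 'f) path"
  define r where "r z = p (X a (fst z), X ?b (snd z))" for z :: "(int, 'e, 'f) path \<times> (int, 'e, 'f) path"
  have w[measurable]: "w \<in> borel_measurable M" unfolding w_def by measurable
  have r[measurable]: "r \<in> borel_measurable (M \<Otimes>\<^sub>M M)" unfolding r_def by measurable
  \<comment> \<open>\<open>?m1\<close> is the joint law of past and future, restricted to end states
    outside \<open>N\<close>; \<open>?m2\<close> is the law of an independent pair, reweighted by
    \<open>p\<close> at the two end states. On a rectangle the past event becomes a function of
    \<open>X a\<close> and the future event one of \<open>X (a + int k)\<close>, so that only the
    law of two states remains to be compared.\<close>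
  let ?m1 = "distr (density M w) (?F \<Otimes>\<^sub>M ?H) (\<lambda>\<omega>. (\<omega>, \<omega>))"
  let ?m2 = "distr (density (M \<Otimes>\<^sub>M M) r) (?F \<Otimes>\<^sub>M ?H) (\<lambda>z. z)"
  have e1: "emeasure ?m1 D = (\<integral>\<^sup>+\<omega>. indicator D (\<omega>, \<omega>) * w \<omega> \<partial>M)" if [measurable]: "D \<in> sets (?F \<Otimes>\<^sub>M ?H)" for D
  proof -
    have "emeasure ?m1 D = (\<integral>\<^sup>+z. indicator D z \<partial>?m1)" by simp
    also have "\<dots> = (\<integral>\<^sup>+\<omega>. indicator D (\<omega>, \<omega>) \<partial>density M w)" by (rule nn_integral_distr) (use d in auto)
    also have "\<dots> = (\<integral>\<^sup>+\<omega>. w \<omega> * indicator D (\<omega>, \<omega>) \<partial>M)"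
      by (rule nn_integral_density) (use measurable_compose[OF d borel_measurable_indicator[OF that]] in auto)
    finally show ?thesis by (simp add: mult.commute)
  qed
  have e2: "emeasure ?m2 D = (\<integral>\<^sup>+z. indicator D z * r z \<partial>(M \<Otimes>\<^sub>M M))" if [measurable]: "D \<in> sets (?F \<Otimes>\<^sub>M ?H)" for D
  proof -
    have "emeasure ?m2 D = (\<integral>\<^sup>+z. indicator D z \<partial>?m2)" by simp
    also have "\<dots> = (\<integral>\<^sup>+z. indicator D z \<partial>density (M \<Otimes>\<^sub>M M) r)" by (rule nn_integral_distr) (use i in auto)
    also have "\<dots> = (\<integral>\<^sup>+z. r z * indicator D z \<partial>(M \<Otimes>\<^sub>M M))"
      by (rule nn_integral_density) (use measurable_compose[OF i borel_measurable_indicator[OF that]] in auto)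
    finally show ?thesis by (simp add: mult.commute)
  qed
  have "?m1 = ?m2"
  proof (rule pair_measure_eqI_rect[where F="?F" and H="?H"])
    show "emeasure ?m1 UNIV \<noteq> \<infinity>"
    proof -
      have "emeasure ?m1 UNIV = (\<integral>\<^sup>+\<omega>. indicator UNIV (\<omega>, \<omega>) * w \<omega> \<partial>M)"
        using sets.top[of "?F \<Otimes>\<^sub>M ?H"] by (intro e1) (simp add: space_pair_measure)
      also have "\<dots> \<le> (\<integral>\<^sup>+\<omega>. 1 \<partial>M)" by (intro nn_integral_mono) (simp add: w_def split: split_indicator)
      also have "\<dots> < \<infinity>" by (simp add: emeasure_space_1 space_M[symmetric] del: space_M)
      finally show ?thesis by simp
    qed
    fix A B assume A: "A \<in> sets ?F" and B: "B \<in> sets ?H"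
    note [measurable] = sub_M[OF A] sub_M[OF B]
    obtain \<alpha> where \<alpha>[measurable]: "\<alpha> \<in> borel_measurable borel"
      and \<alpha>eq: "\<And>\<xi>. \<xi> \<in> borel_measurable (XY {a..} {a..}) \<Longrightarrow>
        (\<integral>\<^sup>+\<omega>. indicator A \<omega> * \<xi> \<omega> \<partial>M) = (\<integral>\<^sup>+\<omega>. \<alpha> (X a \<omega>) * \<xi> \<omega> \<partial>M)"
      using past_future[OF A] by blast
    obtain \<gamma> where \<gamma>[measurable]: "\<gamma> \<in> borel_measurable borel"
      and \<gamma>eq: "\<And>\<zeta>. \<zeta> \<in> borel_measurable (XY {..?b} {..<?b}) \<Longrightarrow>
        (\<integral>\<^sup>+\<omega>. indicator B \<omega> * \<zeta> \<omega> \<partial>M) = (\<integral>\<^sup>+\<omega>. \<gamma> (X ?b \<omega>) * \<zeta> \<omega> \<partial>M)"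
      using future_past[OF B] by blast
    have B': "B \<in> sets (XY {a..} {a..})" using B XY_mono[of "{?b..}" "{a..}" "{?b..}" "{a..}"] by auto
    have ww: "w \<in> borel_measurable (XY T U)" if "a \<in> T" "?b \<in> T" for T U
      unfolding w_def by (intro measurable_compose[OF measurable_Pair[OF X_XY X_XY] borel_measurable_indicator[OF N'']] that)
    have "emeasure ?m1 (A \<times> B) = (\<integral>\<^sup>+\<omega>. indicator A \<omega> * (indicator B \<omega> * w \<omega>) \<partial>M)"
      using A B by (subst e1) (auto simp: indicator_times mult.assoc)
    also have "\<dots> = (\<integral>\<^sup>+\<omega>. \<alpha> (X a \<omega>) * (indicator B \<omega> * w \<omega>) \<partial>M)"
      using B' ww[of "{a..}" "{a..}"] by (intro \<alpha>eq borel_measurable_times_ennreal borel_measurable_indicator) auto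
    also have "\<dots> = (\<integral>\<^sup>+\<omega>. indicator B \<omega> * (\<alpha> (X a \<omega>) * w \<omega>) \<partial>M)" by (simp add: ac_simps)
    also have "\<dots> = (\<integral>\<^sup>+\<omega>. \<gamma> (X ?b \<omega>) * (\<alpha> (X a \<omega>) * w \<omega>) \<partial>M)"
      using ww[of "{..?b}" "{..<?b}"]
      by (intro \<gamma>eq borel_measurable_times_ennreal measurable_compose[OF X_XY \<alpha>]) auto
    also have "\<dots> = (\<integral>\<^sup>+\<omega>. (\<lambda>z. \<alpha> (fst z) * \<gamma> (snd z) * indicator (- N) z) (X a \<omega>, X ?b \<omega>) \<partial>M)"
      by (simp add: w_def ac_simps)
    also have "\<dots> = (\<integral>\<^sup>+z. \<alpha> (fst z) * \<gamma> (snd z) * indicator (- N) z \<partial>joint k)"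
      unfolding joint_eq[symmetric, of k a] by (subst nn_integral_distr) auto
    also have "\<dots> = (\<integral>\<^sup>+z. \<alpha> (fst z) * \<gamma> (snd z) * p z \<partial>(\<pi> \<Otimes>\<^sub>M \<pi>))"
      by (rule eq[unfolded sp]) (simp cong: measurable_cong_sets add: s\<pi>\<pi>)
    also have "\<dots> = (\<integral>\<^sup>+x. \<integral>\<^sup>+x'. \<alpha> x * (\<gamma> x' * p (x, x')) \<partial>\<pi> \<partial>\<pi>)"
      by (subst \<pi>.nn_integral_fst[symmetric]) (auto simp: mult.assoc s\<pi>\<pi> cong: measurable_cong_sets)
    also have "\<dots> = (\<integral>\<^sup>+x. \<alpha> x * (\<integral>\<^sup>+x'. \<gamma> x' * p (x, x') \<partial>\<pi>) \<partial>\<pi>)"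
      by (intro nn_integral_cong nn_integral_cmult) (simp cong: measurable_cong_sets)
    finally have L: "emeasure ?m1 (A \<times> B) = (\<integral>\<^sup>+x. \<alpha> x * (\<integral>\<^sup>+x'. \<gamma> x' * p (x, x') \<partial>\<pi>) \<partial>\<pi>)" .
    define G where "G x = (\<integral>\<^sup>+x'. \<gamma> x' * p (x, x') \<partial>\<pi>)" for x
    have G[measurable]: "G \<in> borel_measurable borel"
      unfolding G_def by (rule \<pi>.borel_measurable_nn_integral) (simp cong: measurable_cong_sets sets_pair_measure_cong add: case_prod_beta')
    have "emeasure ?m2 (A \<times> B) = (\<integral>\<^sup>+z. indicator (A \<times> B) z * r z \<partial>(M \<Otimes>\<^sub>M M))"
      using A B by (intro e2) auto
    also have "\<dots> = (\<integral>\<^sup>+\<omega>. \<integral>\<^sup>+\<omega>'. indicator (A \<times> B) (\<omega>, \<omega>') * r (\<omega>, \<omega>') \<partial>M \<partial>M)"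
      by (rule nn_integral_fst[symmetric]) measurable
    also have "\<dots> = (\<integral>\<^sup>+\<omega>. indicator A \<omega> * G (X a \<omega>) \<partial>M)"
    proof (rule nn_integral_cong)
      fix \<omega> :: "(int, 'e, 'f) path"
      have pc: "(\<lambda>x. p (X a \<omega>, x)) \<in> borel_measurable borel" by measurable
      have "(\<integral>\<^sup>+\<omega>'. indicator (A \<times> B) (\<omega>, \<omega>') * r (\<omega>, \<omega>') \<partial>M) = (\<integral>\<^sup>+\<omega>'. indicator A \<omega> * (indicator B \<omega>' * p (X a \<omega>, X ?b \<omega>')) \<partial>M)"
        by (simp add: indicator_times r_def mult.assoc)
      also have "\<dots> = indicator A \<omega> * (\<integral>\<^sup>+\<omega>'. indicator B \<omega>' * p (X a \<omega>, X ?b \<omega>') \<partial>M)"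
        by (rule nn_integral_cmult) measurable
      also have "(\<integral>\<^sup>+\<omega>'. indicator B \<omega>' * p (X a \<omega>, X ?b \<omega>') \<partial>M) = (\<integral>\<^sup>+\<omega>'. \<gamma> (X ?b \<omega>') * p (X a \<omega>, X ?b \<omega>') \<partial>M)"
        by (rule \<gamma>eq) (rule measurable_compose[OF X_XY pc], simp)
      also have "\<dots> = (\<integral>\<^sup>+x'. \<gamma> x' * p (X a \<omega>, x') \<partial>distr M borel (X ?b))"
        by (subst nn_integral_distr) auto
      finally show "(\<integral>\<^sup>+\<omega>'. indicator (A \<times> B) (\<omega>, \<omega>') * r (\<omega>, \<omega>') \<partial>M) = indicator A \<omega> * G (X a \<omega>)"
        by (simp add: X_distr G_def)
    qed
    also have "\<dots> = (\<integral>\<^sup>+\<omega>. \<alpha> (X a \<omega>) * G (X a \<omega>) \<partial>M)"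
      by (rule \<alpha>eq) (rule measurable_compose[OF X_XY G], simp)
    also have "\<dots> = (\<integral>\<^sup>+x. \<alpha> x * G x \<partial>distr M borel (X a))"
      by (subst nn_integral_distr) auto
    finally show "emeasure ?m1 (A \<times> B) = emeasure ?m2 (A \<times> B)"
      unfolding L by (simp add: X_distr G_def)
  qed (auto)
  then have "emeasure ?m1 C = emeasure ?m2 C" by simp
  then show ?thesis unfolding e1[OF C] e2[OF C] by (simp add: w_def r_def)
qed

text \<open>The dependence between past and future passes through the two states at the ends of the
  gap. The error is therefore bounded by the total variation between \<open>joint k\<close> and the
  product law, and \<open>D1\<close> and \<open>D2\<close> depend neither on \<open>a\<close> nor on
  \<open>C\<close>.\<close>

lemma mixing_aux:
  obtains D1 D2 where "D1 \<in> sets (borel \<Otimes>\<^sub>M borel)" "D2 \<in> sets (borel \<Otimes>\<^sub>M borel)"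
    "\<And>a C. C \<in> sets (XY {..a} {..<a} \<Otimes>\<^sub>M XY {a + int k..} {a + int k..}) \<Longrightarrow>
      emeasure M {\<omega>. (\<omega>, \<omega>) \<in> C} \<le> emeasure (M \<Otimes>\<^sub>M M) C +
        ennreal ((measure (joint k) D1 - measure (\<pi> \<Otimes>\<^sub>M \<pi>) D1) - (measure (joint k) D2 - measure (\<pi> \<Otimes>\<^sub>M \<pi>) D2)) \<and>
      emeasure (M \<Otimes>\<^sub>M M) C \<le> emeasure M {\<omega>. (\<omega>, \<omega>) \<in> C} +
        ennreal ((measure (joint k) D1 - measure (\<pi> \<Otimes>\<^sub>M \<pi>) D1) - (measure (joint k) D2 - measure (\<pi> \<Otimes>\<^sub>M \<pi>) D2))"
proof -
  have s\<pi>\<pi>: "sets (\<pi> \<Otimes>\<^sub>M \<pi>) = sets (borel \<Otimes>\<^sub>M borel)" by (rule sets_pair_measure_cong) auto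
  have sj: "sets (joint k) = sets (\<pi> \<Otimes>\<^sub>M \<pi>)" by (simp add: s\<pi>\<pi> joint_def)
  interpret j: prob_space "joint k" by (rule joint_prob)
  obtain N p D1 D2 where N: "N \<in> null_sets (\<pi> \<Otimes>\<^sub>M \<pi>)" and p: "p \<in> borel_measurable (\<pi> \<Otimes>\<^sub>M \<pi>)"
    and eq: "\<And>f. f \<in> borel_measurable (\<pi> \<Otimes>\<^sub>M \<pi>) \<Longrightarrow> (\<integral>\<^sup>+x. f x * indicator (space (\<pi> \<Otimes>\<^sub>M \<pi>) - N) x \<partial>joint k) = (\<integral>\<^sup>+x. f x * p x \<partial>(\<pi> \<Otimes>\<^sub>M \<pi>))"
    and D: "D1 \<in> sets (\<pi> \<Otimes>\<^sub>M \<pi>)" "D2 \<in> sets (\<pi> \<Otimes>\<^sub>M \<pi>)"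
    and tv: "emeasure (joint k) N + (\<integral>\<^sup>+x. p x - 1 \<partial>(\<pi> \<Otimes>\<^sub>M \<pi>)) + (\<integral>\<^sup>+x. 1 - p x \<partial>(\<pi> \<Otimes>\<^sub>M \<pi>)) =
      ennreal ((measure (joint k) D1 - measure (\<pi> \<Otimes>\<^sub>M \<pi>) D1) - (measure (joint k) D2 - measure (\<pi> \<Otimes>\<^sub>M \<pi>) D2))"
    using lebesgue_decomposition_tv[OF j.finite_measure_axioms \<pi>\<pi>.finite_measure_axioms sj] by blast
  define \<beta> where "\<beta> = emeasure (joint k) N + (\<integral>\<^sup>+x. p x - 1 \<partial>(\<pi> \<Otimes>\<^sub>M \<pi>)) + (\<integral>\<^sup>+x. 1 - p x \<partial>(\<pi> \<Otimes>\<^sub>M \<pi>))"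
  have N'[measurable]: "N \<in> sets (borel \<Otimes>\<^sub>M borel)" using N s\<pi>\<pi> by auto
  have p'[measurable]: "p \<in> borel_measurable (borel \<Otimes>\<^sub>M borel)"
    using p measurable_cong_sets[OF s\<pi>\<pi> refl, of borel] by simp
  have "emeasure M {\<omega>. (\<omega>, \<omega>) \<in> C} \<le> emeasure (M \<Otimes>\<^sub>M M) C + \<beta> \<and>
      emeasure (M \<Otimes>\<^sub>M M) C \<le> emeasure M {\<omega>. (\<omega>, \<omega>) \<in> C} + \<beta>"
    if C: "C \<in> sets (XY {..a} {..<a} \<Otimes>\<^sub>M XY {a + int k..} {a + int k..})" for a C
  proof -
    let ?b = "a + int k"
    let ?F = "XY {..a} {..<a} :: (int, 'e, 'f) path measure"
    let ?H = "XY {?b..} {?b..} :: (int, 'e, 'f) path measure"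
    have "(\<lambda>\<omega>. (\<omega>, \<omega>)) \<in> M \<rightarrow>\<^sub>M ?F \<Otimes>\<^sub>M ?H"
      by (intro measurable_Pair measurable_id_XY)
    from measurable_sets[OF this C] have CM[measurable]: "{\<omega>. (\<omega>, \<omega>) \<in> C} \<in> sets M" by (simp add: vimage_def)
    have "(\<lambda>z. (fst z, snd z)) \<in> M \<Otimes>\<^sub>M M \<rightarrow>\<^sub>M ?F \<Otimes>\<^sub>M ?H"
      by (intro measurable_Pair measurable_compose[OF measurable_fst measurable_id_XY] measurable_compose[OF measurable_snd measurable_id_XY])
    from measurable_sets[OF this C] have CMM[measurable]: "C \<in> sets (M \<Otimes>\<^sub>M M)"
      by (simp add: vimage_def space_pair_measure)
    define q where "q z = p (X a (fst z), X ?b (snd z))" for z :: "(int, 'e, 'f) path \<times> (int, 'e, 'f) path"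
    have q[measurable]: "q \<in> borel_measurable (M \<Otimes>\<^sub>M M)" unfolding q_def by measurable
    define I where "I = (\<integral>\<^sup>+z. indicator C z * q z \<partial>(M \<Otimes>\<^sub>M M))"
    have I: "(\<integral>\<^sup>+\<omega>. indicator C (\<omega>, \<omega>) * indicator (- N) (X a \<omega>, X ?b \<omega>) \<partial>M) = I"
      unfolding I_def q_def by (rule decoupled[OF _ p eq C]) (use N in auto)
    \<comment> \<open>The end states of an independent pair of paths are distributed as
      \<open>\<pi> \<Otimes>\<^sub>M \<pi>\<close>, so integrals of the excess and the deficit of
      \<open>q\<close> are those of \<open>p\<close>.\<close>
    have cast: "(\<integral>\<^sup>+z. h (X a (fst z), X ?b (snd z)) \<partial>(M \<Otimes>\<^sub>M M)) = (\<integral>\<^sup>+x. h x \<partial>(\<pi> \<Otimes>\<^sub>M \<pi>))"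
      if h[measurable]: "h \<in> borel_measurable (borel \<Otimes>\<^sub>M borel)" for h :: "'e \<times> 'e \<Rightarrow> ennreal"
    proof -
      have "(\<integral>\<^sup>+z. h (X a (fst z), X ?b (snd z)) \<partial>(M \<Otimes>\<^sub>M M)) = (\<integral>\<^sup>+\<omega>. \<integral>\<^sup>+\<omega>'. h (X a \<omega>, X ?b \<omega>') \<partial>M \<partial>M)"
        by (subst nn_integral_fst[symmetric]) auto
      also have "\<dots> = (\<integral>\<^sup>+\<omega>. \<integral>\<^sup>+x'. h (X a \<omega>, x') \<partial>distr M borel (X ?b) \<partial>M)"
        by (intro nn_integral_cong, subst nn_integral_distr) auto
      also have "\<dots> = (\<integral>\<^sup>+\<omega>. (\<lambda>x. \<integral>\<^sup>+x'. h (x, x') \<partial>\<pi>) (X a \<omega>) \<partial>M)"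
        by (simp add: X_distr)
      also have "\<dots> = (\<integral>\<^sup>+x. (\<integral>\<^sup>+x'. h (x, x') \<partial>\<pi>) \<partial>distr M borel (X a))"
        by (subst nn_integral_distr)
          (auto intro!: \<pi>.borel_measurable_nn_integral simp: case_prod_beta' cong: measurable_cong_sets sets_pair_measure_cong)
      also have "\<dots> = (\<integral>\<^sup>+x. h x \<partial>(\<pi> \<Otimes>\<^sub>M \<pi>))"
        unfolding X_distr by (rule \<pi>.nn_integral_fst) (simp cong: measurable_cong_sets add: s\<pi>\<pi>)
      finally show ?thesis .
    qed
    have O1: "(\<integral>\<^sup>+z. q z - 1 \<partial>(M \<Otimes>\<^sub>M M)) \<le> \<beta>" and O2: "(\<integral>\<^sup>+z. 1 - q z \<partial>(M \<Otimes>\<^sub>M M)) \<le> \<beta>"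
      and O12: "emeasure (joint k) N + (\<integral>\<^sup>+z. q z - 1 \<partial>(M \<Otimes>\<^sub>M M)) \<le> \<beta>"
      unfolding q_def \<beta>_def cast[of "\<lambda>x. p x - 1", simplified] cast[of "\<lambda>x. 1 - p x", simplified]
      by (auto intro: add_increasing add_increasing2)
    have "emeasure M {\<omega>. (\<omega>, \<omega>) \<in> C} = (\<integral>\<^sup>+\<omega>. indicator {\<omega>. (\<omega>, \<omega>) \<in> C} \<omega> \<partial>M)" by simp
    \<comment> \<open>Where the end states lie in \<open>N\<close> there is no density to use, and
      \<open>C\<close> is simply bounded by 1; this contributes the singular mass
      \<open>emeasure (joint k) N\<close>.\<close>
    also have "\<dots> \<le> (\<integral>\<^sup>+\<omega>. indicator N (X a \<omega>, X ?b \<omega>) + indicator C (\<omega>, \<omega>) * indicator (- N) (X a \<omega>, X ?b \<omega>) \<partial>M)"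
      by (intro nn_integral_mono) (auto split: split_indicator)
    also have "\<dots> = (\<integral>\<^sup>+\<omega>. indicator N (X a \<omega>, X ?b \<omega>) \<partial>M) + I"
    proof (subst nn_integral_add)
      have "(\<lambda>\<omega>. indicator C (\<omega>, \<omega>) :: ennreal) = indicator {\<omega>. (\<omega>, \<omega>) \<in> C}" by (auto simp: fun_eq_iff indicator_def)
      then have [measurable]: "(\<lambda>\<omega>. indicator C (\<omega>, \<omega>) :: ennreal) \<in> borel_measurable M" by simp
      have [measurable]: "- N \<in> sets (borel \<Otimes>\<^sub>M borel)"
        using sets.compl_sets[OF N'] by (simp add: space_pair_measure Compl_eq_Diff_UNIV)
      show "(\<lambda>\<omega>. indicator C (\<omega>, \<omega>) * indicator (- N) (X a \<omega>, X ?b \<omega>) :: ennreal) \<in> borel_measurable M" by measurable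
      show "(\<lambda>\<omega>. indicator N (X a \<omega>, X ?b \<omega>) :: ennreal) \<in> borel_measurable M" by measurable
    qed (simp add: I)
    also have "(\<integral>\<^sup>+\<omega>. indicator N (X a \<omega>, X ?b \<omega>) \<partial>M) = emeasure (joint k) N"
      unfolding joint_eq[symmetric, of k a]
      by (subst nn_integral_indicator[symmetric], simp, subst nn_integral_distr) auto
    also have "I \<le> (\<integral>\<^sup>+z. indicator C z + (q z - 1) \<partial>(M \<Otimes>\<^sub>M M))"
      unfolding I_def by (intro nn_integral_mono)
        (auto split: split_indicator intro: ennreal_le_add_diff)
    also have "\<dots> = emeasure (M \<Otimes>\<^sub>M M) C + (\<integral>\<^sup>+z. q z - 1 \<partial>(M \<Otimes>\<^sub>M M))"
      by (subst nn_integral_add) auto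
    finally have 1: "emeasure M {\<omega>. (\<omega>, \<omega>) \<in> C} \<le> emeasure (joint k) N + (emeasure (M \<Otimes>\<^sub>M M) C + (\<integral>\<^sup>+z. q z - 1 \<partial>(M \<Otimes>\<^sub>M M)))"
      by (simp add: add_left_mono)
    have "emeasure (M \<Otimes>\<^sub>M M) C = (\<integral>\<^sup>+z. indicator C z \<partial>(M \<Otimes>\<^sub>M M))" by simp
    also have "\<dots> \<le> (\<integral>\<^sup>+z. indicator C z * q z + (1 - q z) \<partial>(M \<Otimes>\<^sub>M M))"
      by (intro nn_integral_mono) (auto split: split_indicator intro: ennreal_le_add_diff)
    also have "\<dots> = I + (\<integral>\<^sup>+z. 1 - q z \<partial>(M \<Otimes>\<^sub>M M))"
      unfolding I_def by (subst nn_integral_add) auto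
    also have "I \<le> emeasure M {\<omega>. (\<omega>, \<omega>) \<in> C}"
    proof -
      have "I \<le> (\<integral>\<^sup>+\<omega>. indicator {\<omega>. (\<omega>, \<omega>) \<in> C} \<omega> \<partial>M)"
        unfolding I[symmetric] by (intro nn_integral_mono) (auto split: split_indicator)
      then show ?thesis by simp
    qed
    finally have 2: "emeasure (M \<Otimes>\<^sub>M M) C \<le> emeasure M {\<omega>. (\<omega>, \<omega>) \<in> C} + (\<integral>\<^sup>+z. 1 - q z \<partial>(M \<Otimes>\<^sub>M M))"
      by (simp add: add_right_mono)
    from 1 O12 have "emeasure M {\<omega>. (\<omega>, \<omega>) \<in> C} \<le> emeasure (M \<Otimes>\<^sub>M M) C + \<beta>"
      by (metis (no_types, lifting) add.left_commute add_left_mono order_trans)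
    moreover from 2 O2 have "emeasure (M \<Otimes>\<^sub>M M) C \<le> emeasure M {\<omega>. (\<omega>, \<omega>) \<in> C} + \<beta>"
      by (meson add_left_mono order_trans)
    ultimately show ?thesis by simp
  qed
  then show ?thesis using that[of D1 D2] D unfolding \<beta>_def tv s\<pi>\<pi> by blast
qed

text \<open>A bound on the coefficients of absolute regularity (beta-mixing) of the process (X, Y)
  at gap \<open>k\<close>, uniform in the position \<open>a\<close>. The diagonal represents the
  joint law of past and future, the iterated integral an independent pair.\<close>

definition decoupling_rate :: "(nat \<Rightarrow> ennreal) \<Rightarrow> bool" where
  "decoupling_rate \<beta> \<longleftrightarrow> \<beta> \<longlonglongrightarrow> 0 \<and>
    (\<forall>k a C. C \<in> sets (XY {..a} {..<a} \<Otimes>\<^sub>M XY {a + int k..} {a + int k..}) \<longrightarrow>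
      (\<integral>\<^sup>+\<omega>. indicator C (\<omega>, \<omega>) \<partial>M) \<le> (\<integral>\<^sup>+\<omega>'. \<integral>\<^sup>+\<omega>. indicator C (\<omega>, \<omega>') \<partial>M \<partial>M) + \<beta> k \<and>
      (\<integral>\<^sup>+\<omega>'. \<integral>\<^sup>+\<omega>. indicator C (\<omega>, \<omega>') \<partial>M \<partial>M) \<le> (\<integral>\<^sup>+\<omega>. indicator C (\<omega>, \<omega>) \<partial>M) + \<beta> k)"

lemma decoupling_rateD:
  assumes "decoupling_rate \<beta>"
  shows "\<beta> \<longlonglongrightarrow> 0"
    and "C \<in> sets (XY {..a} {..<a} \<Otimes>\<^sub>M XY {a + int k..} {a + int k..}) \<Longrightarrow>
      (\<integral>\<^sup>+\<omega>. indicator C (\<omega>, \<omega>) \<partial>M) \<le> (\<integral>\<^sup>+\<omega>'. \<integral>\<^sup>+\<omega>. indicator C (\<omega>, \<omega>') \<partial>M \<partial>M) + \<beta> k"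
    and "C \<in> sets (XY {..a} {..<a} \<Otimes>\<^sub>M XY {a + int k..} {a + int k..}) \<Longrightarrow>
      (\<integral>\<^sup>+\<omega>'. \<integral>\<^sup>+\<omega>. indicator C (\<omega>, \<omega>') \<partial>M \<partial>M) \<le> (\<integral>\<^sup>+\<omega>. indicator C (\<omega>, \<omega>) \<partial>M) + \<beta> k"
  using assms unfolding decoupling_rate_def by blast+

lemma decoupling_rate_exists: "\<exists>\<beta>. decoupling_rate \<beta>"
proof -
  let ?d = "\<lambda>k D. measure (joint k) D - measure (\<pi> \<Otimes>\<^sub>M \<pi>) D"
  define Q where "Q k D1 D2 \<longleftrightarrow> D1 \<in> sets (borel \<Otimes>\<^sub>M borel) \<and> D2 \<in> sets (borel \<Otimes>\<^sub>M borel) \<and>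
    (\<forall>a C. C \<in> sets (XY {..a} {..<a} \<Otimes>\<^sub>M XY {a + int k..} {a + int k..}) \<longrightarrow>
      emeasure M {\<omega>. (\<omega>, \<omega>) \<in> C} \<le> emeasure (M \<Otimes>\<^sub>M M) C + ennreal (?d k D1 - ?d k D2) \<and>
      emeasure (M \<Otimes>\<^sub>M M) C \<le> emeasure M {\<omega>. (\<omega>, \<omega>) \<in> C} + ennreal (?d k D1 - ?d k D2))" for k D1 D2
  have "\<exists>D1 D2. Q k D1 D2" for k
    unfolding Q_def by (rule mixing_aux[of k]) blast
  then obtain D1 D2 where QD: "\<And>k. Q k (D1 k) (D2 k)" by metis
  have D: "\<And>k. D1 k \<in> sets (borel \<Otimes>\<^sub>M borel)" "\<And>k. D2 k \<in> sets (borel \<Otimes>\<^sub>M borel)"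
    and *: "\<And>k a C. C \<in> sets (XY {..a} {..<a} \<Otimes>\<^sub>M XY {a + int k..} {a + int k..}) \<Longrightarrow>
      emeasure M {\<omega>. (\<omega>, \<omega>) \<in> C} \<le> emeasure (M \<Otimes>\<^sub>M M) C + ennreal (?d k (D1 k) - ?d k (D2 k)) \<and>
      emeasure (M \<Otimes>\<^sub>M M) C \<le> emeasure M {\<omega>. (\<omega>, \<omega>) \<in> C} + ennreal (?d k (D1 k) - ?d k (D2 k))"
    using QD unfolding Q_def by blast+
  \<comment> \<open>The events realising the total variation vary with \<open>k\<close>, which is
    why the convergence was proved for arbitrary sequences of sets.\<close>
  have "(\<lambda>k. ?d k (D1 k) - ?d k (D2 k)) \<longlonglongrightarrow> 0"
    using tendsto_diff[OF joint_asymptotically_product[of D1] joint_asymptotically_product[of D2]] D by simp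
  then have "(\<lambda>k. ennreal (?d k (D1 k) - ?d k (D2 k))) \<longlonglongrightarrow> 0"
    using tendsto_ennrealI[of "\<lambda>k. ?d k (D1 k) - ?d k (D2 k)" 0] by simp
  moreover have "(\<integral>\<^sup>+\<omega>. indicator C (\<omega>, \<omega>) \<partial>M) = emeasure M {\<omega>. (\<omega>, \<omega>) \<in> C} \<and> (\<integral>\<^sup>+\<omega>'. \<integral>\<^sup>+\<omega>. indicator C (\<omega>, \<omega>') \<partial>M \<partial>M) = emeasure (M \<Otimes>\<^sub>M M) C"
    if C: "C \<in> sets (XY {..a} {..<a} \<Otimes>\<^sub>M XY {a + int k..} {a + int k..})" for a k C
  proof
    have "(\<lambda>\<omega>. (\<omega>, \<omega>)) \<in> M \<rightarrow>\<^sub>M XY {..a} {..<a} \<Otimes>\<^sub>M XY {a + int k..} {a + int k..}"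
      by (intro measurable_Pair measurable_id_XY)
    from measurable_sets[OF this C] have "{\<omega>. (\<omega>, \<omega>) \<in> C} \<in> sets M" by (simp add: vimage_def)
    moreover have "(indicator C (\<omega>, \<omega>) :: ennreal) = indicator {\<omega>. (\<omega>, \<omega>) \<in> C} \<omega>" for \<omega>
      by (simp add: indicator_def)
    ultimately show "(\<integral>\<^sup>+\<omega>. indicator C (\<omega>, \<omega>) \<partial>M) = emeasure M {\<omega>. (\<omega>, \<omega>) \<in> C}" by simp
    have "(\<lambda>z. (fst z, snd z)) \<in> M \<Otimes>\<^sub>M M \<rightarrow>\<^sub>M XY {..a} {..<a} \<Otimes>\<^sub>M XY {a + int k..} {a + int k..}"
      by (intro measurable_Pair measurable_compose[OF measurable_fst measurable_id_XY] measurable_compose[OF measurable_snd measurable_id_XY])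
    from measurable_sets[OF this C] have [measurable]: "C \<in> sets (M \<Otimes>\<^sub>M M)"
      by (simp add: vimage_def space_pair_measure)
    show "(\<integral>\<^sup>+\<omega>'. \<integral>\<^sup>+\<omega>. indicator C (\<omega>, \<omega>') \<partial>M \<partial>M) = emeasure (M \<Otimes>\<^sub>M M) C"
      using MM.nn_integral_snd[of "indicator C"] by simp
  qed
  ultimately show ?thesis
    unfolding decoupling_rate_def using *
    by (intro exI[of _ "\<lambda>k. ennreal (?d k (D1 k) - ?d k (D2 k))"]) simp
qed

end

section \<open>Resampling of observations\<close>

definition resample :: "'f measure \<Rightarrow> int \<Rightarrow> ('t \<times> (int \<Rightarrow> 'f) \<Rightarrow> ennreal) \<Rightarrow> 't \<times> (int \<Rightarrow> 'f) \<Rightarrow> ennreal" where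
  "resample \<phi> j f z = (\<integral>\<^sup>+u. f (fst z, (snd z)(j := u)) \<partial>\<phi>)"

text \<open>Independence in the functional sense, with no measure involved: the function cannot see
  the coordinates in \<open>J\<close>.\<close>

definition indep_of :: "int set \<Rightarrow> ('t \<times> (int \<Rightarrow> 'f) \<Rightarrow> 'c) \<Rightarrow> bool" where
  "indep_of J f \<longleftrightarrow> (\<forall>t y y'. (\<forall>i. i \<notin> J \<longrightarrow> y i = y' i) \<longrightarrow> f (t, y) = f (t, y'))"

lemma indep_of_resample:
  fixes f :: "'t \<times> (int \<Rightarrow> 'f) \<Rightarrow> ennreal"
  assumes "indep_of J f" shows "indep_of (insert j J) (resample \<phi> j f)"
  unfolding indep_of_def
proof (intro allI impI)
  fix t and y y' :: "int \<Rightarrow> 'f" assume "\<forall>i. i \<notin> insert j J \<longrightarrow> y i = y' i"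
  then have "f (t, y(j := u)) = f (t, y'(j := u))" for u
    using assms unfolding indep_of_def by (auto simp: fun_upd_def)
  then show "resample \<phi> j f (t, y) = resample \<phi> j f (t, y')" by (simp add: resample_def)
qed

lemma indep_of_foldr_resample:
  fixes f :: "'t \<times> (int \<Rightarrow> 'f) \<Rightarrow> ennreal"
  shows "indep_of (set js) (foldr (resample \<phi>) js f)"
proof (induction js)
  case Nil
  have "y = y'" if "\<forall>i. y i = y' i" for y y' :: "int \<Rightarrow> 'f" using that by auto
  then have "f (t, y) = f (t, y')" if "\<forall>i. y i = y' i" for t y y' using that by metis
  then show ?case unfolding indep_of_def by simp
next
  case (Cons j js)
  then show ?case using indep_of_resample[of "set js" _ j \<phi>] by simp
qed

lemma resample_indep:
  fixes f :: "'t \<times> (int \<Rightarrow> 'f) \<Rightarrow> ennreal"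
  assumes "prob_space \<phi>" "indep_of J f" "j \<in> J" shows "resample \<phi> j f = f"
proof
  fix z :: "'t \<times> (int \<Rightarrow> 'f)"
  have "f (fst z, (snd z)(j := u)) = f (fst z, snd z)" for u
    by (rule assms(2)[unfolded indep_of_def, rule_format]) (use assms(3) in auto)
  then show "resample \<phi> j f z = f z"
    using prob_space.emeasure_space_1[OF assms(1)] by (simp add: resample_def)
qed

lemma foldr_resample_indep:
  assumes "prob_space \<phi>" "indep_of J f" "set js \<subseteq> J" shows "foldr (resample \<phi>) js f = f"
  using assms(3) by (induction js) (auto simp: resample_indep[OF assms(1,2)])

lemma resample_mono: "(\<And>z. f z \<le> f' z) \<Longrightarrow> resample \<phi> j f z \<le> resample \<phi> j f' z"
  unfolding resample_def by (intro nn_integral_mono) simp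

lemma foldr_resample_mono: "(\<And>z. f z \<le> f' z) \<Longrightarrow> foldr (resample \<phi>) js f z \<le> foldr (resample \<phi>) js f' z"
  by (induction js arbitrary: z) (auto intro: resample_mono)

lemma resample_measurable:
  assumes "sigma_finite_measure \<phi>" and s: "sets \<phi> = sets borel" and f: "f \<in> borel_measurable (N \<Otimes>\<^sub>M YM UNIV)"
  shows "resample \<phi> j f \<in> borel_measurable (N \<Otimes>\<^sub>M YM UNIV)"
proof -
  interpret sigma_finite_measure \<phi> by fact
  note [measurable_cong] = s
  have c[measurable]: "(\<lambda>y. y i) \<in> YM UNIV \<rightarrow>\<^sub>M borel" for i by (rule YM_component) simp
  have [measurable]: "(\<lambda>w. (snd (fst w))(j := snd w)) \<in> (N \<Otimes>\<^sub>M YM UNIV) \<Otimes>\<^sub>M \<phi> \<rightarrow>\<^sub>M YM UNIV"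
  proof (rule measurable_into_YM)
    fix k show "(\<lambda>w. ((snd (fst w))(j := snd w)) k) \<in> borel_measurable ((N \<Otimes>\<^sub>M YM UNIV) \<Otimes>\<^sub>M \<phi>)"
      by (cases "k = j") (auto intro: measurable_compose[OF _ c])
  qed
  have "(\<lambda>w. f (fst (fst w), (snd (fst w))(j := snd w))) \<in> borel_measurable ((N \<Otimes>\<^sub>M YM UNIV) \<Otimes>\<^sub>M \<phi>)"
    by (rule measurable_compose[OF _ f]) measurable
  then have "(\<lambda>(z, u). f (fst z, (snd z)(j := u))) \<in> borel_measurable ((N \<Otimes>\<^sub>M YM UNIV) \<Otimes>\<^sub>M \<phi>)"
    by (simp add: case_prod_beta')
  from borel_measurable_nn_integral[OF this] show ?thesis by (simp add: resample_def[abs_def])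
qed

lemma foldr_resample_measurable:
  assumes "sigma_finite_measure \<phi>" "sets \<phi> = sets borel" "f \<in> borel_measurable (N \<Otimes>\<^sub>M YM UNIV)"
  shows "foldr (resample \<phi>) js f \<in> borel_measurable (N \<Otimes>\<^sub>M YM UNIV)"
  by (induction js) (use assms in \<open>auto intro: resample_measurable\<close>)

text \<open>Let \<open>h\<close> be the indicator of \<open>D\<close> averaged over the block
  \<open>J k\<close>, and \<open>G\<close> the set where \<open>h\<close> is nonzero.
  \<open>G\<close> ignores the block and is \<open>\<mu>\<close>-null, so \<open>\<nu>\<close> gives
  it mass at most \<open>\<beta> k\<close>. The rest of \<open>D\<close> disappears completely under
  resampling and is \<open>\<nu>\<close>-null. Hence \<open>D\<close> has \<open>\<nu>\<close>-mass
  at most \<open>\<beta> k\<close> for every \<open>k\<close>.\<close>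

lemma null_sets_transfer:
  fixes \<mu> \<nu> :: "('t \<times> (int \<Rightarrow> 'f::topological_space)) measure"
  assumes \<phi>: "prob_space \<phi>" "sets \<phi> = sets borel"
    and s\<mu>[measurable_cong]: "sets \<mu> = sets (N \<Otimes>\<^sub>M YM UNIV)" and s\<nu>[measurable_cong]: "sets \<nu> = sets (N \<Otimes>\<^sub>M YM UNIV)"
    and \<mu>: "\<And>f j. f \<in> borel_measurable (N \<Otimes>\<^sub>M YM UNIV) \<Longrightarrow> (\<integral>\<^sup>+z. f z \<partial>\<mu>) = 0 \<longleftrightarrow> (\<integral>\<^sup>+z. resample \<phi> j f z \<partial>\<mu>) = 0"
    and \<nu>: "\<And>f j. f \<in> borel_measurable (N \<Otimes>\<^sub>M YM UNIV) \<Longrightarrow> (\<integral>\<^sup>+z. f z \<partial>\<nu>) = 0 \<longleftrightarrow> (\<integral>\<^sup>+z. resample \<phi> j f z \<partial>\<nu>) = 0"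
    and \<beta>: "\<beta> \<longlonglongrightarrow> (0::ennreal)"
    and close: "\<And>k G. G \<in> sets (N \<Otimes>\<^sub>M YM UNIV) \<Longrightarrow> indep_of (set (J k)) (\<lambda>z. z \<in> G) \<Longrightarrow> emeasure \<nu> G \<le> emeasure \<mu> G + \<beta> (k::nat)"
    and D: "D \<in> null_sets \<mu>"
  shows "D \<in> null_sets \<nu>"
proof -
  have sf: "sigma_finite_measure \<phi>"
    using \<phi>(1) by (simp add: finite_measure_def prob_space_def)
  note rm = foldr_resample_measurable[OF sf \<phi>(2)]
  have D0[measurable]: "D \<in> sets (N \<Otimes>\<^sub>M YM UNIV)" using D s\<mu> by auto
  have \<mu>': "(\<integral>\<^sup>+z. f z \<partial>\<mu>) = 0 \<longleftrightarrow> (\<integral>\<^sup>+z. foldr (resample \<phi>) js f z \<partial>\<mu>) = 0"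
    if f: "f \<in> borel_measurable (N \<Otimes>\<^sub>M YM UNIV)" for f js
    by (induction js) (use \<mu>[OF rm[OF f]] in auto)
  have \<nu>': "(\<integral>\<^sup>+z. f z \<partial>\<nu>) = 0 \<longleftrightarrow> (\<integral>\<^sup>+z. foldr (resample \<phi>) js f z \<partial>\<nu>) = 0"
    if f: "f \<in> borel_measurable (N \<Otimes>\<^sub>M YM UNIV)" for f js
    by (induction js) (use \<nu>[OF rm[OF f]] in auto)
  have "emeasure \<nu> D \<le> \<beta> k" for k
  proof -
    define h where "h = foldr (resample \<phi>) (J k) (indicator D)"
    have h[measurable]: "h \<in> borel_measurable (N \<Otimes>\<^sub>M YM UNIV)" unfolding h_def by (rule rm) simp
    have hi: "indep_of (set (J k)) h" unfolding h_def by (rule indep_of_foldr_resample)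
    define G where "G = {z\<in>space (N \<Otimes>\<^sub>M YM UNIV). h z \<noteq> 0}"
    have spG: "z \<in> space (N \<Otimes>\<^sub>M YM UNIV) \<longleftrightarrow> fst z \<in> space N" for z :: "'t \<times> (int \<Rightarrow> 'f)"
      by (cases z) (simp add: space_pair_measure)
    have G[measurable]: "G \<in> sets (N \<Otimes>\<^sub>M YM UNIV)" unfolding G_def by measurable
    have Gi: "indep_of (set (J k)) (\<lambda>z. z \<in> G)"
      using hi unfolding indep_of_def G_def mem_Collect_eq spG by (metis fst_conv)
    have "(\<integral>\<^sup>+z. h z \<partial>\<mu>) = 0"
      unfolding h_def using D by (subst \<mu>'[symmetric]) (auto simp: null_sets_def)
    then have "AE z in \<mu>. h z = 0" by (subst (asm) nn_integral_0_iff_AE) auto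
    then have "AE z in \<mu>. z \<notin> G" by eventually_elim (simp add: G_def)
    then have "emeasure \<mu> G = 0" by (simp add: AE_iff_measurable[OF _ refl] AE_iff_null_sets null_setsD1 s\<mu>)
    then have \<nu>G: "emeasure \<nu> G \<le> \<beta> k" using close[OF G Gi] by simp
    \<comment> \<open>Off \<open>G\<close> the function \<open>h\<close> is already an upper bound
      equal to 0. On \<open>G\<close> nothing of \<open>D - G\<close> is present, and since
      \<open>G\<close> ignores the block, redrawing observations in the block never leads out of
      \<open>G\<close>.\<close>
    have "foldr (resample \<phi>) (J k) (indicator (D - G)) z = 0" for z
    proof (cases "z \<in> G")
      case True
      have i: "indep_of (set (J k)) (indicator (- G) :: _ \<Rightarrow> ennreal)"
        using Gi unfolding indep_of_def by (auto simp: indicator_def)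
      have "foldr (resample \<phi>) (J k) (indicator (D - G)) z \<le> foldr (resample \<phi>) (J k) (indicator (- G)) z"
        by (rule foldr_resample_mono) (auto split: split_indicator)
      also have "\<dots> = indicator (- G) z" by (subst foldr_resample_indep[OF \<phi>(1) i]) auto
      finally show ?thesis using True by simp
    next
      case False
      have le: "foldr (resample \<phi>) (J k) (indicator (D - G)) z \<le> h z"
        unfolding h_def by (rule foldr_resample_mono) (auto split: split_indicator)
      show ?thesis
      proof (cases "fst z \<in> space N")
        case True
        then show ?thesis using False le by (simp add: G_def spG)
      next
        \<comment> \<open>\<open>G\<close> was cut down to the space, so \<open>h\<close> is not
          controlled by \<open>G\<close> at points outside it. Resampling keeps the first component,
          and \<open>D\<close> has no points over the complement of \<open>space N\<close>.\<close>
        case False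
        have i: "indep_of UNIV (indicator {z. fst z \<in> space N} :: 't \<times> (int \<Rightarrow> 'f) \<Rightarrow> ennreal)"
          by (simp add: indep_of_def indicator_def)
        have "D \<subseteq> {z. fst z \<in> space N}" using sets.sets_into_space[OF D0] spG by auto
        then have "foldr (resample \<phi>) (J k) (indicator (D - G)) z \<le> foldr (resample \<phi>) (J k) (indicator {z. fst z \<in> space N}) z"
          by (intro foldr_resample_mono) (auto split: split_indicator)
        also have "\<dots> = indicator {z. fst z \<in> space N} z" by (subst foldr_resample_indep[OF \<phi>(1) i]) auto
        finally show ?thesis using False by simp
      qed
    qed
    then have z0: "foldr (resample \<phi>) (J k) (indicator (D - G)) = (\<lambda>_. 0)" by (rule ext)
    have "(\<integral>\<^sup>+z. indicator (D - G) z \<partial>\<nu>) = 0"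
      using \<nu>'[of "indicator (D - G)" "J k"] by (simp add: z0)
    then have "emeasure \<nu> (D - G) = 0" by (simp add: s\<nu>)
    moreover have "emeasure \<nu> D \<le> emeasure \<nu> ((D - G) \<union> G)" by (intro emeasure_mono) (auto simp: s\<nu>)
    moreover have "emeasure \<nu> ((D - G) \<union> G) \<le> emeasure \<nu> (D - G) + emeasure \<nu> G"
      by (intro emeasure_subadditive) (auto simp: s\<nu>)
    ultimately show ?thesis using \<nu>G by (simp add: order_trans)
  qed
  then have "emeasure \<nu> D \<le> 0" by (intro LIMSEQ_le_const[OF \<beta>]) auto
  then show ?thesis using D0 by (simp add: null_sets_def s\<nu>)
qed

section \<open>Resampling under a strictly positive observation density\<close>

locale nondegenerate_hmm_measure = ergodic_hmm_measure P \<Phi> M \<pi> Pz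
  for P :: "'e::polish_space \<Rightarrow> 'e measure"
    and \<Phi> :: "'e \<Rightarrow> 'f::polish_space measure"
    and M :: "(int, 'e, 'f) path measure" and \<pi>
    and Pz :: "'e \<Rightarrow> (nat, 'e, 'f) path measure" +
  fixes \<phi> :: "'f measure" and g :: "'e \<Rightarrow> 'f \<Rightarrow> real"
  assumes \<phi>_prob: "prob_space \<phi>" and sets_\<phi>[measurable_cong]: "sets \<phi> = sets borel"
    and g_measurable[measurable]: "(\<lambda>(z, u). g z u) \<in> borel_measurable (borel \<Otimes>\<^sub>M borel)"
    and g_pos: "\<And>z u. 0 < g z u"
    and \<Phi>_density: "\<And>z A. A \<in> sets borel \<Longrightarrow> emeasure (\<Phi> z) A = (\<integral>\<^sup>+u. indicator A u * ennreal (g z u) \<partial>\<phi>)"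
begin

sublocale \<phi>: prob_space \<phi> by (rule \<phi>_prob)

sublocale M\<phi>: pair_sigma_finite M \<phi> ..

definition upd :: "int \<Rightarrow> (int, 'e, 'f) path \<times> 'f \<Rightarrow> (int, 'e, 'f) path" where
  "upd j w = (fst (fst w), (snd (fst w))(j := snd w))"

lemma X_upd[simp]: "X i (upd j w) = X i (fst w)" by (simp add: upd_def X_def)

lemma Y_upd[simp]: "Y i (upd j w) = (if i = j then snd w else Y i (fst w))" by (simp add: upd_def Y_def)

lemma upd_measurable: "upd j \<in> M \<Otimes>\<^sub>M \<phi> \<rightarrow>\<^sub>M M"
proof -
  have "upd j \<in> M \<Otimes>\<^sub>M \<phi> \<rightarrow>\<^sub>M XY UNIV UNIV" by (rule measurable_into_XY) simp_all
  then show ?thesis using measurable_cong_sets[OF refl sets_M[symmetric]] by auto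
qed

lemma g'_measurable[measurable]: "(\<lambda>w. g (X j (fst w)) (snd w)) \<in> borel_measurable (M \<Otimes>\<^sub>M \<phi>)"
proof -
  have "(\<lambda>w. (X j (fst w), snd w)) \<in> M \<Otimes>\<^sub>M \<phi> \<rightarrow>\<^sub>M borel \<Otimes>\<^sub>M borel" by measurable
  from measurable_compose[OF this g_measurable] show ?thesis by simp
qed

text \<open>Given the signal, \<open>Y j\<close> has density g(X j, .) with respect to
  \<open>\<phi>\<close> and is independent of the other observations, so replacing it by a fresh
  draw reproduces the law.\<close>

lemma resampled_law: "M = distr (density (M \<Otimes>\<^sub>M \<phi>) (\<lambda>w. ennreal (g (X j (fst w)) (snd w)))) M (upd j)"
proof (rule measure_eqI_generator_eq[where E="cyl UNIV UNIV" and \<Omega>=UNIV and A="\<lambda>_. UNIV"])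
  fix V :: "(int, 'e, 'f) path set" assume V: "V \<in> cyl UNIV UNIV"
  then have VM[measurable]: "V \<in> sets M" by (auto simp: sets_M sets_XY)
  from V obtain A B where AB: "V = {\<omega>. \<forall>i. X i \<omega> \<in> A i \<and> Y i \<omega> \<in> B i}"
     "\<forall>i. A i \<in> sets borel \<and> B i \<in> sets borel" "finite {i. A i \<noteq> UNIV \<or> B i \<noteq> UNIV}"
    unfolding cyl_def by blast
  \<comment> \<open>\<open>j\<close> is removed because its factor arises from the fresh draw; it
    rejoins the product below, where all observations are put back together.\<close>
  define J where "J = {i. B i \<noteq> UNIV} - {j}"
  have J: "finite J" "j \<notin> J" unfolding J_def by (auto intro: finite_subset[OF _ AB(3)])
  have Bm: "B i \<in> sets borel" for i using AB(2) by simp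
  define WX where "WX = {\<omega> :: (int, 'e, 'f) path. \<forall>i. X i \<omega> \<in> A i}"
  have "WX \<in> cyl UNIV {}"
    unfolding cyl_def WX_def mem_Collect_eq
    by (rule exI[of _ A], rule exI[of _ "\<lambda>_. UNIV"]) (use AB finite_subset[OF _ AB(3), of "{i. A i \<noteq> UNIV}"] in auto)
  then have WX: "WX \<in> sets (XY UNIV {})" by (auto simp: sets_XY)
  note [measurable] = sub_M[OF WX]
  define K where "K = {\<omega> :: (int, 'e, 'f) path. \<forall>i\<in>J. Y i \<omega> \<in> B i}"
  have "{\<omega>\<in>space M. \<forall>i\<in>J. Y i \<omega> \<in> B i} \<in> sets M"
    using J(1) measurable_sets[OF Y_measurable Bm] by (intro sets.sets_Collect_finite_All) (auto simp: vimage_def)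
  then have K[measurable]: "K \<in> sets M" by (simp add: K_def)
  have pj: "(\<lambda>\<omega>. emeasure (\<Phi> (X j \<omega>)) (B j) * indicator WX \<omega>) \<in> borel_measurable (XY UNIV {})"
    using WX by (intro borel_measurable_times_ennreal measurable_compose[OF X_XY \<Phi>_emeasure] Bm borel_measurable_indicator) auto
  have WXi: "(\<lambda>\<omega>. indicator WX \<omega> :: ennreal) \<in> borel_measurable (XY UNIV {})"
    using WX by simp
  have iff: "(\<forall>i. Y i \<omega> \<in> B i) \<longleftrightarrow> (\<forall>i\<in>insert j J. Y i \<omega> \<in> B i)" for \<omega> :: "(int, 'e, 'f) path"
    unfolding J_def by auto
  have iff': "upd j w \<in> V \<longleftrightarrow> fst w \<in> WX \<and> fst w \<in> K \<and> snd w \<in> B j" for w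
    unfolding AB(1) WX_def K_def J_def by (auto split: if_splits)
  have "emeasure (distr (density (M \<Otimes>\<^sub>M \<phi>) (\<lambda>w. ennreal (g (X j (fst w)) (snd w)))) M (upd j)) V =
     (\<integral>\<^sup>+w. indicator V w \<partial>distr (density (M \<Otimes>\<^sub>M \<phi>) (\<lambda>w. ennreal (g (X j (fst w)) (snd w)))) M (upd j))"
    by simp
  also have "\<dots> = (\<integral>\<^sup>+w. ennreal (g (X j (fst w)) (snd w)) * indicator V (upd j w) \<partial>(M \<Otimes>\<^sub>M \<phi>))"
    using upd_measurable[of j] measurable_compose[OF upd_measurable[of j] borel_measurable_indicator[OF VM]]
    by (subst nn_integral_distr) (auto simp: nn_integral_density)
  also have "\<dots> = (\<integral>\<^sup>+\<omega>. \<integral>\<^sup>+u. ennreal (g (X j \<omega>) u) * indicator V (upd j (\<omega>, u)) \<partial>\<phi> \<partial>M)"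
  proof -
    have [measurable]: "(\<lambda>w. indicator V (upd j w) :: ennreal) \<in> borel_measurable (M \<Otimes>\<^sub>M \<phi>)"
      by (rule measurable_compose[OF upd_measurable[of j] borel_measurable_indicator[OF VM]])
    have "(\<lambda>w. ennreal (g (X j (fst w)) (snd w)) * indicator V (upd j w)) \<in> borel_measurable (M \<Otimes>\<^sub>M \<phi>)"
      by measurable
    from \<phi>.nn_integral_fst[OF this] show ?thesis by simp
  qed
  also have "\<dots> = (\<integral>\<^sup>+\<omega>. indicator K \<omega> * (emeasure (\<Phi> (X j \<omega>)) (B j) * indicator WX \<omega>) \<partial>M)"
  proof (rule nn_integral_cong)
    fix \<omega> :: "(int, 'e, 'f) path"
    have [measurable]: "(\<lambda>u. g (X j \<omega>) u) \<in> borel_measurable \<phi>"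
      using measurable_compose[OF measurable_Pair1' g_measurable, of "X j \<omega>"] by (simp cong: measurable_cong_sets)
    have [measurable]: "B j \<in> sets borel" by (rule Bm)
    have "(\<integral>\<^sup>+u. ennreal (g (X j \<omega>) u) * indicator V (upd j (\<omega>, u)) \<partial>\<phi>) =
      (\<integral>\<^sup>+u. (indicator K \<omega> * indicator WX \<omega>) * (indicator (B j) u * ennreal (g (X j \<omega>) u)) \<partial>\<phi>)"
      by (intro nn_integral_cong) (auto simp: indicator_def iff')
    also have "\<dots> = (indicator K \<omega> * indicator WX \<omega>) * emeasure (\<Phi> (X j \<omega>)) (B j)"
      by (subst nn_integral_cmult) (auto simp: \<Phi>_density)
    finally show "(\<integral>\<^sup>+u. ennreal (g (X j \<omega>) u) * indicator V (upd j (\<omega>, u)) \<partial>\<phi>) =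
      indicator K \<omega> * (emeasure (\<Phi> (X j \<omega>)) (B j) * indicator WX \<omega>)" by (simp add: ac_simps)
  qed
  also have "\<dots> = (\<integral>\<^sup>+\<omega>. (\<Prod>i\<in>J. emeasure (\<Phi> (X i \<omega>)) (B i)) * (emeasure (\<Phi> (X j \<omega>)) (B j) * indicator WX \<omega>) \<partial>M)"
    unfolding K_def by (rule obs_cond[OF J(1) Bm pj])
  also have "\<dots> = (\<integral>\<^sup>+\<omega>. (\<Prod>i\<in>insert j J. emeasure (\<Phi> (X i \<omega>)) (B i)) * indicator WX \<omega> \<partial>M)"
    using J by (simp add: ac_simps)
  also have "\<dots> = (\<integral>\<^sup>+\<omega>. indicator {\<omega>. \<forall>i\<in>insert j J. Y i \<omega> \<in> B i} \<omega> * indicator WX \<omega> \<partial>M)"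
    using J(1) by (intro obs_cond[symmetric] Bm WXi) simp
  also have "\<dots> = (\<integral>\<^sup>+\<omega>. indicator V \<omega> \<partial>M)"
  proof (rule nn_integral_cong)
    fix \<omega> :: "(int, 'e, 'f) path"
    have "\<omega> \<in> V \<longleftrightarrow> (\<forall>i\<in>insert j J. Y i \<omega> \<in> B i) \<and> \<omega> \<in> WX"
      unfolding AB(1) WX_def iff[symmetric] by blast
    then show "indicator {\<omega>. \<forall>i\<in>insert j J. Y i \<omega> \<in> B i} \<omega> * indicator WX \<omega> = (indicator V \<omega> :: ennreal)"
      by (simp add: indicator_def)
  qed
  finally show "emeasure M V = emeasure (distr (density (M \<Otimes>\<^sub>M \<phi>) (\<lambda>w. ennreal (g (X j (fst w)) (snd w)))) M (upd j)) V"
    by simp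
qed (auto simp: sets_M sets_XY Int_stable_cyl UNIV_in_cyl)

lemma snd_measurable[measurable]: "snd \<in> M \<rightarrow>\<^sub>M YM U"
  by (rule measurable_from_subalg[OF subalg[of UNIV UNIV] snd_XY]) simp

text \<open>By \<open>resampled_law\<close> the two integrals differ only by the weight
  \<open>g\<close> inside, and a strictly positive weight does not change which nonnegative
  functions integrate to 0. \<open>\<tau>\<close> will be a pair of states for the true law and a
  constant for the product law.\<close>

lemma resample_null:
  assumes \<tau>[measurable]: "\<tau> \<in> M \<rightarrow>\<^sub>M N" and \<tau>_upd: "\<And>w. \<tau> (upd j w) = \<tau> (fst w)"
    and f: "f \<in> borel_measurable (N \<Otimes>\<^sub>M YM UNIV)"
  shows "(\<integral>\<^sup>+\<omega>. f (\<tau> \<omega>, snd \<omega>) \<partial>M) = 0 \<longleftrightarrow> (\<integral>\<^sup>+\<omega>. resample \<phi> j f (\<tau> \<omega>, snd \<omega>) \<partial>M) = 0"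
proof -
  define f' where "f' \<omega> = f (\<tau> \<omega>, snd \<omega>)" for \<omega>
  have "(\<lambda>\<omega>. (\<tau> \<omega>, snd \<omega>)) \<in> M \<rightarrow>\<^sub>M N \<Otimes>\<^sub>M YM UNIV" by measurable
  then have f'[measurable]: "f' \<in> borel_measurable M" unfolding f'_def[abs_def] by (rule measurable_compose[OF _ f])
  have fu[measurable]: "(\<lambda>w. f' (upd j w)) \<in> borel_measurable (M \<Otimes>\<^sub>M \<phi>)"
    by (rule measurable_compose[OF upd_measurable f'])
  have R: "resample \<phi> j f (\<tau> \<omega>, snd \<omega>) = (\<integral>\<^sup>+u. f' (upd j (\<omega>, u)) \<partial>\<phi>)" for \<omega>
    by (simp add: resample_def f'_def \<tau>_upd) (simp add: upd_def)
  have "(\<integral>\<^sup>+\<omega>. f' \<omega> \<partial>M) = (\<integral>\<^sup>+\<omega>. f' \<omega> \<partial>distr (density (M \<Otimes>\<^sub>M \<phi>) (\<lambda>w. ennreal (g (X j (fst w)) (snd w)))) M (upd j))"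
    using resampled_law[of j] by simp
  also have "\<dots> = (\<integral>\<^sup>+w. ennreal (g (X j (fst w)) (snd w)) * f' (upd j w) \<partial>(M \<Otimes>\<^sub>M \<phi>))"
    using upd_measurable[of j] fu by (subst nn_integral_distr) (auto simp: nn_integral_density)
  finally have "(\<integral>\<^sup>+\<omega>. f' \<omega> \<partial>M) = 0 \<longleftrightarrow> (AE w in M \<Otimes>\<^sub>M \<phi>. ennreal (g (X j (fst w)) (snd w)) * f' (upd j w) = 0)"
    by (simp add: nn_integral_0_iff_AE)
  also have "\<dots> \<longleftrightarrow> (AE w in M \<Otimes>\<^sub>M \<phi>. f' (upd j w) = 0)"
  proof -
    have "ennreal (g z u) \<noteq> 0" for z u using g_pos[of z u] by simp
    then show ?thesis by simp
  qed
  also have "\<dots> \<longleftrightarrow> (\<integral>\<^sup>+w. f' (upd j w) \<partial>(M \<Otimes>\<^sub>M \<phi>)) = 0"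
    by (simp add: nn_integral_0_iff_AE)
  also have "(\<integral>\<^sup>+w. f' (upd j w) \<partial>(M \<Otimes>\<^sub>M \<phi>)) = (\<integral>\<^sup>+\<omega>. resample \<phi> j f (\<tau> \<omega>, snd \<omega>) \<partial>M)"
    unfolding R using fu by (subst \<phi>.nn_integral_fst[symmetric]) auto
  finally show ?thesis by (simp add: f'_def)
qed

text \<open>Early observations come from \<open>y\<close>, late ones from \<open>y'\<close>. The
  value in between is immaterial, since the result is only tested against sets that ignore that
  block.\<close>

definition "mix a k b y y' = (\<lambda>i::int. if i < a - int k then y i else if b + int k \<le> i then y' i else (undefined :: 'f))"

text \<open>Observations at distance \<open>k\<close> from both states are nearly independent of
  them. Separating the late and the early observations from the states costs one rate each. The two
  groups then come from independent paths, and a third rate is paid to take them from a common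
  one.\<close>

lemma obs_law_close:
  fixes D :: "(('e \<times> 'e) \<times> (int \<Rightarrow> 'f)) set"
  assumes rate: "decoupling_rate \<beta>" and ab: "a \<le> b"
    and D: "D \<in> sets ((borel \<Otimes>\<^sub>M borel) \<Otimes>\<^sub>M YM UNIV)" and ind: "indep_of {a - int k..b + int k - 1} (\<lambda>z. z \<in> D)"
  shows "(\<integral>\<^sup>+\<omega>. indicator D ((X a \<omega>, X b \<omega>), snd \<omega>) \<partial>M) \<le> (\<integral>\<^sup>+\<omega>. \<integral>\<^sup>+\<omega>'. indicator D ((X a \<omega>, X b \<omega>), snd \<omega>') \<partial>M \<partial>M) + (\<beta> k + \<beta> k + \<beta> k) \<and>
    (\<integral>\<^sup>+\<omega>. \<integral>\<^sup>+\<omega>'. indicator D ((X a \<omega>, X b \<omega>), snd \<omega>') \<partial>M \<partial>M) \<le> (\<integral>\<^sup>+\<omega>. indicator D ((X a \<omega>, X b \<omega>), snd \<omega>) \<partial>M) + (\<beta> k + \<beta> k + \<beta> k)"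
proof -
  note up = decoupling_rateD(2)[OF rate] and lo = decoupling_rateD(3)[OF rate]
  note [measurable] = D
  define m where "m y y' = mix a k b y y'" for y y' :: "int \<Rightarrow> 'f"
  define T where "T \<omega> = (X a \<omega>, X b \<omega>)" for \<omega> :: "(int, 'e, 'f) path"
  have T_XY: "T \<in> XY S U \<rightarrow>\<^sub>M borel \<Otimes>\<^sub>M borel" if "a \<in> S" "b \<in> S" for S U
    unfolding T_def[abs_def] by (intro measurable_Pair X_XY that)
  have Tm[measurable]: "T \<in> M \<rightarrow>\<^sub>M borel \<Otimes>\<^sub>M borel" unfolding T_def by measurable
  have mm: "(t, m y y) \<in> D \<longleftrightarrow> (t, y) \<in> D" for t y
    by (rule ind[unfolded indep_of_def, rule_format]) (auto simp: m_def mix_def)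
  have m_meas: "(\<lambda>z. m (u z) (v z)) \<in> N \<rightarrow>\<^sub>M YM UNIV"
    if "\<And>i. i < a - int k \<Longrightarrow> (\<lambda>z. u z i) \<in> N \<rightarrow>\<^sub>M borel" "\<And>i. b + int k \<le> i \<Longrightarrow> (\<lambda>z. v z i) \<in> N \<rightarrow>\<^sub>M borel"
    for N :: "'z measure" and u v
  proof (rule measurable_into_YM)
    fix i show "(\<lambda>z. m (u z) (v z) i) \<in> N \<rightarrow>\<^sub>M borel"
      using that[of i] by (cases "i < a - int k"; cases "b + int k \<le> i") (auto simp: m_def mix_def)
  qed
  have Yf: "(\<lambda>z. snd (fst z) i) \<in> XY S U \<Otimes>\<^sub>M N \<rightarrow>\<^sub>M borel" if "i \<in> U" for i S U and N :: "'n measure"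
    using measurable_compose[OF measurable_fst Y_XY[OF that]] by (simp add: Y_def)
  have Ys: "(\<lambda>z. snd (snd z) i) \<in> N \<Otimes>\<^sub>M XY S U \<rightarrow>\<^sub>M borel" if "i \<in> U" for i S U and N :: "'n measure"
    using measurable_compose[OF measurable_snd Y_XY[OF that]] by (simp add: Y_def)
  have vs: "{z. f z \<in> D} \<in> sets N" if "f \<in> N \<rightarrow>\<^sub>M (borel \<Otimes>\<^sub>M borel) \<Otimes>\<^sub>M YM UNIV" "space N = UNIV"
    for N :: "'z measure" and f
    using measurable_sets[OF that(1) D] that(2) by (simp add: vimage_def)
  let ?P1 = "\<integral>\<^sup>+\<omega>. indicator D (T \<omega>, snd \<omega>) \<partial>M"
  let ?I2 = "\<integral>\<^sup>+\<omega>'. \<integral>\<^sup>+\<omega>. indicator D (T \<omega>, m (snd \<omega>) (snd \<omega>')) \<partial>M \<partial>M"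
  let ?I3 = "\<integral>\<^sup>+\<omega>'. \<integral>\<^sup>+\<omega>. \<integral>\<^sup>+\<omega>''. indicator D (T \<omega>, m (snd \<omega>'') (snd \<omega>')) \<partial>M \<partial>M \<partial>M"
  let ?P4 = "\<integral>\<^sup>+\<omega>. \<integral>\<^sup>+\<omega>'. indicator D (T \<omega>, snd \<omega>') \<partial>M \<partial>M"
  \<comment> \<open>Detach the late observations, then the early ones, and finally reattach the two.\<close>
  define C1 :: "((int, 'e, 'f) path \<times> (int, 'e, 'f) path) set" where "C1 = {z. (T (fst z), m (snd (fst z)) (snd (snd z))) \<in> D}"
  have C1: "C1 \<in> sets (XY {..b} {..<b} \<Otimes>\<^sub>M XY {b + int k..} {b + int k..})"
    unfolding C1_def
    by (rule vs) (use ab in \<open>auto simp: space_pair_measure intro!: measurable_Pair m_meas Yf Ys measurable_compose[OF measurable_fst T_XY]\<close>)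
  have s1: "?P1 \<le> ?I2 + \<beta> k" "?I2 \<le> ?P1 + \<beta> k"
    using up[OF C1] lo[OF C1] by (simp_all add: C1_def indicator_def mm)
  define C2 where "C2 \<omega>' = ({z. (T (snd z), m (snd (fst z)) (snd \<omega>')) \<in> D} :: ((int, 'e, 'f) path \<times> (int, 'e, 'f) path) set)" for \<omega>' :: "(int, 'e, 'f) path"
  have C2: "C2 \<omega>' \<in> sets (XY {..a - int k} {..<a - int k} \<Otimes>\<^sub>M XY {a - int k + int k..} {a - int k + int k..})" for \<omega>'
    unfolding C2_def
    by (rule vs) (use ab in \<open>auto simp: space_pair_measure intro!: measurable_Pair m_meas Yf measurable_compose[OF measurable_snd T_XY]\<close>)
  have s2: "(\<integral>\<^sup>+\<omega>. indicator D (T \<omega>, m (snd \<omega>) (snd \<omega>')) \<partial>M) \<le> (\<integral>\<^sup>+\<omega>. \<integral>\<^sup>+\<omega>''. indicator D (T \<omega>, m (snd \<omega>'') (snd \<omega>')) \<partial>M \<partial>M) + \<beta> k"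
    "(\<integral>\<^sup>+\<omega>. \<integral>\<^sup>+\<omega>''. indicator D (T \<omega>, m (snd \<omega>'') (snd \<omega>')) \<partial>M \<partial>M) \<le> (\<integral>\<^sup>+\<omega>. indicator D (T \<omega>, m (snd \<omega>) (snd \<omega>')) \<partial>M) + \<beta> k" for \<omega>' :: "(int, 'e, 'f) path"
    using up[OF C2] lo[OF C2] by (simp_all add: C2_def indicator_def)
  define C3 where "C3 t = ({z. (t, m (snd (fst z)) (snd (snd z))) \<in> D} :: ((int, 'e, 'f) path \<times> (int, 'e, 'f) path) set)" for t
  have C3: "C3 t \<in> sets (XY {..b} {..<b} \<Otimes>\<^sub>M XY {b + int k..} {b + int k..})" for t
    unfolding C3_def
    by (rule vs) (use ab in \<open>auto simp: space_pair_measure intro!: measurable_Pair m_meas Yf Ys\<close>)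
  have s3: "(\<integral>\<^sup>+\<omega>'. indicator D (t, snd \<omega>') \<partial>M) \<le> (\<integral>\<^sup>+\<omega>'. \<integral>\<^sup>+\<omega>''. indicator D (t, m (snd \<omega>'') (snd \<omega>')) \<partial>M \<partial>M) + \<beta> k"
    "(\<integral>\<^sup>+\<omega>'. \<integral>\<^sup>+\<omega>''. indicator D (t, m (snd \<omega>'') (snd \<omega>')) \<partial>M \<partial>M) \<le> (\<integral>\<^sup>+\<omega>'. indicator D (t, snd \<omega>') \<partial>M) + \<beta> k" for t
    using up[OF C3] lo[OF C3] by (simp_all add: C3_def indicator_def mm)
  have int_add: "(\<integral>\<^sup>+\<omega>. h \<omega> + c \<partial>M) = (\<integral>\<^sup>+\<omega>. h \<omega> \<partial>M) + c" if "h \<in> borel_measurable M" for h c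
    using that by (subst nn_integral_add) (auto simp: emeasure_space_1[simplified])
  have Ym[measurable]: "(\<lambda>z. snd (q z) i) \<in> N \<rightarrow>\<^sub>M borel" if "q \<in> N \<rightarrow>\<^sub>M M" for N :: "'z measure" and q and i
    using measurable_compose[OF that Y_measurable[of i]] by (simp add: Y_def)
  have "(\<lambda>w. indicator D (T (snd (fst w)), m (snd (snd w)) (snd (fst (fst w)))) :: ennreal) \<in> borel_measurable ((M \<Otimes>\<^sub>M M) \<Otimes>\<^sub>M M)"
    by (intro measurable_compose[OF _ borel_measurable_indicator[OF D]] measurable_Pair m_meas Ym measurable_compose[OF _ Tm]) measurable
  then have H: "(\<lambda>w. \<integral>\<^sup>+\<omega>''. indicator D (T (snd w), m (snd \<omega>'') (snd (fst w))) \<partial>M) \<in> borel_measurable (M \<Otimes>\<^sub>M M)"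
    using borel_measurable_nn_integral[of "\<lambda>w \<omega>''. indicator D (T (snd w), m (snd \<omega>'') (snd (fst w)))" "M \<Otimes>\<^sub>M M"]
    by (simp add: case_prod_beta')
  have H1: "(\<lambda>\<omega>'. \<integral>\<^sup>+\<omega>. \<integral>\<^sup>+\<omega>''. indicator D (T \<omega>, m (snd \<omega>'') (snd \<omega>')) \<partial>M \<partial>M) \<in> borel_measurable M"
    using borel_measurable_nn_integral[of "\<lambda>\<omega>' \<omega>. \<integral>\<^sup>+\<omega>''. indicator D (T \<omega>, m (snd \<omega>'') (snd \<omega>')) \<partial>M" M] H
    by (simp add: case_prod_beta')
  have "(\<lambda>w. (\<lambda>w. \<integral>\<^sup>+\<omega>''. indicator D (T (snd w), m (snd \<omega>'') (snd (fst w))) \<partial>M) (snd w, fst w)) \<in> borel_measurable (M \<Otimes>\<^sub>M M)"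
    by (rule measurable_compose[OF _ H]) measurable
  then have H2: "(\<lambda>\<omega>. \<integral>\<^sup>+\<omega>'. \<integral>\<^sup>+\<omega>''. indicator D (T \<omega>, m (snd \<omega>'') (snd \<omega>')) \<partial>M \<partial>M) \<in> borel_measurable M"
    using borel_measurable_nn_integral[of "\<lambda>\<omega> \<omega>'. \<integral>\<^sup>+\<omega>''. indicator D (T \<omega>, m (snd \<omega>'') (snd \<omega>')) \<partial>M" M]
    by (simp add: case_prod_beta')
  \<comment> \<open>The states become the outermost integral, so that the last comparison can be
    made with the states frozen.\<close>
  have I3: "?I3 = (\<integral>\<^sup>+\<omega>. \<integral>\<^sup>+\<omega>'. \<integral>\<^sup>+\<omega>''. indicator D (T \<omega>, m (snd \<omega>'') (snd \<omega>')) \<partial>M \<partial>M \<partial>M)"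
    using MM.Fubini'[of "\<lambda>\<omega>' \<omega>. \<integral>\<^sup>+\<omega>''. indicator D (T \<omega>, m (snd \<omega>'') (snd \<omega>')) \<partial>M"] H
    by (simp add: case_prod_beta')
  have "(\<lambda>w. indicator D (T (snd w), m (snd (snd w)) (snd (fst w))) :: ennreal) \<in> borel_measurable (M \<Otimes>\<^sub>M M)"
    by (intro measurable_compose[OF _ borel_measurable_indicator[OF D]] measurable_Pair m_meas Ym measurable_compose[OF _ Tm]) measurable
  then have H3: "(\<lambda>\<omega>'. \<integral>\<^sup>+\<omega>. indicator D (T \<omega>, m (snd \<omega>) (snd \<omega>')) \<partial>M) \<in> borel_measurable M"
    using borel_measurable_nn_integral[of "\<lambda>\<omega>' \<omega>. indicator D (T \<omega>, m (snd \<omega>) (snd \<omega>'))" M]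
    by (simp add: case_prod_beta')
  have H4: "(\<lambda>\<omega>. \<integral>\<^sup>+\<omega>'. indicator D (T \<omega>, snd \<omega>') \<partial>M) \<in> borel_measurable M"
    by measurable
  have i2: "?I2 \<le> ?I3 + \<beta> k" "?I3 \<le> ?I2 + \<beta> k"
    unfolding int_add[OF H1, symmetric] int_add[OF H3, symmetric] by (intro nn_integral_mono s2)+
  have i3: "?P4 \<le> ?I3 + \<beta> k" "?I3 \<le> ?P4 + \<beta> k"
    unfolding I3 int_add[OF H2, symmetric] int_add[OF H4, symmetric] by (intro nn_integral_mono s3)+
  have "?P1 \<le> ?P4 + (\<beta> k + \<beta> k + \<beta> k)"
  proof -
    have "?P1 \<le> ?I2 + \<beta> k" by (rule s1)
    also have "\<dots> \<le> (?I3 + \<beta> k) + \<beta> k" by (intro add_right_mono i2)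
    also have "\<dots> \<le> ((?P4 + \<beta> k) + \<beta> k) + \<beta> k" by (intro add_right_mono i3)
    finally show ?thesis by (simp add: add.assoc)
  qed
  moreover have "?P4 \<le> ?P1 + (\<beta> k + \<beta> k + \<beta> k)"
  proof -
    have "?P4 \<le> ?I3 + \<beta> k" by (rule i3)
    also have "\<dots> \<le> (?I2 + \<beta> k) + \<beta> k" by (intro add_right_mono i2)
    also have "\<dots> \<le> ((?P1 + \<beta> k) + \<beta> k) + \<beta> k" by (intro add_right_mono s1)
    finally show ?thesis by (simp add: add.assoc)
  qed
  ultimately show ?thesis unfolding T_def by blast
qed

text \<open>The closeness bound is two-sided and both laws keep their null sets under resampling, so
  \<open>null_sets_transfer\<close> works in both directions. For each \<open>k\<close> the ignored
  block is finite, while the bound for sets ignoring it tends to 0.\<close>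

lemma obs_law_null_iff:
  assumes ab: "a \<le> b" and D: "D \<in> sets ((borel \<Otimes>\<^sub>M borel) \<Otimes>\<^sub>M YM UNIV)"
  shows "(AE \<omega> in M. ((X a \<omega>, X b \<omega>), snd \<omega>) \<notin> D) \<longleftrightarrow> (AE \<omega> in M. AE \<omega>' in M. ((X a \<omega>, X b \<omega>), snd \<omega>') \<notin> D)"
proof -
  let ?N = "(borel \<Otimes>\<^sub>M borel) \<Otimes>\<^sub>M YM UNIV :: (('e \<times> 'e) \<times> (int \<Rightarrow> 'f)) measure"
  let ?T = "\<lambda>\<omega> :: (int, 'e, 'f) path. (X a \<omega>, X b \<omega>)"
  define \<mu> where "\<mu> = distr M ?N (\<lambda>\<omega>. (?T \<omega>, snd \<omega>))"
  define \<nu> where "\<nu> = distr (M \<Otimes>\<^sub>M M) ?N (\<lambda>z. (?T (fst z), snd (snd z)))"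
  have T1: "(\<lambda>\<omega>. (?T \<omega>, snd \<omega>)) \<in> M \<rightarrow>\<^sub>M ?N" by measurable
  have T2: "(\<lambda>z. (?T (fst z), snd (snd z))) \<in> M \<Otimes>\<^sub>M M \<rightarrow>\<^sub>M ?N"
    by (intro measurable_Pair measurable_compose[OF measurable_snd snd_measurable]) measurable
  have i\<mu>: "(\<integral>\<^sup>+z. f z \<partial>\<mu>) = (\<integral>\<^sup>+\<omega>. f (?T \<omega>, snd \<omega>) \<partial>M)" if "f \<in> borel_measurable ?N" for f
    unfolding \<mu>_def by (rule nn_integral_distr[OF T1]) (simp add: that)
  have i\<nu>: "(\<integral>\<^sup>+z. f z \<partial>\<nu>) = (\<integral>\<^sup>+\<omega>. \<integral>\<^sup>+\<omega>'. f (?T \<omega>, snd \<omega>') \<partial>M \<partial>M)" if "f \<in> borel_measurable ?N" for f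
    unfolding \<nu>_def using measurable_compose[OF T2 that]
    by (subst nn_integral_distr[OF T2]) (simp_all add: that nn_integral_fst[symmetric])
  have sf: "sigma_finite_measure \<phi>" ..
  have inner: "(\<lambda>\<omega>. \<integral>\<^sup>+\<omega>'. f (?T \<omega>, snd \<omega>') \<partial>M) \<in> borel_measurable M" if "f \<in> borel_measurable ?N" for f
    using measurable_compose[OF T2 that] by (intro borel_measurable_nn_integral) (simp add: case_prod_beta')
  have n\<mu>: "(\<integral>\<^sup>+z. f z \<partial>\<mu>) = 0 \<longleftrightarrow> (\<integral>\<^sup>+z. resample \<phi> j f z \<partial>\<mu>) = 0" if f: "f \<in> borel_measurable ?N" for f j
    unfolding i\<mu>[OF f] i\<mu>[OF resample_measurable[OF sf sets_\<phi> f]]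
    by (rule resample_null[OF _ _ f]) auto
  \<comment> \<open>Under the product law the states are frozen at \<open>t\<close>, and
    \<open>resample_null\<close> is applied with a constant map.\<close>
  have n\<nu>: "(\<integral>\<^sup>+z. f z \<partial>\<nu>) = 0 \<longleftrightarrow> (\<integral>\<^sup>+z. resample \<phi> j f z \<partial>\<nu>) = 0" if f: "f \<in> borel_measurable ?N" for f j
  proof -
    note r = resample_measurable[OF sf sets_\<phi> f, of j]
    have "(\<integral>\<^sup>+\<omega>'. f (t, snd \<omega>') \<partial>M) = 0 \<longleftrightarrow> (\<integral>\<^sup>+\<omega>'. resample \<phi> j f (t, snd \<omega>') \<partial>M) = 0" for t
      by (rule resample_null[OF _ _ f]) (auto simp: space_pair_measure)
    then show ?thesis
      unfolding i\<nu>[OF f] i\<nu>[OF r] nn_integral_0_iff_AE[OF inner[OF f]] nn_integral_0_iff_AE[OF inner[OF r]] by simp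
  qed
  obtain \<beta> where rate: "decoupling_rate \<beta>" using decoupling_rate_exists by blast
  note close = obs_law_close[OF rate ab]
  have \<beta>: "(\<lambda>k. \<beta> k + \<beta> k + \<beta> k) \<longlonglongrightarrow> 0"
    using tendsto_add[OF tendsto_add] decoupling_rateD(1)[OF rate] by fastforce
  have s: "sets \<mu> = sets ?N" "sets \<nu> = sets ?N" by (simp_all add: \<mu>_def \<nu>_def)
  let ?J = "\<lambda>k::nat. [a - int k..b + int k - 1]"
  have e\<mu>: "emeasure \<mu> G = (\<integral>\<^sup>+\<omega>. indicator G (?T \<omega>, snd \<omega>) \<partial>M)" if "G \<in> sets ?N" for G
    using i\<mu>[of "indicator G"] that s by simp
  have e\<nu>: "emeasure \<nu> G = (\<integral>\<^sup>+\<omega>. \<integral>\<^sup>+\<omega>'. indicator G (?T \<omega>, snd \<omega>') \<partial>M \<partial>M)" if "G \<in> sets ?N" for G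
    using i\<nu>[of "indicator G"] that s by simp
  have 1: "D \<in> null_sets \<nu>" if "D \<in> null_sets \<mu>"
    by (rule null_sets_transfer[OF \<phi>_prob sets_\<phi> s n\<mu> n\<nu> \<beta> _ that, where J="?J"])
       (use close in \<open>auto simp: e\<mu> e\<nu>\<close>)
  have 2: "D \<in> null_sets \<mu>" if "D \<in> null_sets \<nu>"
    by (rule null_sets_transfer[OF \<phi>_prob sets_\<phi> s(2,1) n\<nu> n\<mu> \<beta> _ that, where J="?J"])
       (use close in \<open>auto simp: e\<mu> e\<nu>\<close>)
  have iD: "(indicator D :: _ \<Rightarrow> ennreal) \<in> borel_measurable ?N" using D by simp
  have m1: "(\<lambda>\<omega>. indicator D (?T \<omega>, snd \<omega>) :: ennreal) \<in> borel_measurable M" by (rule measurable_compose[OF T1 iD])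
  have m2: "(\<lambda>\<omega>'. indicator D (t, snd \<omega>') :: ennreal) \<in> borel_measurable M" for t
    by (rule measurable_compose[OF _ iD]) (auto intro!: measurable_Pair simp: space_pair_measure)
  have "D \<in> null_sets \<mu> \<longleftrightarrow> (AE \<omega> in M. ((X a \<omega>, X b \<omega>), snd \<omega>) \<notin> D)"
    using D by (simp add: null_sets_def s e\<mu> nn_integral_0_iff_AE[OF m1] indicator_eq_0_iff)
  moreover have "D \<in> null_sets \<nu> \<longleftrightarrow> (AE \<omega> in M. AE \<omega>' in M. ((X a \<omega>, X b \<omega>), snd \<omega>') \<notin> D)"
    using D by (simp add: null_sets_def s e\<nu> nn_integral_0_iff_AE[OF inner[OF iD]] nn_integral_0_iff_AE[OF m2] indicator_eq_0_iff)
  ultimately show ?thesis using 1 2 by blast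
qed

end

section \<open>Exchange of intersection and supremum\<close>

text \<open>A limit superior, so that its complement is eventual agreement, a relation that can be
  composed through an intermediate state.\<close>

definition disagree :: "(nat \<Rightarrow> ('e \<times> 'y) set) \<Rightarrow> (nat \<Rightarrow> ('e \<times> 'y) set) \<Rightarrow> (('e \<times> 'e) \<times> 'y) set" where
  "disagree H H' = {w. \<forall>m. \<exists>j\<ge>m. ((fst (fst w), snd w) \<in> H j) \<noteq> ((snd (fst w), snd w) \<in> H' j)}"

lemma disagree_sets:
  assumes H: "\<And>j. H j \<in> sets (N \<Otimes>\<^sub>M L)" "\<And>j. H' j \<in> sets (N \<Otimes>\<^sub>M L)" and sp: "space N = UNIV" "space L = UNIV"
  shows "disagree H H' \<in> sets ((N \<Otimes>\<^sub>M N) \<Otimes>\<^sub>M L)"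
proof -
  note [measurable] = H
  have "disagree H H' = {w\<in>space ((N \<Otimes>\<^sub>M N) \<Otimes>\<^sub>M L). \<forall>m. \<exists>j. m \<le> j \<and> ((fst (fst w), snd w) \<in> H j) \<noteq> ((snd (fst w), snd w) \<in> H' j)}"
    unfolding disagree_def using sp by (auto simp: space_pair_measure)
  also have "\<dots> \<in> sets ((N \<Otimes>\<^sub>M N) \<Otimes>\<^sub>M L)" by measurable
  finally show ?thesis .
qed

lemma disagree_triangle:
  assumes "((x, x'), y) \<in> disagree H H" shows "((x, z), y) \<in> disagree H H' \<or> ((x', z), y) \<in> disagree H H'"
proof (rule ccontr)
  assume "\<not> ?thesis"
  then obtain m1 m2 where "\<forall>j\<ge>m1. ((x, y) \<in> H j) = ((z, y) \<in> H' j)" "\<forall>j\<ge>m2. ((x', y) \<in> H j) = ((z, y) \<in> H' j)"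
    unfolding disagree_def by auto
  then have "\<forall>j\<ge>max m1 m2. ((x, y) \<in> H j) = ((x', y) \<in> H j)" by simp
  with assms show False unfolding disagree_def by fastforce
qed

context nondegenerate_hmm_measure
begin

text \<open>Swapping the two states reduces the reversed order of times to the ordered one; this is
  used to compare time 0 with negative times.\<close>

lemma obs_law_null_iff':
  assumes D: "D \<in> sets ((borel \<Otimes>\<^sub>M borel) \<Otimes>\<^sub>M YM UNIV)"
  shows "(AE \<omega> in M. ((X a \<omega>, X b \<omega>), snd \<omega>) \<notin> D) \<longleftrightarrow> (AE \<omega> in M. AE \<omega>' in M. ((X a \<omega>, X b \<omega>), snd \<omega>') \<notin> D)"
proof (cases "a \<le> b")
  case False
  define D' where "D' = {w. ((snd (fst w), fst (fst w)), snd w) \<in> D}"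
  have "(\<lambda>w. ((snd (fst w), fst (fst w)), snd w)) \<in> (borel \<Otimes>\<^sub>M borel) \<Otimes>\<^sub>M YM UNIV \<rightarrow>\<^sub>M (borel \<Otimes>\<^sub>M borel) \<Otimes>\<^sub>M YM UNIV"
    by measurable
  from measurable_sets[OF this D] have "D' \<in> sets ((borel \<Otimes>\<^sub>M borel) \<Otimes>\<^sub>M YM UNIV)"
    by (simp add: D'_def vimage_def space_pair_measure)
  from obs_law_null_iff[OF _ this, of b a] False show ?thesis by (simp add: D'_def)
qed (rule obs_law_null_iff[OF _ D])

text \<open>The same mixing bound serves both directions: for \<open>s = -1\<close> the state at
  time \<open>- int n\<close> is taken as the past and the state at time 0 as the future.\<close>

lemma product_le_joint:
  assumes s: "s = 1 \<or> s = (-1::int)"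
  obtains \<beta> :: "nat \<Rightarrow> ennreal" where "\<beta> \<longlonglongrightarrow> 0"
    "\<And>n E. E \<in> sets (borel \<Otimes>\<^sub>M borel) \<Longrightarrow>
      (\<integral>\<^sup>+x. \<integral>\<^sup>+x'. indicator E (x, x') \<partial>\<pi> \<partial>\<pi>) \<le> (\<integral>\<^sup>+\<omega>. indicator E (X 0 \<omega>, X (s * int n) \<omega>) \<partial>M) + \<beta> n"
proof -
  obtain \<beta> where rate: "decoupling_rate \<beta>" using decoupling_rate_exists by blast
  note \<beta> = decoupling_rateD(1)[OF rate] and up = decoupling_rateD(2)[OF rate] and lo = decoupling_rateD(3)[OF rate]
  have s\<pi>\<pi>: "sets (\<pi> \<Otimes>\<^sub>M \<pi>) = sets (borel \<Otimes>\<^sub>M borel)" by (rule sets_pair_measure_cong) auto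
  have main: "(\<integral>\<^sup>+\<omega>'. \<integral>\<^sup>+\<omega>. h (X a \<omega>, X b \<omega>') \<partial>M \<partial>M) = (\<integral>\<^sup>+x'. \<integral>\<^sup>+x. h (x, x') \<partial>\<pi> \<partial>\<pi>)"
    if h[measurable]: "h \<in> borel_measurable (borel \<Otimes>\<^sub>M borel)" for h :: "'e \<times> 'e \<Rightarrow> ennreal" and a b
  proof -
    have h': "(\<lambda>x'. \<integral>\<^sup>+x. h (x, x') \<partial>\<pi>) \<in> borel_measurable borel"
      by (rule \<pi>.borel_measurable_nn_integral) (simp add: case_prod_beta' cong: measurable_cong_sets sets_pair_measure_cong)
    have "(\<integral>\<^sup>+\<omega>'. \<integral>\<^sup>+\<omega>. h (X a \<omega>, X b \<omega>') \<partial>M \<partial>M) = (\<integral>\<^sup>+\<omega>'. \<integral>\<^sup>+x. h (x, X b \<omega>') \<partial>distr M borel (X a) \<partial>M)"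
      by (intro nn_integral_cong, subst nn_integral_distr) auto
    also have "\<dots> = (\<integral>\<^sup>+\<omega>'. (\<lambda>x'. \<integral>\<^sup>+x. h (x, x') \<partial>\<pi>) (X b \<omega>') \<partial>M)" by (simp add: X_distr)
    also have "\<dots> = (\<integral>\<^sup>+x'. \<integral>\<^sup>+x. h (x, x') \<partial>\<pi> \<partial>distr M borel (X b))"
      using h' by (subst nn_integral_distr) auto
    finally show ?thesis by (simp add: X_distr)
  qed
  have "(\<integral>\<^sup>+x. \<integral>\<^sup>+x'. indicator E (x, x') \<partial>\<pi> \<partial>\<pi>) \<le> (\<integral>\<^sup>+\<omega>. indicator E (X 0 \<omega>, X (s * int n) \<omega>) \<partial>M) + \<beta> n"
    if E[measurable]: "E \<in> sets (borel \<Otimes>\<^sub>M borel)" for n E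
    using s
  proof
    assume s: "s = 1"
    define C where "C = {z :: (int, 'e, 'f) path \<times> (int, 'e, 'f) path. (X 0 (fst z), X (int n) (snd z)) \<in> E}"
    have "(\<lambda>z. (X 0 (fst z), X (int n) (snd z))) \<in> XY {..0::int} {..<0} \<Otimes>\<^sub>M XY {0 + int n..} {0 + int n..} \<rightarrow>\<^sub>M borel \<Otimes>\<^sub>M borel"
      by (intro measurable_Pair measurable_compose[OF measurable_fst X_XY] measurable_compose[OF measurable_snd X_XY]) auto
    from measurable_sets[OF this E] have C: "C \<in> sets (XY {..0} {..<0} \<Otimes>\<^sub>M XY {0 + int n..} {0 + int n..})"
      by (simp add: C_def vimage_def space_pair_measure)
    have "(\<integral>\<^sup>+x. \<integral>\<^sup>+x'. indicator E (x, x') \<partial>\<pi> \<partial>\<pi>) = (\<integral>\<^sup>+x'. \<integral>\<^sup>+x. indicator E (x, x') \<partial>\<pi> \<partial>\<pi>)"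
      by (rule \<pi>\<pi>.Fubini'[symmetric]) (simp add: case_prod_beta' s\<pi>\<pi> cong: measurable_cong_sets)
    then show ?thesis
      using lo[OF C] main[of "indicator E" 0 "int n"] by (simp add: C_def indicator_def s)
  next
    assume s: "s = -1"
    define C where "C = {z :: (int, 'e, 'f) path \<times> (int, 'e, 'f) path. (X 0 (snd z), X (- int n) (fst z)) \<in> E}"
    have "(\<lambda>z. (X 0 (snd z), X (- int n) (fst z))) \<in> XY {..- int n} {..<- int n} \<Otimes>\<^sub>M XY {- int n + int n..} {- int n + int n..} \<rightarrow>\<^sub>M borel \<Otimes>\<^sub>M borel"
      by (intro measurable_Pair measurable_compose[OF measurable_fst X_XY] measurable_compose[OF measurable_snd X_XY]) auto
    from measurable_sets[OF this E] have C: "C \<in> sets (XY {..- int n} {..<- int n} \<Otimes>\<^sub>M XY {- int n + int n..} {- int n + int n..})"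
      by (simp add: C_def vimage_def space_pair_measure)
    have "(\<lambda>w. (snd w, fst w)) \<in> borel \<Otimes>\<^sub>M borel \<rightarrow>\<^sub>M borel \<Otimes>\<^sub>M (borel :: 'e measure)" by measurable
    then have m: "(\<lambda>w. indicator E (snd w, fst w) :: ennreal) \<in> borel_measurable (borel \<Otimes>\<^sub>M borel)"
      by (rule measurable_compose) measurable
    show ?thesis
      using lo[OF C] main[OF m, of "- int n" 0] by (simp add: C_def indicator_def s)
  qed
  then show ?thesis using \<beta> that by blast
qed

lemma shift_measure:
  assumes "A \<in> sets M" shows "measure M (shift N -` A) = measure M A"
  using measure_distr[OF shift_measurable assms, of N] shift_invariant[of N] by simp

text \<open>The sign \<open>s\<close> is the direction of time. Apart from measurability,
  \<open>A\<close> enters only through its approximation by a single state and the observations, so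
  one argument covers the future and the past tail.\<close>

lemma tail_mod_null:
  assumes s: "s = 1 \<or> s = (-1::int)" and A: "A \<in> sets M"
    and approx: "\<And>e. 0 < (e::real) \<Longrightarrow> \<exists>N0. \<forall>N::nat\<ge>N0. \<exists>D\<in>sets (borel \<Otimes>\<^sub>M YM T).
      measure M (sym_diff A {\<omega>. (X (s * int N) \<omega>, snd \<omega>) \<in> D}) < e"
  shows "\<exists>B\<in>sets (XY {} T). sym_diff A B \<in> null_sets M"
proof -
  have "\<forall>j::nat. \<exists>N0. \<forall>N\<ge>N0. \<exists>D\<in>sets (borel \<Otimes>\<^sub>M YM T). measure M (sym_diff A {\<omega>. (X (s * int N) \<omega>, snd \<omega>) \<in> D}) < (1/2)^j"
    using approx by simp
  then obtain N0 where N0: "\<forall>j. \<forall>N\<ge>N0 j. \<exists>D\<in>sets (borel \<Otimes>\<^sub>M YM T). measure M (sym_diff A {\<omega>. (X (s * int N) \<omega>, snd \<omega>) \<in> D}) < (1/2)^j"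
    by (rule choice[THEN exE])
  \<comment> \<open>For every \<open>j\<close> and \<open>n\<close> a set is chosen for time
    \<open>N0 j + n\<close>. In the comparisons \<open>n\<close> stays fixed while \<open>j\<close>
    grows, so the error 2^-j does not depend on \<open>n\<close>.\<close>
  define Q where "Q j n D \<longleftrightarrow> D \<in> sets (borel \<Otimes>\<^sub>M YM T) \<and>
    measure M (sym_diff A {\<omega>. (X (s * int (N0 j + n)) \<omega>, snd \<omega>) \<in> D}) < (1/2)^j" for j n D
  have "\<exists>D. Q j n D" for j n
    using N0[rule_format, of j "N0 j + n"] unfolding Q_def by auto
  then obtain D where Q: "\<And>j n. Q j n (D j n)" by metis
  have D[measurable]: "\<And>j n. D j n \<in> sets (borel \<Otimes>\<^sub>M YM T)"
    and D': "\<And>j n. measure M (sym_diff A {\<omega>. (X (s * int (N0 j + n)) \<omega>, snd \<omega>) \<in> D j n}) < (1/2)^j"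
    using Q unfolding Q_def by auto
  define sh where "sh j = s * int (N0 j)" for j
  have YT: "(\<lambda>z. (fst z, \<lambda>i. snd z (i - c))) \<in> borel \<Otimes>\<^sub>M YM UNIV \<rightarrow>\<^sub>M borel \<Otimes>\<^sub>M YM T" for c
    by (intro measurable_Pair measurable_into_YM measurable_fst measurable_compose[OF measurable_snd YM_component]) auto
  \<comment> \<open>Translation by \<open>sh j\<close> moves the reading time from
    \<open>s * int (N0 j + n)\<close> to \<open>s * int n\<close>, which is free of
    \<open>j\<close>. The observation times in \<open>T\<close> move as well, so
    \<open>H n j\<close> has to be a set over all observations.\<close>
  define H where "H n j = {z. (fst z, \<lambda>i. snd z (i - sh j)) \<in> D j n}" for n j
  have H[measurable]: "H n j \<in> sets (borel \<Otimes>\<^sub>M YM UNIV)" for n j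
    using measurable_sets[OF YT D, of "sh j" j n] by (simp add: H_def vimage_def space_pair_measure)
  define E where "E n j = {\<omega>. (X (s * int n) \<omega>, snd \<omega>) \<in> H n j}" for n j
  define E' where "E' n j = {\<omega>. (X (s * int (N0 j + n)) \<omega>, snd \<omega>) \<in> D j n}" for n j
  have E_sh: "E' n j = shift (sh j) -` E n j" for n j
  proof -
    have "X (s * int (N0 j + n)) \<omega> = X (s * int n) (shift (sh j) \<omega>)" for \<omega> :: "(int, 'e, 'f) path"
      by (simp add: sh_def distrib_left add.commute)
    moreover have "(\<lambda>i. snd (shift (sh j) \<omega>) (i - sh j)) = snd \<omega>" for \<omega> :: "(int, 'e, 'f) path"
      by (simp add: shift_def)
    ultimately show ?thesis by (simp add: E'_def E_def H_def vimage_def)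
  qed
  have ZM: "(\<lambda>\<omega>. (X i \<omega>, snd \<omega>)) \<in> M \<rightarrow>\<^sub>M borel \<Otimes>\<^sub>M YM U" for i U by measurable
  have E[measurable]: "E n j \<in> sets M" for n j
    using measurable_sets[OF ZM H] by (simp add: E_def vimage_def)
  have E'[measurable]: "E' n j \<in> sets M" for n j
    using measurable_sets[OF ZM D] by (simp add: E'_def vimage_def)
  \<comment> \<open>\<open>E 0 j\<close> and \<open>E n j\<close> themselves need not be near
    \<open>A\<close>. Their shifts both lie within 2^-j of \<open>A\<close>, and stationarity
    carries the distance between the shifts back to the events.\<close>
  have close: "measure M (sym_diff (E 0 j) (E n j)) \<le> 2 * (1/2)^j" for n j
  proof -
    have "measure M (sym_diff (E 0 j) (E n j)) = measure M (shift (sh j) -` sym_diff (E 0 j) (E n j))"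
      by (rule shift_measure[symmetric]) measurable
    also have "\<dots> = measure M (sym_diff (E' 0 j) (E' n j))"
      by (simp add: E_sh vimage_Diff vimage_Un)
    also have "\<dots> \<le> measure M (sym_diff (E' 0 j) A) + measure M (sym_diff A (E' n j))"
      by (rule measure_sym_diff_triangle[OF finM]) (use A in auto)
    also have "\<dots> \<le> (1/2)^j + (1/2)^j"
      using D'[of j 0] D'[of j n] unfolding E'_def by (intro add_mono less_imp_le) (simp_all add: Un_commute)
    finally show ?thesis by simp
  qed
  let ?BY = "(borel \<Otimes>\<^sub>M borel) \<Otimes>\<^sub>M YM UNIV :: (('e \<times> 'e) \<times> (int \<Rightarrow> 'f)) measure"
  have dis[measurable]: "disagree (H 0) (H n) \<in> sets ?BY" for n
    by (rule disagree_sets) auto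
  have sec[measurable]: "{z. (z, y) \<in> disagree (H 0) (H n)} \<in> sets (borel \<Otimes>\<^sub>M borel)" for n y
    using sets_Pair2[OF dis, of y n] by (simp add: vimage_def)
  have null: "AE \<omega> in M. ((X 0 \<omega>, X (s * int n) \<omega>), snd \<omega>) \<notin> disagree (H 0) (H n)" for n
  proof -
    have "AE \<omega> in M. \<forall>\<^sub>F j in sequentially. \<omega> \<in> space M - sym_diff (E 0 j) (E n j)"
    proof (rule borel_cantelli_AE1)
      show "summable (\<lambda>j. measure M (sym_diff (E 0 j) (E n j)))"
        using close by (intro summable_comparison_test'[OF summable_mult[OF summable_geometric[of "1/2::real"]], of 0]) auto
    qed (auto simp: emeasure_eq_measure)
    then show ?thesis
    proof eventually_elim
      case (elim \<omega>)
      then obtain m where "\<forall>j\<ge>m. \<omega> \<notin> sym_diff (E 0 j) (E n j)" by (auto simp: eventually_sequentially)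
      then show ?case unfolding disagree_def E_def by auto
    qed
  qed
  obtain \<beta> :: "nat \<Rightarrow> ennreal" where \<beta>: "\<beta> \<longlonglongrightarrow> 0"
    and le: "\<And>n E. E \<in> sets (borel \<Otimes>\<^sub>M borel) \<Longrightarrow>
      (\<integral>\<^sup>+x. \<integral>\<^sup>+x'. indicator E (x, x') \<partial>\<pi> \<partial>\<pi>) \<le> (\<integral>\<^sup>+\<omega>. indicator E (X 0 \<omega>, X (s * int n) \<omega>) \<partial>M) + \<beta> n"
    by (rule product_le_joint[OF s], rule that)
  define b where "b n y = (\<integral>\<^sup>+x. \<integral>\<^sup>+x'. indicator (disagree (H 0) (H n)) ((x, x'), y) \<partial>\<pi> \<partial>\<pi>)" for n y
  \<comment> \<open>By the equivalence of null sets, for almost every observation path the states at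
    times 0 and \<open>s * int n\<close> eventually agree under their unconditional joint law.
    Mixing then bounds the disagreement of two independent states by
    \<open>\<beta> n\<close>.\<close>
  have b_le: "AE \<omega>' in M. b n (snd \<omega>') \<le> \<beta> n" for n
  proof -
    have P: "{w\<in>space (M \<Otimes>\<^sub>M M). ((X 0 (fst w), X (s * int n) (fst w)), snd (snd w)) \<notin> disagree (H 0) (H n)} \<in> sets (M \<Otimes>\<^sub>M M)"
      by measurable
    have "AE \<omega> in M. AE \<omega>' in M. ((X 0 \<omega>, X (s * int n) \<omega>), snd \<omega>') \<notin> disagree (H 0) (H n)"
      using null[of n] obs_law_null_iff'[OF dis] by simp
    then have "AE \<omega>' in M. AE \<omega> in M. ((X 0 \<omega>, X (s * int n) \<omega>), snd \<omega>') \<notin> disagree (H 0) (H n)"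
      by (subst MM.AE_commute[symmetric]) (use P in simp_all)
    then show ?thesis
    proof eventually_elim
      case (elim \<omega>')
      let ?S = "{z. (z, snd \<omega>') \<in> disagree (H 0) (H n)}"
      have "(\<integral>\<^sup>+\<omega>. indicator ?S (X 0 \<omega>, X (s * int n) \<omega>) \<partial>M) = (\<integral>\<^sup>+\<omega>. 0 \<partial>M)"
        by (rule nn_integral_cong_AE) (use elim in eventually_elim, auto)
      then show ?case using le[OF sec[of "snd \<omega>'" n], of n] by (simp add: b_def indicator_def)
    qed
  qed
  define q where "q y = (\<integral>\<^sup>+x. \<integral>\<^sup>+x'. indicator (disagree (H 0) (H 0)) ((x, x'), y) \<partial>\<pi> \<partial>\<pi>)" for y
  have sc: "(\<lambda>(x, x'). indicator (disagree (H 0) (H n)) ((x, x'), y) :: ennreal) \<in> borel_measurable (\<pi> \<Otimes>\<^sub>M \<pi>)" for n y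
  proof -
    have "(\<lambda>w. indicator (disagree (H 0) (H n)) ((fst w, snd w), y) :: ennreal) \<in> borel_measurable (borel \<Otimes>\<^sub>M borel)"
      by measurable
    then show ?thesis by (simp add: case_prod_beta' cong: measurable_cong_sets sets_pair_measure_cong)
  qed
  have sc2: "(\<lambda>x'. indicator (disagree (H 0) (H n)) ((x, x'), y) :: ennreal) \<in> borel_measurable \<pi>" for n x y
    using measurable_compose[OF measurable_Pair1'[of x \<pi> \<pi>] sc[of n y]] by simp
  have sc3: "(\<lambda>x. \<integral>\<^sup>+x'. indicator (disagree (H 0) (H n)) ((x, x'), y) \<partial>\<pi>) \<in> borel_measurable \<pi>" for n y
    by (rule \<pi>.borel_measurable_nn_integral[OF sc])
  \<comment> \<open>Two initial states are compared through a common state at time \<open>s * n\<close>.\<close>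
  have q_le: "q y \<le> 2 * b n y" for n y
  proof -
    let ?f = "\<lambda>x. \<integral>\<^sup>+z. indicator (disagree (H 0) (H n)) ((x, z), y) \<partial>\<pi>"
    have pw: "indicator (disagree (H 0) (H 0)) ((x, x'), y) \<le> ?f x + ?f x'" for x x'
    proof -
      have "(indicator (disagree (H 0) (H 0)) ((x, x'), y) :: ennreal) = (\<integral>\<^sup>+z. indicator (disagree (H 0) (H 0)) ((x, x'), y) \<partial>\<pi>)"
        using \<pi>.emeasure_space_1 by simp
      also have "\<dots> \<le> (\<integral>\<^sup>+z. indicator (disagree (H 0) (H n)) ((x, z), y) + indicator (disagree (H 0) (H n)) ((x', z), y) \<partial>\<pi>)"
        by (intro nn_integral_mono) (use disagree_triangle[of x x' y "H 0" _ "H n"] in \<open>auto split: split_indicator\<close>)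
      also have "\<dots> = ?f x + ?f x'" by (rule nn_integral_add[OF sc2 sc2])
      finally show ?thesis .
    qed
    have "q y \<le> (\<integral>\<^sup>+x. \<integral>\<^sup>+x'. ?f x + ?f x' \<partial>\<pi> \<partial>\<pi>)"
      unfolding q_def by (intro nn_integral_mono pw)
    also have "\<dots> = (\<integral>\<^sup>+x. ?f x + b n y \<partial>\<pi>)"
      using \<pi>.emeasure_space_1 by (intro nn_integral_cong, subst nn_integral_add) (auto simp: sc3 b_def)
    also have "\<dots> = b n y + b n y"
      using \<pi>.emeasure_space_1 by (subst nn_integral_add) (auto simp: sc3 b_def)
    finally show ?thesis by (simp add: mult_2)
  qed
  \<comment> \<open>\<open>q\<close> compares states at time 0 only and does not involve
    \<open>n\<close>, so letting \<open>n\<close> tend to infinity in the bound forces it to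
    vanish.\<close>
  have "AE \<omega>' in M. \<forall>n. b n (snd \<omega>') \<le> \<beta> n" using b_le by (simp add: AE_all_countable)
  then have q0: "AE \<omega>' in M. q (snd \<omega>') = 0"
  proof eventually_elim
    case (elim \<omega>')
    have "q (snd \<omega>') \<le> 2 * \<beta> n" for n
      using q_le[of "snd \<omega>'" n] elim by (meson mult_left_mono order_trans zero_le)
    moreover have "(\<lambda>n. 2 * \<beta> n) \<longlonglongrightarrow> 0"
      using ennreal_tendsto_cmult[OF _ \<beta>, of 2] by simp
    ultimately have "q (snd \<omega>') \<le> 0" by (intro LIMSEQ_le_const) auto
    then show ?case by simp
  qed
  \<comment> \<open>The proportion of states that put \<open>y\<close> into the set. If almost all
    states eventually agree, it comes close to 0 or 1, and the majority, with threshold 1/2, decides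
    membership from \<open>y\<close> alone.\<close>
  define hb where "hb j y = measure \<pi> {x. (x, y) \<in> H 0 j}" for j y
  have Hs[measurable]: "{x. (x, y) \<in> H 0 j} \<in> sets borel" for y j
    using sets_Pair2[OF H, of y 0 j] by (simp add: vimage_def)
  have hb_gen: "(\<lambda>y. measure \<pi> {x. (x, y) \<in> G}) \<in> borel_measurable (YM U)" if "G \<in> sets (borel \<Otimes>\<^sub>M YM U)" for G and U :: "int set"
  proof -
    have "(\<lambda>w. indicator G (snd w, fst w) :: ennreal) \<in> borel_measurable (YM U \<Otimes>\<^sub>M borel)"
    proof (rule measurable_compose[OF _ borel_measurable_indicator[OF that]])
      show "(\<lambda>w. (snd w, fst w)) \<in> YM U \<Otimes>\<^sub>M borel \<rightarrow>\<^sub>M borel \<Otimes>\<^sub>M YM U" by measurable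
    qed
    then have "(\<lambda>(y, x). indicator G (x, y) :: ennreal) \<in> borel_measurable (YM U \<Otimes>\<^sub>M \<pi>)"
      by (simp add: case_prod_beta' cong: measurable_cong_sets sets_pair_measure_cong)
    from \<pi>.borel_measurable_nn_integral[OF this]
    have "(\<lambda>y. \<integral>\<^sup>+x. indicator G (x, y) \<partial>\<pi>) \<in> borel_measurable (YM U)" .
    moreover have "(\<integral>\<^sup>+x. indicator G (x, y) \<partial>\<pi>) = emeasure \<pi> {x. (x, y) \<in> G}" for y
    proof -
      have "{x. (x, y) \<in> G} \<in> sets \<pi>" using sets_Pair2[OF that, of y] by (simp add: vimage_def)
      moreover have "(indicator G (x, y) :: ennreal) = indicator {x. (x, y) \<in> G} x" for x by (simp add: indicator_def)
      ultimately show ?thesis by simp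
    qed
    ultimately show ?thesis unfolding measure_def by simp
  qed
  have hb[measurable]: "hb j \<in> borel_measurable (YM UNIV)" for j
    unfolding hb_def[abs_def] by (rule hb_gen) measurable
  \<comment> \<open>The second state is a dummy. It brings the set into the form of
    \<open>obs_law_null_iff\<close>, which is applied below with both times equal to 0.\<close>
  define W where "W = {w :: ('e \<times> 'e) \<times> (int \<Rightarrow> 'f). \<forall>m. \<exists>j\<ge>m. ((fst (fst w), snd w) \<in> H 0 j) \<noteq> (1/2 < hb j (snd w))}"
  have W: "W \<in> sets ?BY"
  proof -
    have "W = {w\<in>space ?BY. \<forall>m. \<exists>j. m \<le> j \<and> ((fst (fst w), snd w) \<in> H 0 j) \<noteq> (1/2 < hb j (snd w))}"
      by (auto simp: W_def space_pair_measure)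
    also have "\<dots> \<in> sets ?BY" by measurable
    finally show ?thesis .
  qed
  have notW: "AE x in \<pi>. ((x, x0 x), y) \<notin> W" if "q y = 0" for y x0
  proof -
    have "AE x in \<pi>. (\<integral>\<^sup>+x'. indicator (disagree (H 0) (H 0)) ((x, x'), y) \<partial>\<pi>) = 0"
      using that unfolding q_def by (subst (asm) nn_integral_0_iff_AE[OF sc3])
    then show ?thesis
    proof eventually_elim
      case (elim x)
      then have ae: "AE x' in \<pi>. ((x, x'), y) \<notin> disagree (H 0) (H 0)"
        by (subst (asm) nn_integral_0_iff_AE[OF sc2]) (simp add: indicator_eq_0_iff)
      \<comment> \<open>With \<open>x\<close> fixed, averaging over \<open>x'\<close> turns eventual
        agreement with almost every \<open>x'\<close> into convergence of the proportion to the
        membership of \<open>x\<close>.\<close>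
      have "(\<lambda>j. \<integral>x'. indicator {x. (x, y) \<in> H 0 j} x' - indicator (H 0 j) (x, y) \<partial>\<pi>) \<longlonglongrightarrow> (\<integral>x'. (0::real) \<partial>\<pi>)"
      proof (rule integral_dominated_convergence[where w="\<lambda>_. 1"])
        show "AE x' in \<pi>. (\<lambda>j. indicator {x. (x, y) \<in> H 0 j} x' - indicator (H 0 j) (x, y) :: real) \<longlonglongrightarrow> 0"
          using ae
        proof eventually_elim
          case (elim x')
          then obtain m where "\<forall>j\<ge>m. ((x, y) \<in> H 0 j) = ((x', y) \<in> H 0 j)"
            unfolding disagree_def by auto
          then have "\<forall>\<^sub>F j in sequentially. indicator {x. (x, y) \<in> H 0 j} x' - indicator (H 0 j) (x, y) = (0::real)"
            unfolding eventually_sequentially by (intro exI[of _ m]) (auto simp: indicator_def)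
          then show ?case by (rule tendsto_eventually)
        qed
      qed (auto simp: indicator_def)
      moreover have "(\<integral>x'. indicator {x. (x, y) \<in> H 0 j} x' - indicator (H 0 j) (x, y) \<partial>\<pi>) = hb j y - indicator (H 0 j) (x, y)" for j
      proof -
        have "integrable \<pi> (indicator {x. (x, y) \<in> H 0 j} :: _ \<Rightarrow> real)"
          by (intro \<pi>.integrable_const_bound[of _ 1]) auto
        then show ?thesis by (subst Bochner_Integration.integral_diff) (auto simp: hb_def \<pi>.prob_space[simplified])
      qed
      ultimately have "(\<lambda>j. hb j y - indicator (H 0 j) (x, y)) \<longlonglongrightarrow> 0" by simp
      then have "\<forall>\<^sub>F j in sequentially. dist (hb j y - indicator (H 0 j) (x, y)) 0 < 1/2"
        by (rule tendstoD) simp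
      then obtain m where m: "\<And>j. j \<ge> m \<Longrightarrow> \<bar>hb j y - indicator (H 0 j) (x, y)\<bar> < 1/2"
        by (auto simp: eventually_sequentially)
      have "((x, y) \<in> H 0 j) = (1/2 < hb j y)" if "j \<ge> m" for j
      proof (cases "(x, y) \<in> H 0 j")
        case True
        then have "\<bar>hb j y - 1\<bar> < 1/2" using m[OF that] by simp
        then have "1/2 < hb j y" by linarith
        then show ?thesis using True by simp
      next
        case False
        then have "\<bar>hb j y\<bar> < 1/2" using m[OF that] by simp
        then have "\<not> 1/2 < hb j y" by linarith
        then show ?thesis using False by simp
      qed
      then show ?case unfolding W_def by auto
    qed
  qed
  \<comment> \<open>Under the product law the claim is \<open>notW\<close> at almost every
    observation path; the equivalence of null sets returns it to the true law, where the state and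
    the observations are dependent.\<close>
  have aeW: "AE \<omega> in M. ((X 0 \<omega>, X 0 \<omega>), snd \<omega>) \<notin> W"
  proof (subst obs_law_null_iff[OF _ W])
    have P: "{w\<in>space (M \<Otimes>\<^sub>M M). ((X 0 (fst w), X 0 (fst w)), snd (snd w)) \<notin> W} \<in> sets (M \<Otimes>\<^sub>M M)"
    proof -
      note W[measurable]
      show ?thesis by measurable
    qed
    have "AE \<omega>' in M. AE \<omega> in M. ((X 0 \<omega>, X 0 \<omega>), snd \<omega>') \<notin> W"
      using q0
    proof eventually_elim
      case (elim \<omega>')
      have "AE x in distr M borel (X 0). ((x, x), snd \<omega>') \<notin> W"
        unfolding X_distr by (rule notW[OF elim])
      moreover have "{x\<in>space borel. ((x, x), snd \<omega>') \<notin> W} \<in> sets borel"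
      proof -
        note W[measurable]
        have "(\<lambda>x. ((x, x), snd \<omega>')) \<in> borel \<rightarrow>\<^sub>M ?BY" by measurable
        from measurable_sets[OF this W] have "{x. ((x, x), snd \<omega>') \<in> W} \<in> sets borel" by (simp add: vimage_def)
        from sets.compl_sets[OF this] show ?thesis by (simp add: Compl_eq_Diff_UNIV[symmetric] Collect_neg_eq)
      qed
      ultimately show ?case by (subst (asm) AE_distr_iff) auto
    qed
    then show "AE \<omega> in M. AE \<omega>' in M. ((X 0 \<omega>, X 0 \<omega>), snd \<omega>') \<notin> W"
      by (subst MM.AE_commute) (use P in simp_all)
  qed simp
  define F where "F j = {\<omega> :: (int, 'e, 'f) path. 1/2 < hb j (snd \<omega>)}" for j
  have Fm[measurable]: "F j \<in> sets M" for j
  proof -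
    have "F j = {\<omega>\<in>space M. 1/2 < hb j (snd \<omega>)}" by (simp add: F_def)
    also have "\<dots> \<in> sets M" by measurable
    finally show ?thesis .
  qed
  have "(\<lambda>j. \<integral>\<omega>. indicator (sym_diff (E 0 j) (F j)) \<omega> \<partial>M) \<longlonglongrightarrow> (\<integral>\<omega>. (0::real) \<partial>M)"
  proof (rule integral_dominated_convergence[where w="\<lambda>_. 1"])
    show "AE \<omega> in M. (\<lambda>j. indicator (sym_diff (E 0 j) (F j)) \<omega> :: real) \<longlonglongrightarrow> 0"
      using aeW
    proof eventually_elim
      case (elim \<omega>)
      then obtain m where "\<forall>j\<ge>m. ((X 0 \<omega>, snd \<omega>) \<in> H 0 j) = (1/2 < hb j (snd \<omega>))"
        unfolding W_def by auto
      then have "\<forall>\<^sub>F j in sequentially. indicator (sym_diff (E 0 j) (F j)) \<omega> = (0::real)"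
        unfolding eventually_sequentially by (intro exI[of _ m]) (auto simp: E_def F_def)
      then show ?case by (rule tendsto_eventually)
    qed
  qed (auto simp: indicator_def)
  then have lim: "(\<lambda>j. measure M (sym_diff (E 0 j) (F j))) \<longlonglongrightarrow> 0" by simp
  show ?thesis
  proof (rule approx_imp_mod_null[OF finM space_M subalg A])
    fix e :: real assume e: "0 < e"
    have "\<forall>\<^sub>F j in sequentially. measure M (sym_diff (E 0 j) (F j)) < e/2"
      using order_tendstoD(2)[OF lim, of "e/2"] e by simp
    moreover have "\<forall>\<^sub>F j in sequentially. (1/2::real)^j < e/2"
      using order_tendstoD(2)[OF LIMSEQ_power_zero[of "1/2::real"], of "e/2"] e by simp
    ultimately have "\<forall>\<^sub>F j in sequentially. measure M (sym_diff (E 0 j) (F j)) < e/2 \<and> (1/2::real)^j < e/2"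
      by eventually_elim simp
    then obtain j where j: "measure M (sym_diff (E 0 j) (F j)) < e/2" "(1/2::real)^j < e/2"
      by (auto simp: eventually_sequentially)
    let ?B = "shift (sh j) -` F j"
    \<comment> \<open>Shifting back undoes the translation in \<open>H 0 j\<close>, so the event is
      expressed by \<open>D j 0\<close> and involves only the observations in
      \<open>T\<close>.\<close>
    have "?B = {\<omega>. 1/2 < measure \<pi> {x. (x, snd \<omega>) \<in> D j 0}}"
      by (auto simp: F_def hb_def H_def shift_def)
    also have "\<dots> = snd -` {y\<in>space (YM T). 1/2 < measure \<pi> {x. (x, y) \<in> D j 0}}" by auto
    also have "\<dots> \<in> FY T"
    proof (rule snd_FY)
      note hb_gen[OF D, measurable]
      show "{y\<in>space (YM T). 1/2 < measure \<pi> {x. (x, y) \<in> D j 0}} \<in> sets (YM T)" by measurable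
    qed
    finally have B: "?B \<in> sets (XY {} T)" by (simp add: sets_XY_FY)
    have "measure M (sym_diff A ?B) \<le> measure M (sym_diff A (E' 0 j)) + measure M (sym_diff (E' 0 j) ?B)"
      by (rule measure_sym_diff_triangle[OF finM A _ sub_M[OF B]]) measurable
    also have "measure M (sym_diff (E' 0 j) ?B) = measure M (shift (sh j) -` sym_diff (E 0 j) (F j))"
      by (simp add: E_sh vimage_Diff vimage_Un)
    also have "\<dots> = measure M (sym_diff (E 0 j) (F j))" by (rule shift_measure) measurable
    also have "measure M (sym_diff A (E' 0 j)) + measure M (sym_diff (E 0 j) (F j)) < e"
      using j D'[of j 0] unfolding E'_def by simp
    finally show "\<exists>B\<in>sets (XY {} T). measure M (sym_diff A B) < e" using B by blast
  qed
qed

end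

theorem theorem4p2:
  fixes P :: "'e::polish_space \<Rightarrow> 'e measure"
    and \<pi> :: "'e measure"
    and \<Phi> :: "'e \<Rightarrow> 'f::polish_space measure"
    and M :: "((int \<Rightarrow> 'e) \<times> (int \<Rightarrow> 'f)) measure"
    and Pz :: "'e \<Rightarrow> ((nat \<Rightarrow> 'e) \<times> (nat \<Rightarrow> 'f)) measure"
  assumes "prob_kernel P"
    and "prob_space \<pi>" and "sets \<pi> = sets borel" and "invariant_law P \<pi>"
    and "prob_kernel \<Phi>"
    and "stationary_hmm P \<pi> \<Phi> M"
    and "\<And>z. hmm_from P \<Phi> z (Pz z)"
    and ergodicity:
      "AE z in \<pi>. (\<lambda>n. tv_dist (distr (Pz z) borel (X n)) \<pi>) \<longlonglongrightarrow> 0"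
    and nondegeneracy: "nondegenerate \<Phi>"
  shows "eq_mod_null M (\<Inter>n::nat. sigma_join (FY {0..}) (FX {int n..})) (FY {0..})
       \<and> eq_mod_null M (\<Inter>n::nat. sigma_join (FY {..0}) (FX {..- int n})) (FY {..0})"
proof -
  obtain \<phi> and g :: "'e \<Rightarrow> 'f \<Rightarrow> real" where \<phi>: "prob_space \<phi>" "sets \<phi> = sets borel"
    "(\<lambda>(z, u). g z u) \<in> borel_measurable (borel \<Otimes>\<^sub>M borel)" "\<And>z u. 0 < g z u"
    "\<And>z A. A \<in> sets borel \<Longrightarrow> emeasure (\<Phi> z) A = (\<integral>\<^sup>+u. indicator A u * ennreal (g z u) \<partial>\<phi>)"
    using nondegeneracy unfolding nondegenerate_def by blast
  have hmm: "hmm P \<Phi> M" and X_distr: "\<And>n. distr M borel (X n) = \<pi>"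
    using \<open>stationary_hmm P \<pi> \<Phi> M\<close> by (simp_all add: stationary_hmm_def)
  interpret nondegenerate_hmm_measure P \<Phi> M \<pi> Pz \<phi> g
    by (intro nondegenerate_hmm_measure.intro ergodic_hmm_measure.intro stationary_hmm_measure.intro
        hmm_measure.intro stationary_hmm_measure_axioms.intro ergodic_hmm_measure_axioms.intro
        nondegenerate_hmm_measure_axioms.intro hmm X_distr ergodicity \<phi> \<open>prob_kernel P\<close> \<open>prob_kernel \<Phi>\<close>
        \<open>\<And>z. hmm_from P \<Phi> z (Pz z)\<close>)
  have join: "sigma_join (FY U) (FX S) = sets (XY S U :: (int, 'e, 'f) path measure)" for S U
    by (simp add: sets_XY_join sigma_join_def Un_commute)
  have sub: "FY U \<subseteq> sets (XY S U :: (int, 'e, 'f) path measure)" for S U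
    using XY_mono[of "{}" S U U] by (simp add: sets_XY_FY)
  have 1: "\<exists>B\<in>FY {0..}. sym_diff A B \<in> null_sets M"
    if A: "\<And>n::nat. A \<in> sets (XY {int n..} {0..})" for A
    using tail_mod_null[of 1 A "{0..}"] tail_future_approx[of A "{0..}"] A sub_M[OF A[of 0]]
    by (simp add: sets_XY_FY)
  have 2: "\<exists>B\<in>FY {..0}. sym_diff A B \<in> null_sets M"
    if A: "\<And>n::nat. A \<in> sets (XY {..- int n} {..0})" for A
    using tail_mod_null[of "-1" A "{..0}"] tail_past_approx[of A "{..0}"] A sub_M[OF A[of 0]]
    by (simp add: sets_XY_FY)
  show ?thesis
    unfolding eq_mod_null_def join
  proof (intro conjI ballI)
    fix B :: "(int, 'e, 'f) path set"
    \<comment> \<open>The observation sigma-field lies in every member of the intersection, so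
      \<open>B\<close> itself serves as the witness.\<close>
    show "\<exists>A\<in>\<Inter>n::nat. sets (XY {int n..} {0..}). sym_diff A B \<in> null_sets M" if "B \<in> FY {0..}"
      using sub that by (intro bexI[of _ B]) auto
    show "\<exists>A\<in>\<Inter>n::nat. sets (XY {..- int n} {..0}). sym_diff A B \<in> null_sets M" if "B \<in> FY {..0}"
      using sub that by (intro bexI[of _ B]) auto
  qed (use 1 2 in auto)
qed

end
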